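(* For $d=2$, $sep_{\mathbb{H}^d}(n)\asymp \log n$, and for every integer $d\ge 3$, $sep_{\mathbb{H}^d}(n)\asymp n^{(d-2)/(d-1)}$. For every integer $d\ge 1$, $sep_{\mathbb{Z}^d}(n)\asymp n^{(d-1)/d}$.
   Context: $\mathbb{H}^d$ is $d$-dimensional real hyperbolic space and $\mathbb{Z}^d$ is the $d$-dimensional integer lattice with its nearest-neighbour graph structure. For functions, $f\asymp g$ means that $f$ and $g$ agree up to positive constant factors (depending on $d$) for all integers $n\ge 2$. Separation: for a finite set $S$ of vertices of a graph $G$, $cut(S)$ is the minimum size of a subset $C_S\subset S$ such that the largest connected component of the subgraph of $G$ induced by $S\setminus C_S$ has fewer than $|S|/2$ vertices. For a positive integer $n$, $sep_G(n)=\sup\{cut(S): S\subset V(G),\ |S|=n\}$. For a manifold $X$ such as $\mathbb{H}^d$, $sep_X$ means $sep_G$ for a connected bounded degree graph $G$ roughly isometric to $X$; up to constant factors this does not depend on the choice of $G$. A map $f:X\to Y$ of metric spaces is a $\kappa$-rough isometry ($\kappa<\infty$) if $\kappa^{-1}d_X(x_1,x_2)-\kappa\le d_Y(f(x_1),f(x_2))\le\kappa d_X(x_1,x_2)+\kappa$ for all $x_1,x_2\in X$ and every $y\in Y$ is within distance $\kappa$ of some $f(x)$; $X$ and $Y$ are roughly isometric if such an $f$ exists for some $\kappa$. *)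

theory Defs
  imports Complex_Main
begin

text \<open>
  A graph is given by its vertex set \<open>V\<close> and its adjacency relation \<open>E\<close>; it may be infinite.
\<close>

definition simple_graph :: "'v set \<Rightarrow> ('v \<times> 'v) set \<Rightarrow> bool" where
  "simple_graph V E \<longleftrightarrow> E \<subseteq> V \<times> V \<and> sym E \<and> irrefl E"

definition connected_graph :: "'v set \<Rightarrow> ('v \<times> 'v) set \<Rightarrow> bool" where
  "connected_graph V E \<longleftrightarrow> (\<forall>u\<in>V. \<forall>v\<in>V. (u, v) \<in> E\<^sup>*)"

definition bounded_degree :: "'v set \<Rightarrow> ('v \<times> 'v) set \<Rightarrow> bool" where
  "bounded_degree V E \<longleftrightarrow> (\<exists>D. \<forall>v\<in>V. finite (E `` {v}) \<and> card (E `` {v}) \<le> D)"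

text \<open>Meaningful only for vertices joined by a path; otherwise the value is unspecified.\<close>

definition graph_dist :: "('v \<times> 'v) set \<Rightarrow> 'v \<Rightarrow> 'v \<Rightarrow> real" where
  "graph_dist E u v = real (LEAST k. (u, v) \<in> E ^^ k)"

text \<open>Vertex sets of the connected components of the subgraph induced by \<open>T\<close>.\<close>

definition induced_components :: "('v \<times> 'v) set \<Rightarrow> 'v set \<Rightarrow> 'v set set" where
  "induced_components E T = {{u \<in> T. (v, u) \<in> (E \<inter> T \<times> T)\<^sup>*} | v. v \<in> T}"

text \<open>
  For finite \<open>T\<close>. The inserted 0 only matters for empty \<open>T\<close>, which has no components.
\<close>

definition largest_component_size :: "('v \<times> 'v) set \<Rightarrow> 'v set \<Rightarrow> nat" where
  "largest_component_size E T = Max (insert 0 (card ` induced_components E T))"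

text \<open>
  For finite nonempty \<open>S\<close>, the minimum is over a finite set that contains \<open>card S\<close>
  (take \<open>C = S\<close>).
\<close>

definition cut :: "('v \<times> 'v) set \<Rightarrow> 'v set \<Rightarrow> nat" where
  "cut E S = Min {card C | C. C \<subseteq> S \<and> real (largest_component_size E (S - C)) < real (card S) / 2}"

text \<open>
  For \<open>n > 0\<close> the values of \<open>cut\<close> are at most \<open>n\<close>, so the supremum in \<^typ>\<open>nat\<close> is genuine;
  it is 0 if the graph has fewer than \<open>n\<close> vertices.
\<close>

definition sep :: "'v set \<Rightarrow> ('v \<times> 'v) set \<Rightarrow> nat \<Rightarrow> nat" where
  "sep V E n = Sup {cut E S | S. S \<subseteq> V \<and> finite S \<and> card S = n}"

definition rough_isometry ::
  "real \<Rightarrow> 'a set \<Rightarrow> ('a \<Rightarrow> 'a \<Rightarrow> real) \<Rightarrow> 'b set \<Rightarrow> ('b \<Rightarrow> 'b \<Rightarrow> real) \<Rightarrow> ('a \<Rightarrow> 'b) \<Rightarrow> bool" where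
  "rough_isometry \<kappa> X dX Y dY f \<longleftrightarrow>
     \<kappa> > 0 \<and> f ` X \<subseteq> Y \<and>
     (\<forall>x1\<in>X. \<forall>x2\<in>X. inverse \<kappa> * dX x1 x2 - \<kappa> \<le> dY (f x1) (f x2) \<and>
                        dY (f x1) (f x2) \<le> \<kappa> * dX x1 x2 + \<kappa>) \<and>
     (\<forall>y\<in>Y. \<exists>x\<in>X. dY y (f x) \<le> \<kappa>)"

definition roughly_isometric ::
  "'a set \<Rightarrow> ('a \<Rightarrow> 'a \<Rightarrow> real) \<Rightarrow> 'b set \<Rightarrow> ('b \<Rightarrow> 'b \<Rightarrow> real) \<Rightarrow> bool" where
  "roughly_isometric X dX Y dY \<longleftrightarrow> (\<exists>\<kappa> f. rough_isometry \<kappa> X dX Y dY f)"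

text \<open>
  The graphs \<open>G\<close> for which \<open>sep\<^sub>G\<close> serves as the separation function of the metric space \<open>(X, dX)\<close>.
\<close>

definition discretization ::
  "'v set \<Rightarrow> ('v \<times> 'v) set \<Rightarrow> 'a set \<Rightarrow> ('a \<Rightarrow> 'a \<Rightarrow> real) \<Rightarrow> bool" where
  "discretization V E X dX \<longleftrightarrow>
     simple_graph V E \<and> connected_graph V E \<and> bounded_degree V E \<and>
     roughly_isometric V (graph_dist E) X dX"

text \<open>
  Points of real or integer \<open>d\<close>-space are functions on \<^typ>\<open>nat\<close> that vanish at all indices
  \<open>i \<ge> d\<close>, as in the library's \<open>Euclidean_space\<close> topology, so that \<open>d\<close> can be quantified over.

  Hyperbolic \<open>d\<close>-space (\<open>d \<ge> 1\<close>, curvature \<open>-1\<close> if \<open>d \<ge> 2\<close>) is the upper half-space model. The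
  positive (height) coordinate is the one with index 0, and the Riemannian distance \<open>\<rho>\<close> satisfies
  \<open>cosh \<rho>(x, y) = 1 + |x - y|\<^sup>2 / (2 x\<^sub>0 y\<^sub>0)\<close>.
\<close>

definition hyp_space :: "nat \<Rightarrow> (nat \<Rightarrow> real) set" where
  "hyp_space d = {x. 0 < x 0 \<and> (\<forall>i\<ge>d. x i = 0)}"

definition hyp_dist :: "nat \<Rightarrow> (nat \<Rightarrow> real) \<Rightarrow> (nat \<Rightarrow> real) \<Rightarrow> real" where
  "hyp_dist d x y = arcosh (1 + (\<Sum>i<d. (x i - y i)\<^sup>2) / (2 * x 0 * y 0))"

definition lattice_verts :: "nat \<Rightarrow> (nat \<Rightarrow> int) set" where
  "lattice_verts d = {x. \<forall>i\<ge>d. x i = 0}"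

definition lattice_edges :: "nat \<Rightarrow> ((nat \<Rightarrow> int) \<times> (nat \<Rightarrow> int)) set" where
  "lattice_edges d =
     {(x, y). x \<in> lattice_verts d \<and> y \<in> lattice_verts d \<and> (\<Sum>i<d. \<bar>x i - y i\<bar>) = 1}"

definition same_growth :: "(nat \<Rightarrow> real) \<Rightarrow> (nat \<Rightarrow> real) \<Rightarrow> bool"  (infix "\<asymp>" 50) where
  "f \<asymp> g \<longleftrightarrow> (\<exists>c>0. \<exists>C>0. \<forall>n\<ge>2. c * g n \<le> f n \<and> f n \<le> C * g n)"

end

theory Submission imports Defs "HOL-Library.FuncSet" begin

text \<open>
  Upper bounds: let \<open>S\<close> be \<open>n\<close> points of the upper half-space of dimension \<open>d\<close>, boundedly many of them
  in every unit ball. Take the smallest dyadic box standing on the boundary that contains a fixed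
  proportion of \<open>S\<close>, say of side \<open>t\<close>, and enlarge its side to \<open>s\<close>, with \<open>s\<close> varying in \<open>[t, 2 t)\<close>. The
  enlarged box does not contain much more, as it is covered by boundedly many smaller boxes and a
  bounded region. A point at height \<open>h\<close> is close to the sides of the box for a proportion of order
  \<open>h / t\<close> of the values \<open>s\<close>, so some box is separated from its complement by about
  \<open>\<Sum>h / t\<close> points. There are at most \<open>2\<^bsup>l (d - 1)\<^esup>\<close> points, up to a constant, at height about
  \<open>2\<^bsup>-l\<^esup> t\<close>, so this sum is at most of order \<open>\<Sum>l\<le>log n / (d - 1). 2\<^bsup>l (d - 2)\<^esup>\<close>. Boundedly many boxes cut \<open>S\<close>
  into small pieces. The lattice \<open>\<int>\<^sup>d\<close> is covered by the same argument, being a horosphere in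
  dimension \<open>d + 1\<close>.

  Lower bounds: a separator of size \<open>\<epsilon> m\<^bsup>D - 1\<^esup>\<close> leaves most pairs of points of the cube \<open>[0, m)\<^bsup>D\<^esup>\<close>
  joined by their coordinatewise path. This gives the bound for \<open>\<int>\<^sup>D\<close> and, on a horosphere, for
  hyperbolic space of dimension \<open>D + 1\<close>. In the hyperbolic plane the cube is replaced by a binary tree
  with horizontal edges: a separator of size \<open>\<epsilon> log n\<close> misses a whole row of medium height, and few of
  the vertices below this row are cut off from it.
\<close>

section \<open>Components and cuts\<close>

text \<open>All upper bounds rest on one number: the sum of the heights of the points of
  \<open>S\<close> in a box, divided by the size \<open>t\<close> of the box. Averaging turns it
  into a bound for the points close to the sides, Markov's inequality into one for the points so
  high that an edge might leave through the top. A dyadic layer adds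
  \<open>2 ^ (l * (d - 2))\<close> to it: for \<open>d = 2\<close> all scales weigh the same and
  their number is the answer, for \<open>d \<ge> 3\<close> the lowest counted scale dominates. Only
  the line escapes this estimate, which would give it a logarithm as a horocycle of the plane; there
  the sum of the heights is computed directly.

  Two obstacles shape the lower bounds. They concern every \<open>n\<close>, while the models have
  sizes of their own: so consecutive models differ by a factor tending to 1, and a set of exactly
  \<open>n\<close> vertices is squeezed between two of them. And the graph is only roughly isometric
  to the space: so a vertex of the model becomes a ball of the graph, large enough that balls of
  adjacent vertices meet.\<close>

definition component :: "('v \<times> 'v) set \<Rightarrow> 'v set \<Rightarrow> 'v \<Rightarrow> 'v set" where
  "component E T v = {u \<in> T. (v, u) \<in> (E \<inter> T \<times> T)\<^sup>*}"

text \<open>The threshold is a parameter because separators are built by splitting off pieces: the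
  set shrinks while the threshold stays half the size of the original set.\<close>

definition shattered :: "('v \<times> 'v) set \<Rightarrow> real \<Rightarrow> 'v set \<Rightarrow> bool" where
  "shattered E b T \<longleftrightarrow> (\<forall>v\<in>T. real (card (component E T v)) < b)"

text \<open>\<open>0 < b\<close> takes care of the empty set, whose largest component has size 0 by
  convention.\<close>

lemma largest_component_size_less_iff:
  assumes "finite T" "0 < b"
  shows "real (largest_component_size E T) < b \<longleftrightarrow> shattered E b T"
proof -
  have ic: "induced_components E T = component E T ` T"
    by (auto simp: induced_components_def component_def)
  have fin: "finite (insert 0 (card ` induced_components E T))"
    using assms(1) by (simp add: ic)
  show ?thesis
  proof
    assume L: "real (largest_component_size E T) < b"
    show "shattered E b T" unfolding shattered_def
    proof
      fix v assume "v \<in> T"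
      then have "card (component E T v) \<in> insert 0 (card ` induced_components E T)"
        by (simp add: ic)
      from Max_ge[OF fin this] have "card (component E T v) \<le> largest_component_size E T"
        by (simp add: largest_component_size_def)
      with L show "real (card (component E T v)) < b" by linarith
    qed
  next
    assume R: "shattered E b T"
    have "largest_component_size E T \<in> insert 0 (card ` induced_components E T)"
      unfolding largest_component_size_def using fin by (intro Max_in) auto
    then show "real (largest_component_size E T) < b"
      using R assms(2) by (auto simp: ic shattered_def)
  qed
qed

lemma cut_eq:
  assumes "finite S" "S \<noteq> {}"
  shows "cut E S = Min (card ` {C. C \<subseteq> S \<and> shattered E (real (card S) / 2) (S - C)})"
proof -
  have "real (card S) / 2 > 0" using assms by (simp add: card_gt_0_iff)
  then have "\<And>C. real (largest_component_size E (S - C)) < real (card S) / 2 \<longleftrightarrow>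
      shattered E (real (card S) / 2) (S - C)"
    using assms(1) by (intro largest_component_size_less_iff) auto
  then have "{card C | C. C \<subseteq> S \<and> real (largest_component_size E (S - C)) < real (card S) / 2} =
      card ` {C. C \<subseteq> S \<and> shattered E (real (card S) / 2) (S - C)}"
    by auto
  then show ?thesis by (simp add: cut_def)
qed

lemma cut_le:
  assumes "finite S" "S \<noteq> {}" "C \<subseteq> S" "shattered E (real (card S) / 2) (S - C)"
  shows "cut E S \<le> card C"
  unfolding cut_eq[OF assms(1,2)] using assms by (intro Min_le) auto

lemma cut_ge:
  assumes "finite S" "S \<noteq> {}"
    and "\<And>C. C \<subseteq> S \<Longrightarrow> shattered E (real (card S) / 2) (S - C) \<Longrightarrow> b \<le> real (card C)"
  shows "b \<le> real (cut E S)"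
proof -
  let ?X = "{C. C \<subseteq> S \<and> shattered E (real (card S) / 2) (S - C)}"
  have "S \<in> ?X" by (simp add: shattered_def)
  moreover have "finite ?X" using assms(1) by auto
  ultimately have "cut E S \<in> card ` ?X"
    unfolding cut_eq[OF assms(1,2)] by (intro Min_in) auto
  then show ?thesis using assms(3) by auto
qed

lemma cut_le_card:
  assumes "finite S" "S \<noteq> {}"
  shows "cut E S \<le> card S"
  by (rule cut_le[OF assms]) (auto simp: shattered_def)

lemma cut_le_sep:
  assumes "0 < n" "S \<subseteq> V" "finite S" "card S = n"
  shows "cut E S \<le> sep V E n"
proof -
  have "\<forall>k \<in> {cut E S | S. S \<subseteq> V \<and> finite S \<and> card S = n}. k \<le> n"
    using assms(1) cut_le_card by (fastforce simp: card_gt_0_iff)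
  then have "bdd_above {cut E S | S. S \<subseteq> V \<and> finite S \<and> card S = n}"
    by (auto simp: bdd_above_def)
  then show ?thesis unfolding sep_def using assms by (intro cSup_upper) auto
qed

lemma sep_le:
  assumes "0 \<le> b" and "\<And>S. S \<subseteq> V \<Longrightarrow> finite S \<Longrightarrow> card S = n \<Longrightarrow> real (cut E S) \<le> b"
  shows "real (sep V E n) \<le> b"
proof (cases "{cut E S | S. S \<subseteq> V \<and> finite S \<and> card S = n} = {}")
  case True
  then show ?thesis using assms(1) unfolding sep_def by (simp add: Sup_nat_def)
next
  case False
  have "sep V E n \<le> nat \<lfloor>b\<rfloor>"
    unfolding sep_def
    by (rule cSup_least[OF False]) (use assms in \<open>auto simp: le_nat_floor\<close>)
  then show ?thesis using assms(1) by linarith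
qed

text \<open>A path that starts in \<open>A\<close> can never cross to \<open>B\<close>, so it
  already runs in the subgraph on \<open>A\<close>.\<close>

lemma component_Un:
  assumes "\<And>u w. u \<in> A \<Longrightarrow> w \<in> B \<Longrightarrow> (u, w) \<notin> E \<and> (w, u) \<notin> E"
  shows "v \<in> A \<Longrightarrow> component E (A \<union> B) v \<subseteq> component E A v"
proof -
  assume v: "v \<in> A"
  have "u \<in> A \<and> (v, u) \<in> (E \<inter> A \<times> A)\<^sup>*" if "(v, u) \<in> (E \<inter> (A \<union> B) \<times> (A \<union> B))\<^sup>*" for u
    using that
  proof induction
    case base
    then show ?case using v by simp
  next
    case (step y z)
    then have "(y, z) \<in> E \<inter> A \<times> A" using assms[of y z] assms[of z y] by auto
    then show ?case using step by (meson IntD2 SigmaD2 rtrancl.rtrancl_into_rtrancl)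
  qed
  then show ?thesis by (auto simp: component_def)
qed

lemma shattered_Un:
  assumes "finite A" "finite B"
    and "\<And>u w. u \<in> A \<Longrightarrow> w \<in> B \<Longrightarrow> (u, w) \<notin> E \<and> (w, u) \<notin> E"
    and "shattered E b A" "shattered E b B"
  shows "shattered E b (A \<union> B)"
  unfolding shattered_def
proof
  fix v assume "v \<in> A \<union> B"
  moreover have "real (card (component E (A \<union> B) v)) < b" if "v \<in> A"
  proof -
    have "card (component E (A \<union> B) v) \<le> card (component E A v)"
      using assms(1) by (intro card_mono component_Un that assms(3)) (auto simp: component_def)
    then show ?thesis using assms(4) that by (force simp: shattered_def)
  qed
  moreover have "real (card (component E (A \<union> B) v)) < b" if "v \<in> B"
  proof -
    have "component E (B \<union> A) v \<subseteq> component E B v"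
      using assms(3) by (intro component_Un that) auto
    then have "card (component E (A \<union> B) v) \<le> card (component E B v)"
      using assms(2) by (intro card_mono) (auto simp: component_def Un_commute)
    then show ?thesis using assms(5) that by (force simp: shattered_def)
  qed
  ultimately show "real (card (component E (A \<union> B) v)) < b" by blast
qed

lemma shattered_small:
  assumes "finite A" "real (card A) < b"
  shows "shattered E b A"
  unfolding shattered_def
proof
  fix v
  have "card (component E A v) \<le> card A"
    using assms(1) by (intro card_mono) (auto simp: component_def)
  then show "real (card (component E A v)) < b" using assms(2) by linarith
qed

text \<open>The empty separator leaves a connected set in one piece, which is too large. This serves
  the finitely many small \<open>n\<close> in the lower bounds.\<close>

lemma one_le_cut:
  assumes "finite S" "S \<noteq> {}" "\<And>u v. u \<in> S \<Longrightarrow> v \<in> S \<Longrightarrow> (u, v) \<in> (E \<inter> S \<times> S)\<^sup>*"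
  shows "1 \<le> cut E S"
proof -
  have "(1::real) \<le> real (cut E S)"
  proof (rule cut_ge[OF assms(1,2)])
    fix C assume C: "C \<subseteq> S" "shattered E (real (card S) / 2) (S - C)"
    obtain v where v: "v \<in> S" using assms(2) by blast
    have "C \<noteq> {}"
    proof
      assume "C = {}"
      moreover have "component E S v = S" using assms(3) v by (auto simp: component_def)
      ultimately show False using C v assms(1) by (auto simp: shattered_def card_gt_0_iff)
    qed
    then have "card C \<noteq> 0" using assms(1) C(1) finite_subset by fastforce
    then show "1 \<le> real (card C)" by simp
  qed
  then show ?thesis by simp
qed

lemma card_le_fibres:
  assumes "finite I" "h ` A \<subseteq> I" "finite A" "\<And>i. i \<in> I \<Longrightarrow> real (card {x \<in> A. h x = i}) \<le> b"
  shows "real (card A) \<le> real (card I) * b"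
proof -
  have "A = (\<Union>i\<in>I. {x \<in> A. h x = i})" using assms(2) by auto
  then have "card A \<le> (\<Sum>i\<in>I. card {x \<in> A. h x = i})"
    using card_UN_le[OF assms(1)] by metis
  then have "real (card A) \<le> (\<Sum>i\<in>I. real (card {x \<in> A. h x = i}))"
    by (metis of_nat_le_iff of_nat_sum)
  also have "\<dots> \<le> real (card I) * b"
    using sum_bounded_above[of I "\<lambda>i. real (card {x \<in> A. h x = i})" b] assms(4) by simp
  finally show ?thesis .
qed

section \<open>Separating by boxes in the half-space\<close>

text \<open>
  On the half-space, \<open>near d K\<close> for some \<open>K\<close> means bounded \<open>hyp_dist d\<close>. It is visibly transitive up to
  a change of \<open>K\<close>, which replaces the triangle inequality for \<open>hyp_dist\<close>.
\<close>

definition near :: "nat \<Rightarrow> real \<Rightarrow> (nat \<Rightarrow> real) \<Rightarrow> (nat \<Rightarrow> real) \<Rightarrow> bool" where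
  "near d K x y \<longleftrightarrow> (\<Sum>i<d. (x i - y i)\<^sup>2) \<le> K * x 0 * y 0"

text \<open>Within the half-space, all these boxes are images of one another under translations
  along the boundary and dilations, hence under hyperbolic isometries.\<close>

definition box :: "nat \<Rightarrow> (nat \<Rightarrow> real) \<Rightarrow> real \<Rightarrow> (nat \<Rightarrow> real) set" where
  "box d a t = {x. x 0 \<le> t \<and> (\<forall>i\<in>{1..<d}. \<bar>x i - a i\<bar> \<le> t)}"

lemma near_sym: "near d K x y \<longleftrightarrow> near d K y x"
  by (simp add: near_def power2_commute[of "x _" "y _"] mult_ac)

lemma near_coord:
  assumes "near d K x y" "i < d"
  shows "(x i - y i)\<^sup>2 \<le> K * x 0 * y 0"
proof -
  have "(x i - y i)\<^sup>2 \<le> (\<Sum>i<d. (x i - y i)\<^sup>2)"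
    using assms(2) by (intro member_le_sum) auto
  then show ?thesis using assms(1) by (simp add: near_def)
qed

text \<open>Expand the square of the height difference, drop the square of \<open>y 0\<close> and
  divide by \<open>x 0\<close>.\<close>

lemma near_height:
  assumes "near d K x y" "0 < d" "0 < x 0" "0 < y 0"
  shows "x 0 \<le> (K + 2) * y 0"
proof -
  have "(x 0 - y 0)\<^sup>2 \<le> K * x 0 * y 0" using near_coord[OF assms(1,2)] .
  then have "x 0 * x 0 \<le> x 0 * ((K + 2) * y 0) - (y 0)\<^sup>2"
    by (simp add: power2_eq_square algebra_simps)
  then have "x 0 * x 0 \<le> x 0 * ((K + 2) * y 0)"
    using zero_le_power2[of "y 0"] by linarith
  then show ?thesis using assms(3) by simp
qed

lemma near_nonneg:
  assumes "near d K x y" "0 < x 0" "0 < y 0"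
  shows "0 \<le> K"
proof -
  have "0 \<le> K * (x 0 * y 0)"
    using assms(1) sum_nonneg[of "{..<d}" "\<lambda>i. (x i - y i)\<^sup>2"] by (simp add: near_def mult.assoc)
  then show ?thesis using mult_pos_pos[OF assms(2,3)] by (auto simp: zero_le_mult_iff)
qed

text \<open>Trading \<open>y 0\<close> for \<open>(K + 2) * x 0\<close> in the bound
  \<open>K * x 0 * y 0\<close> makes it at most the square of \<open>(K + 2) * x 0\<close>.\<close>

lemma near_coord_abs:
  assumes "near d K x y" "i < d" "0 < x 0" "0 < y 0"
  shows "\<bar>x i - y i\<bar> \<le> (K + 2) * x 0"
proof -
  have K: "0 \<le> K" using near_nonneg[OF assms(1,3,4)] .
  have "y 0 \<le> (K + 2) * x 0" using near_height[of d K y x] assms near_sym by fastforce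
  then have "K * x 0 * y 0 \<le> K * x 0 * ((K + 2) * x 0)"
    using K assms by (intro mult_left_mono) auto
  also have "\<dots> \<le> (K + 2) * x 0 * ((K + 2) * x 0)"
    using K assms by (intro mult_right_mono) auto
  finally have "(x i - y i)\<^sup>2 \<le> ((K + 2) * x 0)\<^sup>2"
    using near_coord[OF assms(1,2)] by (simp add: power2_eq_square)
  then show ?thesis using K assms(3) by (simp add: abs_le_square_iff[symmetric])
qed

text \<open>The square of a sum is at most twice the sum of the squares; the middle height
  \<open>y 0\<close> is then replaced by a multiple of \<open>z 0\<close> in one term and of
  \<open>x 0\<close> in the other.\<close>

lemma near_trans:
  assumes "near d K x y" "near d L y z" "0 < d" "0 < x 0" "0 < y 0" "0 < z 0"
  shows "near d (2 * K * (L + 2) + 2 * L * (K + 2)) x z"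
proof -
  have KL: "0 \<le> K" "0 \<le> L" using near_nonneg assms by blast+
  have yz: "y 0 \<le> (L + 2) * z 0" using near_height[OF assms(2,3)] assms by simp
  have yx: "y 0 \<le> (K + 2) * x 0" using near_height[of d K y x] assms near_sym by fastforce
  have "(\<Sum>i<d. (x i - z i)\<^sup>2) \<le> (\<Sum>i<d. 2 * (x i - y i)\<^sup>2 + 2 * (y i - z i)\<^sup>2)"
  proof (rule sum_mono)
    fix i
    have "0 \<le> ((x i - y i) - (y i - z i))\<^sup>2" by simp
    then show "(x i - z i)\<^sup>2 \<le> 2 * (x i - y i)\<^sup>2 + 2 * (y i - z i)\<^sup>2"
      by (simp add: power2_eq_square algebra_simps)
  qed
  also have "\<dots> \<le> 2 * (K * x 0 * y 0) + 2 * (L * y 0 * z 0)"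
    using assms(1,2) by (simp add: near_def sum.distrib flip: sum_distrib_left)
  also have "\<dots> \<le> 2 * (K * x 0 * ((L + 2) * z 0)) + 2 * (L * ((K + 2) * x 0) * z 0)"
    using KL assms yz yx by (intro add_mono mult_left_mono mult_right_mono) auto
  finally show ?thesis by (simp add: near_def algebra_simps)
qed

section \<open>Choosing a box: minimality and averaging\<close>

lemma card_nat_interval_le:
  fixes p l :: real
  assumes "0 \<le> l"
  shows "real (card {j. j < n \<and> p \<le> real j \<and> real j < p + l}) \<le> l + 1"
proof -
  have "card {j. j < n \<and> p \<le> real j \<and> real j < p + l} \<le> card {\<lceil>p\<rceil>..<\<lceil>p + l\<rceil>}"
  proof (rule card_inj_on_le[where f = int])
    show "int ` {j. j < n \<and> p \<le> real j \<and> real j < p + l} \<subseteq> {\<lceil>p\<rceil>..<\<lceil>p + l\<rceil>}"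
      by (auto simp: ceiling_le_iff less_ceiling_iff)
  qed auto
  then have "card {j. j < n \<and> p \<le> real j \<and> real j < p + l} \<le> nat (\<lceil>p + l\<rceil> - \<lceil>p\<rceil>)" by simp
  moreover have "real (nat (\<lceil>p + l\<rceil> - \<lceil>p\<rceil>)) \<le> l + 1" using assms by linarith
  ultimately show ?thesis by linarith
qed

lemma finite_average:
  fixes c :: "nat \<Rightarrow> real"
  assumes "0 < n" "(\<Sum>j<n. c j) \<le> real n * b"
  obtains j where "j < n" "c j \<le> b"
proof -
  have "\<exists>j<n. c j \<le> b"
  proof (rule ccontr)
    assume "\<not> ?thesis"
    then have "(\<Sum>j<n. b) < (\<Sum>j<n. c j)" using assms(1) by (intro sum_strict_mono) auto
    then show False using assms(2) by simp
  qed
  then show ?thesis using that by blast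
qed

text \<open>A large box contains all of \<open>S\<close> and a box lower than all of
  \<open>S\<close> contains nothing, so there is a least dyadic scale at which some box has
  \<open>m\<close> points. At half this scale every box fails, whatever its centre.\<close>

lemma minimal_box:
  fixes F :: "'v \<Rightarrow> nat \<Rightarrow> real"
  assumes "finite S" "\<And>v. v \<in> S \<Longrightarrow> 0 < F v 0" "0 < m" "m \<le> real (card S)"
  obtains a t where "0 < t" "m \<le> real (card {v \<in> S. F v \<in> box d a t})"
    "\<And>b. real (card {v \<in> S. F v \<in> box d b (t / 2)}) < m"
proof -
  define P where "P k \<longleftrightarrow> (\<exists>a. m \<le> real (card {v \<in> S. F v \<in> box d a (2 powi k)}))" for k :: int
  \<comment> \<open>\<open>Suc d\<close> instead of \<open>d\<close> keeps the height coordinate 0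
    in the sum even for \<open>d = 0\<close>.\<close>
  define R where "R = (\<Sum>v\<in>S. \<Sum>i<Suc d. \<bar>F v i\<bar>)"
  obtain N :: nat where N: "R < 2 ^ N" using real_arch_pow[of 2 R] by auto
  have "S \<noteq> {}" using assms(3,4) by auto
  define h where "h = Min ((\<lambda>v. F v 0) ` S)"
  have h: "0 < h" "\<And>v. v \<in> S \<Longrightarrow> h \<le> F v 0"
    using assms(1,2) \<open>S \<noteq> {}\<close> by (auto simp: h_def)
  obtain M :: nat where M: "1 / h < 2 ^ M" using real_arch_pow[of 2 "1 / h"] by auto
  have PN: "P (int N)"
  proof -
    have "\<bar>F v i\<bar> \<le> 2 ^ N" if "v \<in> S" "i < Suc d" for v i
    proof -
      have "\<bar>F v i\<bar> \<le> (\<Sum>i<Suc d. \<bar>F v i\<bar>)" using that by (intro member_le_sum) auto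
      also have "\<dots> \<le> R" unfolding R_def using that assms(1)
        by (intro member_le_sum[of v S "\<lambda>v. \<Sum>i<Suc d. \<bar>F v i\<bar>"]) (auto intro: sum_nonneg)
      finally show ?thesis using N by linarith
    qed
    then have "{v \<in> S. F v \<in> box d (\<lambda>_. 0) (2 powi int N)} = S"
      by (force simp: box_def)
    then show ?thesis using assms(4) unfolding P_def by metis
  qed
  have nP: "k > - int M" if "P k" for k
  proof (rule ccontr)
    assume "\<not> k > - int M"
    then have "(2::real) powi k \<le> 2 powi (- int M)" by (intro power_int_increasing) auto
    also have "\<dots> < h" using M h(1) by (simp add: power_int_minus field_simps)
    finally have "{v \<in> S. F v \<in> box d a (2 powi k)} = {}" for a
      using h(2) by (force simp: box_def)
    then have "\<not> m \<le> real (card {v \<in> S. F v \<in> box d a (2 powi k)})" for a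
      using assms(3) by (metis card.empty not_le of_nat_0)
    then show False using that by (simp add: P_def)
  qed
  \<comment> \<open>The shift by \<open>M\<close> makes the integer exponents natural, so that
    \<open>LEAST\<close> applies.\<close>
  define Q where "Q j \<longleftrightarrow> P (int j - int M)" for j
  have "Q (N + M)" using PN by (simp add: Q_def)
  define j where "j = (LEAST j. Q j)"
  have Qj: "Q j" unfolding j_def using \<open>Q (N + M)\<close> by (rule LeastI)
  have j0: "j > 0" using nP[of "int j - int M"] Qj by (simp add: Q_def)
  have nQ: "\<not> Q (j - 1)" using j0 unfolding j_def by (metis diff_less not_less_Least zero_less_one)
  define t :: real where "t = 2 powi (int j - int M)"
  have "t / 2 = 2 powi (int (j - 1) - int M)"
  proof -
    have "int (j - 1) - int M = (int j - int M) - 1" using j0 by simp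
    then show ?thesis by (simp add: t_def power_int_diff)
  qed
  then have "\<And>b. real (card {v \<in> S. F v \<in> box d b (t / 2)}) < m"
    using nQ unfolding Q_def P_def by (metis not_le)
  moreover obtain a where "m \<le> real (card {v \<in> S. F v \<in> box d a t})"
    using Qj unfolding Q_def P_def t_def by blast
  moreover have "0 < t" by (simp add: t_def)
  ultimately show ?thesis using that by blast
qed

text \<open>Cut the base into cells of side \<open>t\<close>. Offsets between \<open>- 2 * t\<close>
  and \<open>2 * t\<close> have five possible floors in each of the \<open>d - 1\<close> directions,
  and a cell up to height \<open>t / 2\<close> is a box of size \<open>t / 2\<close>.\<close>

lemma low_part_of_double_box:
  fixes F :: "'v \<Rightarrow> nat \<Rightarrow> real"
  assumes "finite S" "0 < t" "\<And>b. real (card {v \<in> S. F v \<in> box d b (t / 2)}) \<le> m"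
  shows "real (card {v \<in> S. F v \<in> box d a (2 * t) \<and> F v 0 \<le> t / 2}) \<le> 5 ^ (d - 1) * m"
proof -
  let ?A = "{v \<in> S. F v \<in> box d a (2 * t) \<and> F v 0 \<le> t / 2}"
  define h where "h v = restrict (\<lambda>i. \<lfloor>(F v i - a i) / t\<rfloor>) {1..<d}" for v
  define I where "I = PiE {1..<d} (\<lambda>_. {-2..2::int})"
  have "real (card ?A) \<le> real (card I) * m"
  proof (rule card_le_fibres)
    show "finite I" by (simp add: I_def finite_PiE)
    show "h ` ?A \<subseteq> I"
    proof
      fix y assume "y \<in> h ` ?A"
      then obtain v where v: "v \<in> ?A" "y = h v" by blast
      have "\<lfloor>(F v i - a i) / t\<rfloor> \<in> {-2..2}" if "i \<in> {1..<d}" for i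
      proof -
        have "\<bar>F v i - a i\<bar> \<le> 2 * t" using v(1) that by (auto simp: box_def)
        then have "-2 \<le> (F v i - a i) / t" "(F v i - a i) / t \<le> 2"
          using assms(2) by (auto simp: field_simps)
        then show ?thesis by (simp add: le_floor_iff floor_le_iff)
      qed
      then show "y \<in> I" by (auto simp: v(2) h_def I_def)
    qed
    show "finite ?A" using assms(1) by simp
    fix k assume "k \<in> I"
    define b where "b i = a i + (real_of_int (k i) + 1 / 2) * t" for i
    have "{v \<in> ?A. h v = k} \<subseteq> {v \<in> S. F v \<in> box d b (t / 2)}"
    proof
      fix v assume "v \<in> {v \<in> ?A. h v = k}"
      then have v: "v \<in> S" "F v 0 \<le> t / 2" "h v = k" by auto
      have "\<bar>F v i - b i\<bar> \<le> t / 2" if "i \<in> {1..<d}" for i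
      proof -
        have "k i = \<lfloor>(F v i - a i) / t\<rfloor>" using that v(3) by (auto simp: h_def)
        then have "real_of_int (k i) \<le> (F v i - a i) / t" "(F v i - a i) / t < real_of_int (k i) + 1"
          by linarith+
        then have "real_of_int (k i) * t \<le> F v i - a i" "F v i - a i < (real_of_int (k i) + 1) * t"
          using assms(2) by (auto simp: field_simps)
        then have "F v i - b i \<le> t / 2" "b i - F v i \<le> t / 2"
          by (simp_all add: b_def algebra_simps)
        then show ?thesis by linarith
      qed
      then show "v \<in> {v \<in> S. F v \<in> box d b (t / 2)}" using v by (auto simp: box_def)
    qed
    then have "card {v \<in> ?A. h v = k} \<le> card {v \<in> S. F v \<in> box d b (t / 2)}"
      using assms(1) by (intro card_mono) auto
    then show "real (card {v \<in> ?A. h v = k}) \<le> m" using assms(3)[of b] by linarith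
  qed
  also have "card I = 5 ^ (d - 1)" by (simp add: I_def card_PiE)
  finally show ?thesis by simp
qed

text \<open>A point counts for \<open>s\<close> only while \<open>s\<close> is in an interval of
  length \<open>L * F v 0\<close>, so the average over \<open>s\<close> is governed by the sum of
  the heights. The average runs over \<open>n\<close> equally spaced values; an interval may catch
  one value more than its length predicts, and \<open>card W \<le> n\<close> keeps this error at 1
  per direction.\<close>

lemma box_boundary_average:
  fixes F :: "'v \<Rightarrow> nat \<Rightarrow> real"
  assumes "finite W" "card W \<le> n" "0 < n" "0 < t" "0 \<le> L" "\<And>v. v \<in> W \<Longrightarrow> 0 < F v 0"
    and "(\<Sum>v\<in>W. F v 0) \<le> \<Phi> * t"
  obtains s where "t \<le> s" "s < 2 * t"
    "real (card {v \<in> W. \<exists>i\<in>{1..<d}. \<bar>F v i - a i\<bar> \<le> s \<and> s < \<bar>F v i - a i\<bar> + L * F v 0})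
      \<le> real (d - 1) * (L * \<Phi> + 1)"
proof -
  define s where "s j = t + t * real j / real n" for j
  define X where "X v i = {j. j < n \<and> \<bar>F v i - a i\<bar> \<le> s j \<and> s j < \<bar>F v i - a i\<bar> + L * F v 0}" for v i
  define Y where "Y j = {v \<in> W. \<exists>i\<in>{1..<d}. j \<in> X v i}" for j
  have X: "real (card (X v i)) \<le> real n * L * F v 0 / t + 1" if "v \<in> W" for v i
  proof -
    define p where "p = (\<bar>F v i - a i\<bar> - t) * real n / t"
    have "X v i = {j. j < n \<and> p \<le> real j \<and> real j < p + real n * L * F v 0 / t}"
      using assms(3,4) by (auto simp: X_def p_def s_def field_simps)
    moreover have "0 \<le> real n * L * F v 0 / t" using assms(4,5) assms(6)[OF that] by simp
    ultimately show ?thesis using card_nat_interval_le by metis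
  qed
  have Yeq: "real (card (Y j)) \<le> (\<Sum>v\<in>W. \<Sum>i\<in>{1..<d}. if j \<in> X v i then 1 else 0)" for j
  proof -
    have "real (card (Y j)) = (\<Sum>v\<in>W. if \<exists>i\<in>{1..<d}. j \<in> X v i then 1 else 0)"
      using assms(1) by (simp add: Y_def sum.If_cases Int_def)
    also have "\<dots> \<le> (\<Sum>v\<in>W. \<Sum>i\<in>{1..<d}. if j \<in> X v i then 1 else 0)"
    proof (rule sum_mono)
      fix v
      show "(if \<exists>i\<in>{1..<d}. j \<in> X v i then 1 else 0) \<le> (\<Sum>i\<in>{1..<d}. if j \<in> X v i then 1 else (0::real))"
      proof (cases "\<exists>i\<in>{1..<d}. j \<in> X v i")
        case True
        then obtain i where i: "i \<in> {1..<d}" "j \<in> X v i" by blast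
        have "(if j \<in> X v i then 1 else (0::real)) \<le> (\<Sum>i\<in>{1..<d}. if j \<in> X v i then 1 else (0::real))"
          using i(1) by (intro member_le_sum) auto
        then show ?thesis using True i by simp
      qed (simp add: sum_nonneg)
    qed
    finally show ?thesis .
  qed
  have "(\<Sum>j<n. real (card (Y j))) \<le> (\<Sum>j<n. \<Sum>v\<in>W. \<Sum>i\<in>{1..<d}. if j \<in> X v i then 1 else 0)"
    by (intro sum_mono Yeq)
  also have "\<dots> = (\<Sum>v\<in>W. \<Sum>j<n. \<Sum>i\<in>{1..<d}. if j \<in> X v i then 1 else 0)" by (rule sum.swap)
  also have "\<dots> = (\<Sum>v\<in>W. \<Sum>i\<in>{1..<d}. \<Sum>j<n. if j \<in> X v i then 1 else 0)"
    by (intro sum.cong refl sum.swap)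
  also have "\<dots> = (\<Sum>v\<in>W. \<Sum>i\<in>{1..<d}. real (card (X v i)))"
  proof (intro sum.cong refl)
    fix v i
    have "{..<n} \<inter> X v i = X v i" by (auto simp: X_def)
    then show "(\<Sum>j<n. if j \<in> X v i then 1 else 0) = real (card (X v i))"
      by (simp add: sum.If_cases)
  qed
  also have "\<dots> \<le> (\<Sum>v\<in>W. \<Sum>i\<in>{1..<d}. real n * L * F v 0 / t + 1)"
    by (intro sum_mono X)
  also have "\<dots> = real (d - 1) * (real n * L / t * (\<Sum>v\<in>W. F v 0) + real (card W))"
    by (simp add: sum.distrib sum_distrib_left sum_divide_distrib algebra_simps)
  also have "\<dots> \<le> real (d - 1) * (real n * L / t * (\<Phi> * t) + real n)"
    using assms by (intro mult_left_mono add_mono) auto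
  also have "\<dots> = real n * (real (d - 1) * (L * \<Phi> + 1))"
    using assms(4) by (simp add: algebra_simps)
  finally obtain j where j: "j < n" "real (card (Y j)) \<le> real (d - 1) * (L * \<Phi> + 1)"
    using finite_average[OF assms(3), of "\<lambda>j. real (card (Y j))"] by blast
  have "{v \<in> W. \<exists>i\<in>{1..<d}. \<bar>F v i - a i\<bar> \<le> s j \<and> s j < \<bar>F v i - a i\<bar> + L * F v 0} = Y j"
    using j(1) by (auto simp: Y_def X_def)
  moreover have "t \<le> s j" using assms(4) by (simp add: s_def)
  moreover have "s j < 2 * t" using assms(3,4) j(1) by (simp add: s_def field_simps)
  ultimately show ?thesis using that[of "s j"] j(2) by simp
qed

section \<open>Separators from boxes\<close>

lemma box_separator:
  fixes F :: "'v \<Rightarrow> nat \<Rightarrow> real"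
  assumes "finite S" "0 < n" "real n / 5 ^ d \<le> real (card S)" "card S \<le> n" "0 < d" "0 \<le> K" "sym E"
    and pos: "\<And>v. v \<in> S \<Longrightarrow> 0 < F v 0"
    and lip: "\<And>u v. u \<in> S \<Longrightarrow> v \<in> S \<Longrightarrow> (u, v) \<in> E \<Longrightarrow> near d K (F u) (F v)"
    and \<Phi>: "\<And>a t. 0 < t \<Longrightarrow> (\<Sum>v\<in>{v \<in> S. F v \<in> box d a (2 * t)}. F v 0) \<le> \<Phi> * t"
  obtains A C where "A \<subseteq> S" "C \<subseteq> S" "A \<inter> C = {}"
    "\<And>u v. u \<in> A \<Longrightarrow> v \<in> S - (A \<union> C) \<Longrightarrow> (u, v) \<notin> E \<and> (v, u) \<notin> E"
    "real (card A) \<le> real n / 5" "real n / 5 ^ d \<le> real (card (A \<union> C))"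
    "real (card C) \<le> real d * (K + 2) * (\<Phi> + 1)"
proof -
  \<comment> \<open>With this \<open>m\<close>, the \<open>5 ^ (d - 1)\<close> boxes of half the
    size that cover the low part of the double box have at most \<open>n / 5\<close> points
    together.\<close>
  define m where "m = real n / 5 ^ d"
  have m0: "0 < m" using assms(2) by (simp add: m_def)
  obtain a t where t: "0 < t" and large: "m \<le> real (card {v \<in> S. F v \<in> box d a t})"
    and small: "\<And>b. real (card {v \<in> S. F v \<in> box d b (t / 2)}) < m"
    by (rule minimal_box[where F = F and d = d, OF assms(1) pos m0 assms(3)[folded m_def]]) auto
  define W where "W = {v \<in> S. F v \<in> box d a (2 * t)}"
  have W: "finite W" "W \<subseteq> S" using assms(1) by (auto simp: W_def)
  have sumW: "(\<Sum>v\<in>W. F v 0) \<le> \<Phi> * t" using \<Phi>[OF t, of a] by (simp add: W_def)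
  have cW: "card W \<le> n" using card_mono[OF assms(1) W(2)] assms(4) by simp
  have K2: "0 \<le> K + 2" using assms(6) by simp
  have posW: "0 < F v 0" if "v \<in> W" for v using pos that W(2) by blast
  obtain s where s: "t \<le> s" "s < 2 * t" and
    bd: "real (card {v \<in> W. \<exists>i\<in>{1..<d}. \<bar>F v i - a i\<bar> \<le> s \<and> s < \<bar>F v i - a i\<bar> + (K + 2) * F v 0})
      \<le> real (d - 1) * ((K + 2) * \<Phi> + 1)"
    by (rule box_boundary_average[where F = F and d = d and a = a, OF W(1) cW assms(2) t K2 posW sumW]) auto
  \<comment> \<open>\<open>N\<close> collects the points with edges that may pass through a side of
    the box, \<open>H\<close> those with edges that may pass through its top.\<close>
  define N where "N = {v \<in> W. \<exists>i\<in>{1..<d}. \<bar>F v i - a i\<bar> \<le> s \<and> s < \<bar>F v i - a i\<bar> + (K + 2) * F v 0}"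
  define H where "H = {v \<in> W. t / (K + 2) \<le> F v 0}"
  define C where "C = N \<union> H"
  define A where "A = {v \<in> S. F v \<in> box d a s} - C"
  have pos': "0 \<le> F v 0" if "v \<in> W" for v
    using pos[of v] that W(2) by auto
  have "\<Phi> \<ge> 0"
  proof -
    have "0 \<le> (\<Sum>v\<in>W. F v 0)" using pos' by (intro sum_nonneg)
    then have "0 \<le> \<Phi> * t" using sumW by linarith
    then show ?thesis using t by (simp add: zero_le_mult_iff)
  qed
  have K2: "0 < K + 2" using assms(6) by simp
  \<comment> \<open>Markov's inequality: each point of \<open>H\<close> uses up
    \<open>t / (K + 2)\<close> of the total height \<open>\<Phi> * t\<close>.\<close>
  have cH: "real (card H) \<le> (K + 2) * \<Phi>"
  proof -
    have "real (card H) * (t / (K + 2)) \<le> (\<Sum>v\<in>H. F v 0)"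
      using sum_bounded_below[of H "t / (K + 2)" "\<lambda>v. F v 0"] by (simp add: H_def)
    also have "\<dots> \<le> (\<Sum>v\<in>W. F v 0)"
      using W(1) pos' by (intro sum_mono2) (auto simp: H_def)
    finally have "real (card H) * (t / (K + 2)) \<le> \<Phi> * t" using sumW by linarith
    then have "real (card H) * t \<le> (K + 2) * \<Phi> * t" using K2 by (simp add: field_simps)
    then show ?thesis using t by simp
  qed
  have "real (card C) \<le> real (card N) + real (card H)"
    unfolding C_def using card_Un_le[of N H] by linarith
  also have "\<dots> \<le> real (d - 1) * ((K + 2) * \<Phi> + 1) + (K + 2) * \<Phi>"
    using bd cH by (simp add: N_def)
  also have "\<dots> \<le> real (d - 1) * ((K + 2) * (\<Phi> + 1)) + (K + 2) * (\<Phi> + 1)"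
    using K2 assms(6) \<open>\<Phi> \<ge> 0\<close> by (intro add_mono mult_left_mono) (auto simp: algebra_simps)
  also have "\<dots> = real d * (K + 2) * (\<Phi> + 1)"
    using assms(5) by (simp add: of_nat_diff algebra_simps)
  finally have cC: "real (card C) \<le> real d * (K + 2) * (\<Phi> + 1)" .
  have boxW: "v \<in> W" if "v \<in> S" "F v \<in> box d a s" for v
    using that s by (force simp: W_def box_def)
  have "A \<subseteq> {v \<in> S. F v \<in> box d a (2 * t) \<and> F v 0 \<le> t / 2}"
  proof
    fix v assume "v \<in> A"
    then have v: "v \<in> S" "F v \<in> box d a s" "v \<notin> H" by (auto simp: A_def C_def)
    then have "F v 0 < t / (K + 2)" using boxW by (auto simp: H_def)
    also have "\<dots> \<le> t / 2" using assms(6) t by (intro divide_left_mono) auto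
    finally show "v \<in> {v \<in> S. F v \<in> box d a (2 * t) \<and> F v 0 \<le> t / 2}"
      using v boxW by (auto simp: W_def)
  qed
  then have "card A \<le> card {v \<in> S. F v \<in> box d a (2 * t) \<and> F v 0 \<le> t / 2}"
    using assms(1) by (intro card_mono) auto
  also have "real \<dots> \<le> 5 ^ (d - 1) * m"
    using low_part_of_double_box[OF assms(1) t] small by (simp add: less_imp_le)
  also have "\<dots> = real n / 5"
    using assms(5) by (cases d) (simp_all add: m_def)
  finally have cA: "real (card A) \<le> real n / 5" by simp
  have CS: "C \<subseteq> S" using W by (auto simp: C_def N_def H_def)
  have "box d a t \<subseteq> box d a s" using s by (force simp: box_def)
  then have "{v \<in> S. F v \<in> box d a t} \<subseteq> A \<union> C" by (auto simp: A_def)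
  then have "card {v \<in> S. F v \<in> box d a t} \<le> card (A \<union> C)"
    using assms(1) CS by (intro card_mono) (auto simp: A_def intro: finite_subset)
  then have cAC: "real n / 5 ^ d \<le> real (card (A \<union> C))" using large by (simp add: m_def)
  have noedge: "(u, v) \<notin> E" if "u \<in> A" "v \<in> S - (A \<union> C)" for u v
  proof
    assume "(u, v) \<in> E"
    then have nr: "near d K (F u) (F v)" using that lip by (auto simp: A_def)
    have u: "u \<in> S" "F u \<in> box d a s" "u \<notin> C" "u \<in> W" using that boxW by (auto simp: A_def)
    have v: "v \<in> S" "F v \<notin> box d a s" using that by (auto simp: A_def)
    note p = pos[OF u(1)] pos[OF v(1)]
    have "F v 0 \<le> (K + 2) * F u 0" using near_height[of d K "F v" "F u"] nr near_sym p assms(5) by blast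
    \<comment> \<open>As \<open>u\<close> is not in \<open>H\<close>, its neighbour \<open>v\<close>
      stays below the top. So \<open>v\<close> is outside because of a side, which forces
      \<open>u\<close> into \<open>N\<close>.\<close>
    moreover have "(K + 2) * F u 0 < t" using u(3,4) K2 by (auto simp: C_def H_def field_simps)
    ultimately have "F v 0 \<le> s" using s by linarith
    then obtain i where i: "i \<in> {1..<d}" "s < \<bar>F v i - a i\<bar>" using v(2) by (force simp: box_def)
    have "\<bar>F u i - F v i\<bar> \<le> (K + 2) * F u 0" using near_coord_abs[OF nr _ p] i(1) by simp
    then have "s < \<bar>F u i - a i\<bar> + (K + 2) * F u 0" using i(2) by linarith
    moreover have "\<bar>F u i - a i\<bar> \<le> s" using u(2) i(1) by (auto simp: box_def)
    ultimately have "u \<in> N" using u(4) i(1) by (auto simp: N_def)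
    then show False using u(3) by (simp add: C_def)
  qed
  have noedge': "(u, v) \<notin> E \<and> (v, u) \<notin> E" if "u \<in> A" "v \<in> S - (A \<union> C)" for u v
    using noedge that assms(7) by (meson symD)
  show ?thesis
    by (rule that[OF _ CS _ noedge' cA cAC cC]) (auto simp: A_def)
qed

text \<open>Each round splits off a piece of at most \<open>n / 5\<close> points and takes away at
  least \<open>n / 5 ^ d\<close> points in all, so after at most \<open>5 ^ d\<close> rounds fewer
  than \<open>n / 2\<close> are left.\<close>

lemma cut_le_weight:
  fixes F :: "'v \<Rightarrow> nat \<Rightarrow> real"
  assumes "finite S" "S \<noteq> {}" "0 < d" "0 \<le> K" "0 \<le> \<Phi>" "sym E"
    and pos: "\<And>v. v \<in> S \<Longrightarrow> 0 < F v 0"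
    and lip: "\<And>u v. u \<in> S \<Longrightarrow> v \<in> S \<Longrightarrow> (u, v) \<in> E \<Longrightarrow> near d K (F u) (F v)"
    and \<Phi>: "\<And>a t. 0 < t \<Longrightarrow> (\<Sum>v\<in>{v \<in> S. F v \<in> box d a (2 * t)}. F v 0) \<le> \<Phi> * t"
  shows "real (cut E S) \<le> 5 ^ d * (real d * (K + 2) * (\<Phi> + 1))"
proof -
  define n where "n = card S"
  have n0: "0 < n" using assms(1,2) by (simp add: n_def card_gt_0_iff)
  define P where "P = real d * (K + 2) * (\<Phi> + 1)"
  have P0: "0 \<le> P" using assms(4,5) by (simp add: P_def)
  have "\<exists>C\<subseteq>T. real (card C) \<le> real k * P \<and> shattered E (real n / 2) (T - C)"
    if "T \<subseteq> S" "real (card T) < real n / 2 + real k * (real n / 5 ^ d)" for T and k :: nat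
    using that
  proof (induction k arbitrary: T)
    case 0
    have "finite T" using 0(1) assms(1) finite_subset by blast
    then show ?case using 0 by (intro exI[of _ "{}"]) (simp add: shattered_small)
  next
    case (Suc k)
    have fT: "finite T" using Suc(2) assms(1) finite_subset by blast
    show ?case
    proof (cases "real (card T) < real n / 2")
      case True
      then show ?thesis using P0 fT by (intro exI[of _ "{}"]) (simp add: shattered_small)
    next
      case False
      \<comment> \<open>A remainder of \<open>n / 2\<close> points is still rich enough for another
        separator.\<close>
      have "real n / 5 ^ d \<le> real n / 2"
      proof -
        have "(2::real) \<le> 5 ^ d" using assms(3) power_increasing[of 1 d "5::real"] by simp
        then show ?thesis by (intro divide_left_mono) auto
      qed
      then have big: "real n / 5 ^ d \<le> real (card T)" using False by linarith
      have cT: "card T \<le> n" unfolding n_def using Suc(2) assms(1) card_mono by blast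
      have \<Phi>T: "(\<Sum>v\<in>{v \<in> T. F v \<in> box d a (2 * t)}. F v 0) \<le> \<Phi> * t" if "0 < t" for a t
      proof -
        have "(\<Sum>v\<in>{v \<in> T. F v \<in> box d a (2 * t)}. F v 0) \<le> (\<Sum>v\<in>{v \<in> S. F v \<in> box d a (2 * t)}. F v 0)"
          using assms(1) Suc(2) pos by (intro sum_mono2) (auto simp: less_imp_le)
        then show ?thesis using \<Phi>[OF that, of a] by linarith
      qed
      have posT: "0 < F v 0" if "v \<in> T" for v using pos that Suc(2) by blast
      have lipT: "near d K (F u) (F v)" if "u \<in> T" "v \<in> T" "(u, v) \<in> E" for u v
        using lip that Suc(2) by blast
      obtain A C where AC: "A \<subseteq> T" "C \<subseteq> T" "A \<inter> C = {}"
        "\<And>u v. u \<in> A \<Longrightarrow> v \<in> T - (A \<union> C) \<Longrightarrow> (u, v) \<notin> E \<and> (v, u) \<notin> E"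
        "real (card A) \<le> real n / 5" "real n / 5 ^ d \<le> real (card (A \<union> C))"
        "real (card C) \<le> P"
        unfolding P_def
        by (rule box_separator[where F = F, OF fT n0 big cT assms(3,4,6) posT lipT \<Phi>T]) auto
      define T' where "T' = T - (A \<union> C)"
      have "card T' = card T - card (A \<union> C)"
        unfolding T'_def using AC(1,2) fT by (intro card_Diff_subset) (auto intro: finite_subset)
      moreover have "card (A \<union> C) \<le> card T" using AC(1,2) fT by (intro card_mono) auto
      ultimately have "real (card T') = real (card T) - real (card (A \<union> C))" by linarith
      also have "\<dots> < real n / 2 + real k * (real n / 5 ^ d)"
        using AC(6) Suc(3) by (simp add: algebra_simps add_divide_distrib)
      finally obtain C' where C': "C' \<subseteq> T'" "real (card C') \<le> real k * P"
        "shattered E (real n / 2) (T' - C')"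
        using Suc.IH[of T'] Suc(2) unfolding T'_def by blast
      have "T - (C \<union> C') = A \<union> (T' - C')" using AC(1-3) C'(1) by (auto simp: T'_def)
      moreover have "shattered E (real n / 2) (A \<union> (T' - C'))"
      proof (rule shattered_Un)
        show "finite A" "finite (T' - C')" using fT AC(1) by (auto simp: T'_def intro: finite_subset)
        then show "shattered E (real n / 2) A" using AC(5) n0 by (intro shattered_small) auto
        show "shattered E (real n / 2) (T' - C')" by fact
        show "\<And>u w. u \<in> A \<Longrightarrow> w \<in> T' - C' \<Longrightarrow> (u, w) \<notin> E \<and> (w, u) \<notin> E"
          using AC(4) by (auto simp: T'_def)
      qed
      moreover have "real (card (C \<union> C')) \<le> real (Suc k) * P"
        using card_Un_le[of C C'] AC(7) C'(2) by (simp add: algebra_simps)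
      ultimately show ?thesis using AC(2) C'(1)
        by (intro exI[of _ "C \<union> C'"]) (auto simp: T'_def)
    qed
  qed
  \<comment> \<open>For \<open>k = 5 ^ d\<close> the size condition reads
    \<open>n < n / 2 + n\<close>.\<close>
  from this[of S "5 ^ d"] obtain C where C: "C \<subseteq> S" "real (card C) \<le> 5 ^ d * P"
    "shattered E (real n / 2) (S - C)"
    using n0 by (auto simp: n_def)
  have "cut E S \<le> card C" using cut_le[OF assms(1,2) C(1)] C(3) by (simp add: n_def)
  then show ?thesis using C(2) unfolding P_def by linarith
qed

section \<open>The sum of the heights in a sparse set\<close>

text \<open>With the constant \<open>d\<close>, any two points of a cube of side \<open>h\<close> whose heights are at least \<open>h\<close> are near.\<close>

definition sparse :: "nat \<Rightarrow> real \<Rightarrow> ('v \<Rightarrow> nat \<Rightarrow> real) \<Rightarrow> 'v set \<Rightarrow> bool" where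
  "sparse d B F S \<longleftrightarrow>
    (\<forall>A\<subseteq>S. finite A \<longrightarrow> (\<forall>u\<in>A. \<forall>v\<in>A. near d (real d) (F u) (F v)) \<longrightarrow> real (card A) \<le> B)"

lemma sparse_subset: "sparse d B F V \<Longrightarrow> S \<subseteq> V \<Longrightarrow> sparse d B F S"
  unfolding sparse_def by (meson subset_trans)

lemma near_cell:
  assumes "0 < h" "h \<le> x 0" "h \<le> y 0" "\<And>i. i < d \<Longrightarrow> \<bar>x i - y i\<bar> \<le> h"
  shows "near d (real d) x y"
proof -
  have "(\<Sum>i<d. (x i - y i)\<^sup>2) \<le> (\<Sum>i<d. x 0 * y 0)"
  proof (rule sum_mono)
    fix i assume "i \<in> {..<d}"
    then have "(x i - y i)\<^sup>2 \<le> h\<^sup>2" using assms(4)[of i] assms(1) by (simp add: abs_le_square_iff[symmetric])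
    also have "\<dots> \<le> x 0 * y 0" unfolding power2_eq_square using assms(1-3) by (intro mult_mono) auto
    finally show "(x i - y i)\<^sup>2 \<le> x 0 * y 0" .
  qed
  then show ?thesis by (simp add: near_def)
qed

text \<open>In a cell whose side \<open>s\<close> is the lower height of the layer, all points are
  pairwise near, so sparseness leaves at most \<open>B\<close> of them. Offsets up to
  \<open>2 * t\<close> have \<open>4 * 2 ^ l + 1\<close> possible floors, rounded up to
  \<open>5 * 2 ^ l\<close>.\<close>

lemma layer_card:
  fixes F :: "'v \<Rightarrow> nat \<Rightarrow> real"
  assumes "finite S" "sparse d B F S" "0 < t"
  shows "real (card {v \<in> S. F v \<in> box d a (2 * t) \<and> t / 2 ^ l < F v 0 \<and> F v 0 \<le> 2 * t / 2 ^ l})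
    \<le> (5 * 2 ^ l) ^ (d - 1) * B"
proof -
  let ?A = "{v \<in> S. F v \<in> box d a (2 * t) \<and> t / 2 ^ l < F v 0 \<and> F v 0 \<le> 2 * t / 2 ^ l}"
  define s where "s = t / 2 ^ l"
  have s: "0 < s" "t = s * 2 ^ l" using assms(3) by (auto simp: s_def)
  define h where "h v = restrict (\<lambda>i. \<lfloor>(F v i - a i) / s\<rfloor>) {1..<d}" for v
  define R where "R = {- (2 * 2 ^ l)..2 * 2 ^ l :: int}"
  define I where "I = PiE {1..<d} (\<lambda>_. R)"
  have "0 \<le> B" using assms(2) unfolding sparse_def by (metis card.empty empty_iff empty_subsetI finite.emptyI of_nat_0)
  have "real (card ?A) \<le> real (card I) * B"
  proof (rule card_le_fibres)
    show "finite I" by (simp add: I_def R_def finite_PiE)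
    show "h ` ?A \<subseteq> I"
    proof
      fix y assume "y \<in> h ` ?A"
      then obtain v where v: "v \<in> ?A" "y = h v" by blast
      have "\<lfloor>(F v i - a i) / s\<rfloor> \<in> R" if "i \<in> {1..<d}" for i
      proof -
        have "\<bar>F v i - a i\<bar> \<le> 2 * t" using v(1) that by (auto simp: box_def)
        then have "- (2 * 2 ^ l) \<le> (F v i - a i) / s" "(F v i - a i) / s \<le> 2 * 2 ^ l"
          using s by (auto simp: field_simps)
        then have "real_of_int (- (2 * 2 ^ l)) \<le> (F v i - a i) / s"
          "(F v i - a i) / s < real_of_int (2 * 2 ^ l + 1)" by auto
        then show ?thesis unfolding R_def by (metis atLeastAtMost_iff floor_less_iff le_floor_iff zle_add1_eq_le)
      qed
      then show "y \<in> I" by (auto simp: v(2) h_def I_def)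
    qed
    show "finite ?A" using assms(1) by simp
    fix k assume "k \<in> I"
    have "near d (real d) (F u) (F v)" if "u \<in> {v \<in> ?A. h v = k}" "v \<in> {v \<in> ?A. h v = k}" for u v
    proof (rule near_cell[OF s(1)])
      show "s \<le> F u 0" "s \<le> F v 0" using that by (auto simp: s_def)
      have 2: "F u 0 \<le> 2 * s" "F v 0 \<le> 2 * s" using that by (auto simp: s_def)
      fix i assume i: "i < d"
      show "\<bar>F u i - F v i\<bar> \<le> s"
      proof (cases "i = 0")
        case True
        then show ?thesis using \<open>s \<le> F u 0\<close> \<open>s \<le> F v 0\<close> 2 by (simp add: abs_le_iff)
      next
        case False
        then have "i \<in> {1..<d}" using i by auto
        moreover have "h u i = k i" "h v i = k i" using that by auto
        ultimately have "\<lfloor>(F u i - a i) / s\<rfloor> = k i" "\<lfloor>(F v i - a i) / s\<rfloor> = k i"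
          by (simp_all add: h_def)
        then have "\<bar>(F u i - a i) / s - (F v i - a i) / s\<bar> \<le> 1" by linarith
        then have "\<bar>F u i - F v i\<bar> / s \<le> 1" using s(1) by (simp add: abs_divide flip: diff_divide_distrib)
        then show ?thesis using s(1) by simp
      qed
    qed
    then show "real (card {v \<in> ?A. h v = k}) \<le> B"
      using assms(1) by (intro assms(2)[unfolded sparse_def, rule_format]) (blast | simp)+
  qed
  also have "real (card I) \<le> (5 * 2 ^ l) ^ (d - 1)"
  proof -
    have "card R = nat (4 * 2 ^ l + 1)" by (simp add: R_def)
    then have "real (card R) = 4 * 2 ^ l + 1" by simp
    also have "\<dots> \<le> 5 * 2 ^ l" by simp
    finally have "real (card R) ^ (d - 1) \<le> (5 * 2 ^ l) ^ (d - 1)" by (intro power_mono) auto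
    then show ?thesis by (simp add: I_def card_PiE)
  qed
  then have "real (card I) * B \<le> (5 * 2 ^ l) ^ (d - 1) * B" using \<open>0 \<le> B\<close> by (rule mult_right_mono)
  finally show ?thesis .
qed

text \<open>The first \<open>J\<close> layers are counted by cells; every point below them is simply
  charged the height \<open>2 * t / 2 ^ J\<close>. \<open>J\<close> stays free to balance the two
  terms.\<close>

lemma weight_bound:
  fixes F :: "'v \<Rightarrow> nat \<Rightarrow> real"
  assumes "finite S" "sparse d B F S" "0 < t" "\<And>v. v \<in> S \<Longrightarrow> 0 < F v 0"
  shows "(\<Sum>v\<in>{v \<in> S. F v \<in> box d a (2 * t)}. F v 0)
    \<le> (2 * 5 ^ (d - 1) * B * (\<Sum>l<J. (2 ^ (d - 1)) ^ l / 2 ^ l) + 2 * real (card S) / 2 ^ J) * t"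
proof -
  let ?W = "{v \<in> S. F v \<in> box d a (2 * t)}"
  have high: "(\<Sum>v\<in>{v \<in> ?W. 2 * t / 2 ^ J < F v 0}. F v 0)
      \<le> (2 * 5 ^ (d - 1) * B * (\<Sum>l<J. (2 ^ (d - 1)) ^ l / 2 ^ l)) * t"
  proof (induction J)
    case 0
    have "{v \<in> ?W. 2 * t / 2 ^ 0 < F v 0} = {}" by (auto simp: box_def)
    then show ?case by (simp only: sum.empty lessThan_0)
  next
    case (Suc J)
    let ?L = "{v \<in> S. F v \<in> box d a (2 * t) \<and> t / 2 ^ J < F v 0 \<and> F v 0 \<le> 2 * t / 2 ^ J}"
    let ?H = "{v \<in> ?W. 2 * t / 2 ^ J < F v 0}"
    have "t / 2 ^ J \<le> 2 * t / 2 ^ J" using assms(3) by (simp add: field_simps)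
    then have "{v \<in> ?W. 2 * t / 2 ^ Suc J < F v 0} = ?H \<union> ?L" by auto
    then have split: "(\<Sum>v\<in>{v \<in> ?W. 2 * t / 2 ^ Suc J < F v 0}. F v 0) = (\<Sum>v\<in>?H. F v 0) + (\<Sum>v\<in>?L. F v 0)"
      using assms(1) by (simp only:) (rule sum.union_disjoint, auto)
    have "(\<Sum>v\<in>?L. F v 0) \<le> real (card ?L) * (2 * t / 2 ^ J)"
      by (rule sum_bounded_above) auto
    also have "\<dots> \<le> (5 * 2 ^ J) ^ (d - 1) * B * (2 * t / 2 ^ J)"
      using layer_card[OF assms(1-3)] assms(3) by (intro mult_right_mono) auto
    also have "\<dots> = 2 * 5 ^ (d - 1) * B * ((2 ^ (d - 1)) ^ J / 2 ^ J) * t"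
      by (simp add: power_mult_distrib power_commutes mult.commute flip: power_mult)
    finally show ?case using Suc split by (simp add: algebra_simps)
  qed
  have "(\<Sum>v\<in>{v \<in> ?W. F v 0 \<le> 2 * t / 2 ^ J}. F v 0) \<le>
      real (card {v \<in> ?W. F v 0 \<le> 2 * t / 2 ^ J}) * (2 * t / 2 ^ J)"
    by (rule sum_bounded_above) auto
  also have "\<dots> \<le> real (card S) * (2 * t / 2 ^ J)"
    using assms(1,3) by (intro mult_right_mono) (auto intro: card_mono)
  finally have low: "(\<Sum>v\<in>{v \<in> ?W. F v 0 \<le> 2 * t / 2 ^ J}. F v 0) \<le> 2 * real (card S) / 2 ^ J * t"
    by (simp add: mult_ac)
  have "?W = {v \<in> ?W. 2 * t / 2 ^ J < F v 0} \<union> {v \<in> ?W. F v 0 \<le> 2 * t / 2 ^ J}" by auto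
  then have "(\<Sum>v\<in>?W. F v 0) = (\<Sum>v\<in>{v \<in> ?W. 2 * t / 2 ^ J < F v 0} \<union> {v \<in> ?W. F v 0 \<le> 2 * t / 2 ^ J}. F v 0)"
    by (rule arg_cong)
  also have "\<dots> = (\<Sum>v\<in>{v \<in> ?W. 2 * t / 2 ^ J < F v 0}. F v 0) + (\<Sum>v\<in>{v \<in> ?W. F v 0 \<le> 2 * t / 2 ^ J}. F v 0)"
    using assms(1) by (intro sum.union_disjoint) auto
  finally show ?thesis using high low by (simp add: algebra_simps)
qed

lemma dyadic_bracket:
  fixes b n :: nat
  assumes "1 < b" "0 < n"
  obtains J where "b ^ J \<le> n" "n < b ^ Suc J"
proof -
  have "\<exists>J. b ^ J \<le> n \<and> n < b ^ Suc J"
    using ex_power_ivl1[of b n] assms by auto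
  then show ?thesis using that by blast
qed

text \<open>For \<open>d = 2\<close> each layer adds the same amount. About \<open>log n\<close>
  layers bring the remainder down to 4, which \<open>ln n \<ge> ln 2\<close> absorbs.\<close>

lemma weight_growth_log:
  obtains c where "0 < c" "\<And>n. 2 \<le> n \<Longrightarrow> \<exists>J. 2 * 5 * B * real J + 2 * real n / 2 ^ J \<le> c * ln (real n)"
proof -
  define c where "c = 10 * \<bar>B\<bar> / ln 2 + 4 / ln 2"
  have "\<exists>J. 2 * 5 * B * real J + 2 * real n / 2 ^ J \<le> c * ln (real n)" if n: "2 \<le> n" for n :: nat
  proof -
    obtain J where J: "2 ^ J \<le> n" "n < 2 ^ Suc J" using dyadic_bracket[of 2 n] n by auto
    have "real (2 ^ J) \<le> real n" "real n < real (2 ^ Suc J)" using J by linarith+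
    then have r: "(2::real) ^ J \<le> real n" "real n < 2 * 2 ^ J" by simp_all
    have "ln ((2::real) ^ J) \<le> ln (real n)" using r(1) n by (subst ln_le_cancel_iff) auto
    then have "real J \<le> ln (real n) / ln 2" by (simp add: ln_realpow field_simps)
    then have "10 * \<bar>B\<bar> * real J \<le> 10 * \<bar>B\<bar> * (ln (real n) / ln 2)" by (intro mult_left_mono) auto
    moreover have "2 * 5 * B * real J \<le> 10 * \<bar>B\<bar> * real J" by (intro mult_right_mono) auto
    moreover have "2 * real n / 2 ^ J \<le> 4" using r(2) by (simp add: field_simps)
    moreover have "4 * 1 \<le> 4 * (ln (real n) / ln 2)" using n by (intro mult_left_mono) auto
    moreover have "c * ln (real n) = 10 * \<bar>B\<bar> * (ln (real n) / ln 2) + 4 * (ln (real n) / ln 2)"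
      by (simp add: c_def algebra_simps)
    ultimately have "2 * 5 * B * real J + 2 * real n / 2 ^ J \<le> c * ln (real n)"
      by linarith
    then show ?thesis by blast
  qed
  moreover have "0 < c" by (auto simp: c_def intro!: add_nonneg_pos)
  ultimately show ?thesis using that by blast
qed

text \<open>Here \<open>p = d - 1\<close>. The balance is at \<open>2 ^ J\<close> of order
  \<open>x = n powr (1 / p)\<close>: the layers form a geometric sum of ratio
  \<open>2 ^ (p - 1)\<close>, dominated by its end, and both terms are of order
  \<open>x ^ (p - 1)\<close>.\<close>

lemma weight_growth_power:
  assumes p: "2 \<le> p"
  obtains c where "0 < c" "\<And>n. 2 \<le> n \<Longrightarrow>
    \<exists>J. 2 * 5 ^ p * B * (\<Sum>l<J. (2 ^ p) ^ l / 2 ^ l) + 2 * real n / 2 ^ J \<le> c * real n powr ((real p - 1) / real p)"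
proof -
  define c where "c = 2 * 5 ^ p * \<bar>B\<bar> + 4"
  have "\<exists>J. 2 * 5 ^ p * B * (\<Sum>l<J. (2 ^ p) ^ l / 2 ^ l) + 2 * real n / 2 ^ J \<le> c * real n powr ((real p - 1) / real p)"
    if n: "2 \<le> n" for n :: nat
  proof -
    have swap: "(2 ^ p) ^ J = ((2::real) ^ J) ^ p" for J
      by (metis mult.commute power_mult)
    define x where "x = real n powr (1 / real p)"
    have x0: "0 < x" using n by (simp add: x_def)
    have xp: "x ^ p = real n" using n p by (simp add: x_def powr_powr flip: powr_realpow)
    have xq: "real n powr ((real p - 1) / real p) = x ^ (p - 1)"
      using p x0 by (simp add: x_def powr_powr of_nat_diff flip: powr_realpow)
    obtain J where J: "(2 ^ p) ^ J \<le> n" "n < (2 ^ p) ^ Suc J"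
      using dyadic_bracket[of "2 ^ p" n] n p one_less_power[of "2::nat" p] by auto
    have "real ((2 ^ p) ^ J) \<le> real n" "real n < real ((2 ^ p) ^ Suc J)" using J by linarith+
    then have "(2 ^ J) ^ p \<le> x ^ p" "x ^ p < (2 * 2 ^ J) ^ p"
      using swap[of J] swap[of "Suc J"] by (simp_all add: xp)
    then have r: "2 ^ J \<le> x" "x < 2 * 2 ^ J"
      using x0 p by (auto intro: power_le_imp_le_base[of _ "p - 1"] power_less_imp_less_base)
    \<comment> \<open>The induction step is \<open>y + y \<le> 2 ^ (p - 1) * y\<close>, which is
      where \<open>p \<ge> 2\<close> enters.\<close>
    have geo: "(\<Sum>l<J. (2 ^ p) ^ l / 2 ^ l) \<le> ((2::real) ^ J) ^ (p - 1)" for J :: nat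
    proof (induction J)
      case (Suc J)
      have "(2 ^ p) ^ J / 2 ^ J = ((2::real) ^ J) ^ (p - 1)"
        unfolding swap using p by (cases p) simp_all
      moreover have "(2::real) * (2 ^ J) ^ (p - 1) \<le> 2 ^ (p - 1) * (2 ^ J) ^ (p - 1)"
        using p power_increasing[of 1 "p - 1" "2::real"] by (intro mult_right_mono) auto
      ultimately show ?case using Suc
        by (simp only: sum.lessThan_Suc power_Suc power_mult_distrib)
    qed simp
    also have "((2::real) ^ J) ^ (p - 1) \<le> x ^ (p - 1)" using r by (intro power_mono) auto
    finally have g: "(\<Sum>l<J. (2 ^ p) ^ l / 2 ^ l) \<le> x ^ (p - 1)" .
    have "2 * 5 ^ p * B * (\<Sum>l<J. (2 ^ p) ^ l / 2 ^ l) \<le> 2 * 5 ^ p * \<bar>B\<bar> * (\<Sum>l<J. (2 ^ p) ^ l / 2 ^ l)"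
      by (intro mult_right_mono mult_left_mono sum_nonneg) auto
    also have "\<dots> \<le> 2 * 5 ^ p * \<bar>B\<bar> * x ^ (p - 1)"
      using g by (intro mult_left_mono) auto
    finally have 1: "2 * 5 ^ p * B * (\<Sum>l<J. (2 ^ p) ^ l / 2 ^ l) \<le> 2 * 5 ^ p * \<bar>B\<bar> * x ^ (p - 1)" .
    have "real n = x * x ^ (p - 1)" using xp p by (metis Suc_1 Suc_le_D diff_Suc_1 power_Suc)
    also have "\<dots> \<le> 2 * 2 ^ J * x ^ (p - 1)" using r x0 by (intro mult_right_mono) auto
    finally have "2 * real n / 2 ^ J \<le> 4 * x ^ (p - 1)" by (simp add: field_simps)
    then show ?thesis unfolding xq c_def distrib_right using 1 by (intro exI[of _ J]) linarith
  qed
  moreover have "0 < c" by (auto simp: c_def intro!: add_nonneg_pos)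
  ultimately show ?thesis using that by blast
qed

lemma sep_le_weight:
  fixes F :: "'v \<Rightarrow> nat \<Rightarrow> real"
  assumes "0 < d" "0 \<le> K" "sym E" "0 < n" "0 \<le> \<Phi>"
    and pos: "\<And>v. v \<in> V \<Longrightarrow> 0 < F v 0"
    and lip: "\<And>u v. (u, v) \<in> E \<Longrightarrow> near d K (F u) (F v)"
    and \<Phi>: "\<And>S a t. S \<subseteq> V \<Longrightarrow> finite S \<Longrightarrow> card S = n \<Longrightarrow> 0 < t \<Longrightarrow>
      (\<Sum>v\<in>{v \<in> S. F v \<in> box d a (2 * t)}. F v 0) \<le> \<Phi> * t"
  shows "real (sep V E n) \<le> 5 ^ d * (real d * (K + 2) * (\<Phi> + 1))"
proof (rule sep_le)
  show "0 \<le> 5 ^ d * (real d * (K + 2) * (\<Phi> + 1))" using assms(2,5) by simp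
  fix S assume S: "S \<subseteq> V" "finite S" "card S = n"
  have "S \<noteq> {}" using S assms(4) by auto
  then show "real (cut E S) \<le> 5 ^ d * (real d * (K + 2) * (\<Phi> + 1))"
    using S assms by (intro cut_le_weight[where F = F and K = K]) auto
qed

text \<open>The positive lower bound \<open>c\<close> of \<open>g\<close> lets a multiple of
  \<open>g n\<close> absorb the summand 1 of the separator bound.\<close>

lemma sep_le_sparse:
  fixes F :: "'v \<Rightarrow> nat \<Rightarrow> real"
  assumes "0 < d" "0 \<le> K" "sym E" "\<And>v. v \<in> V \<Longrightarrow> 0 < F v 0"
    and "\<And>u v. (u, v) \<in> E \<Longrightarrow> near d K (F u) (F v)" "sparse d B F V"
    and J: "\<And>n. 2 \<le> n \<Longrightarrow>
      \<exists>J. 2 * 5 ^ (d - 1) * B * (\<Sum>l<J. (2 ^ (d - 1)) ^ l / 2 ^ l) + 2 * real n / 2 ^ J \<le> g n"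
    and g: "0 < c" "\<And>n. 2 \<le> n \<Longrightarrow> c \<le> g n"
  obtains C where "0 < C" "\<And>n. 2 \<le> n \<Longrightarrow> real (sep V E n) \<le> C * g n"
proof -
  define C where "C = 5 ^ d * (real d * (K + 2)) * (1 + 1 / c)"
  have "0 < K + 2" using assms(2) by simp
  then have C0: "0 < C" using assms(1) g(1) by (simp add: C_def add_pos_pos)
  have "real (sep V E n) \<le> C * g n" if n: "2 \<le> n" for n
  proof -
    have g0: "0 \<le> g n" using g(2)[OF n] g(1) by linarith
    have "(\<Sum>v\<in>{v \<in> S. F v \<in> box d a (2 * t)}. F v 0) \<le> g n * t"
      if S: "S \<subseteq> V" "finite S" "card S = n" "0 < t" for S a t
    proof -
      have "sparse d B F S" by (rule sparse_subset[OF assms(6) S(1)])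
      note wb = weight_bound[OF S(2) this S(4), of a]
      obtain J where "2 * 5 ^ (d - 1) * B * (\<Sum>l<J. (2 ^ (d - 1)) ^ l / 2 ^ l) + 2 * real n / 2 ^ J \<le> g n"
        using J[OF n] by blast
      then have "(2 * 5 ^ (d - 1) * B * (\<Sum>l<J. (2 ^ (d - 1)) ^ l / 2 ^ l) + 2 * real (card S) / 2 ^ J) * t
          \<le> g n * t" using S(3,4) by (intro mult_right_mono) auto
      moreover have posS: "0 < F v 0" if "v \<in> S" for v using assms(4) S(1) that by blast
      ultimately show ?thesis using wb[OF posS, of J] by linarith
    qed
    then have "real (sep V E n) \<le> 5 ^ d * (real d * (K + 2) * (g n + 1))"
      using n g0 assms(1-5) by (intro sep_le_weight[where F = F]) auto
    also have "\<dots> \<le> 5 ^ d * (real d * (K + 2) * (g n + g n / c))"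
      using g(2)[OF n] g(1) assms(2) by (intro mult_left_mono add_left_mono) auto
    also have "\<dots> = C * g n" by (simp add: C_def algebra_simps)
    finally show ?thesis .
  qed
  then show ?thesis using that C0 by blast
qed

lemma sep_upper_log:
  fixes F :: "'v \<Rightarrow> nat \<Rightarrow> real"
  assumes "0 \<le> K" "sym E" "\<And>v. v \<in> V \<Longrightarrow> 0 < F v 0"
    and "\<And>u v. (u, v) \<in> E \<Longrightarrow> near 2 K (F u) (F v)" "sparse 2 B F V"
  obtains C where "0 < C" "\<And>n. 2 \<le> n \<Longrightarrow> real (sep V E n) \<le> C * ln (real n)"
proof -
  obtain c where c: "0 < c"
    "\<And>n. 2 \<le> n \<Longrightarrow> \<exists>J. 2 * 5 * B * real J + 2 * real n / 2 ^ J \<le> c * ln (real n)"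
    using weight_growth_log by blast
  have J: "\<exists>J. 2 * 5 ^ (2 - 1) * B * (\<Sum>l<J. (2 ^ (2 - 1)) ^ l / 2 ^ l) + 2 * real n / 2 ^ J \<le> c * ln (real n)"
    if "2 \<le> n" for n :: nat
    using c(2)[OF that] by simp
  have low: "c * ln 2 \<le> c * ln (real n)" if "2 \<le> n" for n :: nat using that c(1) by simp
  obtain C where C: "0 < C" "\<And>n. 2 \<le> n \<Longrightarrow> real (sep V E n) \<le> C * (c * ln (real n))"
    using c(1) by (rule_tac sep_le_sparse[OF _ assms J _ low]) auto
  show ?thesis by (rule that[of "C * c"]) (use C c in \<open>auto simp: mult.assoc\<close>)
qed

lemma sep_upper_power:
  fixes F :: "'v \<Rightarrow> nat \<Rightarrow> real"
  assumes d: "3 \<le> d" and "0 \<le> K" "sym E" "\<And>v. v \<in> V \<Longrightarrow> 0 < F v 0"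
    and "\<And>u v. (u, v) \<in> E \<Longrightarrow> near d K (F u) (F v)" "sparse d B F V"
  obtains C where "0 < C"
    "\<And>n. 2 \<le> n \<Longrightarrow> real (sep V E n) \<le> C * real n powr ((real d - 2) / (real d - 1))"
proof -
  let ?e = "(real d - 2) / (real d - 1)"
  have e: "(real (d - 1) - 1) / real (d - 1) = ?e" using d by (simp add: of_nat_diff)
  have "2 \<le> d - 1" using d by simp
  from weight_growth_power[OF this, of B] obtain c where c: "0 < c"
    and J: "\<And>n. 2 \<le> n \<Longrightarrow> \<exists>J. 2 * 5 ^ (d - 1) * B * (\<Sum>l<J. (2 ^ (d - 1)) ^ l / 2 ^ l) + 2 * real n / 2 ^ J
        \<le> c * real n powr ?e"
    unfolding e by blast
  have low: "c \<le> c * real n powr ?e" if "2 \<le> n" for n :: nat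
    using that c d by (simp add: ge_one_powr_ge_zero)
  obtain C where C: "0 < C" "\<And>n. 2 \<le> n \<Longrightarrow> real (sep V E n) \<le> C * (c * real n powr ?e)"
    using c d by (rule_tac sep_le_sparse[OF _ assms(2-6) J _ low]) auto
  show ?thesis by (rule that[of "C * c"]) (use C c in \<open>auto simp: mult.assoc\<close>)
qed

section \<open>Lower bounds from expanding models\<close>

definition conn :: "('v \<times> 'v) set \<Rightarrow> 'v set \<Rightarrow> bool" where
  "conn E T \<longleftrightarrow> (\<forall>u\<in>T. \<forall>v\<in>T. (u, v) \<in> (E \<inter> T \<times> T)\<^sup>*)"

lemma one_le_sep:
  assumes "0 < n" "S \<subseteq> V" "finite S" "card S = n" "conn E S"
  shows "1 \<le> sep V E n"
proof -
  have "S \<noteq> {}" using assms(1,4) by auto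
  then have "1 \<le> cut E S" using assms(3,5) by (intro one_le_cut) (auto simp: conn_def)
  then show ?thesis using cut_le_sep[OF assms(1-4)] by (meson le_trans)
qed

lemma rtrancl_exit:
  assumes "(s, v) \<in> E\<^sup>*" "s \<in> S" "v \<notin> S"
  obtains a b where "(a, b) \<in> E" "a \<in> S" "b \<notin> S"
proof -
  have "v \<notin> S \<longrightarrow> (\<exists>a b. (a, b) \<in> E \<and> a \<in> S \<and> b \<notin> S)"
    using assms(1) by induction (use assms(2) in blast)+
  then show ?thesis using assms(3) that by blast
qed

lemma rtrancl_Restr_mono: "(u, v) \<in> (E \<inter> S \<times> S)\<^sup>* \<Longrightarrow> S \<subseteq> T \<Longrightarrow> (u, v) \<in> (E \<inter> T \<times> T)\<^sup>*"
  by (erule rtrancl_mono[THEN subsetD, rotated]) blast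

lemma conn_insert:
  assumes "conn E S" "sym E" "(a, b) \<in> E" "a \<in> S"
  shows "conn E (insert b S)"
proof -
  let ?R = "E \<inter> insert b S \<times> insert b S"
  have ab: "(a, b) \<in> ?R" "(b, a) \<in> ?R" using assms by (auto dest: symD)
  have S: "(u, v) \<in> ?R\<^sup>*" if "u \<in> S" "v \<in> S" for u v
    by (rule rtrancl_Restr_mono[of u v E S]) (use assms(1) that in \<open>auto simp: conn_def\<close>)
  have into: "(u, a) \<in> ?R\<^sup>*" if "u \<in> insert b S" for u
    using that S[of u a] assms(4) ab by auto
  have out: "(a, u) \<in> ?R\<^sup>*" if "u \<in> insert b S" for u
    using that S[of a u] assms(4) ab by auto
  show ?thesis unfolding conn_def using into out by (meson rtrancl_trans)
qed

text \<open>Grow the set vertex by vertex: a path to any vertex outside contains an edge that leaves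
  the set.\<close>

lemma connected_subsets_exist:
  assumes "connected_graph V E" "sym E" "E \<subseteq> V \<times> V" "infinite V" "0 < n"
  shows "\<exists>S\<subseteq>V. finite S \<and> card S = n \<and> conn E S"
  using assms(5)
proof (induction n rule: nat_induct_non_zero)
  case 1
  obtain v where "v \<in> V" using assms(4) by fastforce
  then show ?case by (intro exI[of _ "{v}"]) (simp add: conn_def)
next
  case (Suc n)
  then obtain S where S: "S \<subseteq> V" "finite S" "card S = n" "conn E S" by blast
  obtain v where v: "v \<in> V" "v \<notin> S" using assms(4) S(2) by (meson ex_new_if_finite infinite_super subsetI)
  obtain s where s: "s \<in> S" using S Suc(1) by fastforce
  have "(s, v) \<in> E\<^sup>*" using assms(1) s v S(1) by (auto simp: connected_graph_def)
  then obtain a b where ab: "(a, b) \<in> E" "a \<in> S" "b \<notin> S" using rtrancl_exit[OF _ s v(2)] by blast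
  show ?case
    using S ab assms(3) conn_insert[OF S(4) assms(2) ab(1,2)] by (intro exI[of _ "insert b S"]) auto
qed

text \<open>A path of cells lifts to vertices: connectedness carries it through each cell, a common
  vertex or an edge into the next one.\<close>

lemma cells_conn:
  assumes "(p, q) \<in> (\<Gamma> \<inter> D \<times> D)\<^sup>*" "p \<in> D" "x \<in> K p" "y \<in> K q"
    and "\<And>q. q \<in> D \<Longrightarrow> conn E (K q)"
    and "\<And>p q. p \<in> D \<Longrightarrow> q \<in> D \<Longrightarrow> (p, q) \<in> \<Gamma> \<Longrightarrow> \<exists>u\<in>K p. \<exists>w\<in>K q. u = w \<or> (u, w) \<in> E"
  shows "(x, y) \<in> (E \<inter> (\<Union>(K ` D)) \<times> (\<Union>(K ` D)))\<^sup>*"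
proof -
  let ?X = "\<Union>(K ` D)"
  have cell: "(u, v) \<in> (E \<inter> ?X \<times> ?X)\<^sup>*" if "q \<in> D" "u \<in> K q" "v \<in> K q" for q u v
    by (rule rtrancl_Restr_mono[of u v E "K q"])
      (use assms(5)[OF that(1)] that in \<open>auto simp: conn_def\<close>)
  have "q \<in> D \<and> (\<forall>y\<in>K q. (x, y) \<in> (E \<inter> ?X \<times> ?X)\<^sup>*)"
    using assms(1)
  proof induction
    case base
    then show ?case using cell[of p] assms(2,3) by blast
  next
    case (step q r)
    then obtain u w where uw: "u \<in> K q" "w \<in> K r" "u = w \<or> (u, w) \<in> E"
      using assms(6)[of q r] by blast
    have qr: "q \<in> D" "r \<in> D" using step(2) by auto
    have "(x, w) \<in> (E \<inter> ?X \<times> ?X)\<^sup>*"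
    proof (cases "u = w")
      case True
      then show ?thesis using step.IH uw by blast
    next
      case False
      then have "(u, w) \<in> E \<inter> ?X \<times> ?X" using uw qr by blast
      then show ?thesis using step.IH uw(1) by (meson rtrancl.rtrancl_into_rtrancl)
    qed
    then show ?case using cell[OF qr(2) uw(2)] qr(2) by (meson rtrancl_trans)
  qed
  then show ?thesis using assms(4) by blast
qed

lemma real_card_UN_le:
  assumes "finite I" "\<And>i. i \<in> I \<Longrightarrow> real (card (X i)) \<le> b"
  shows "real (card (\<Union>i\<in>I. X i)) \<le> real (card I) * b"
proof -
  have "real (card (\<Union>i\<in>I. X i)) \<le> (\<Sum>i\<in>I. real (card (X i)))"
    using card_UN_le[OF assms(1), of X] by (simp flip: of_nat_sum)
  also have "\<dots> \<le> real (card I) * b" using assms(2) by (rule sum_bounded_above)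
  finally show ?thesis .
qed

text \<open>
  The graph \<open>\<Gamma>\<close> on the increasing finite sets \<open>Q k\<close> is a model of a part of \<open>V\<close>: each \<open>q\<close> stands for
  the cell \<open>K q\<close>, and a separator destroys only boundedly many cells per vertex.
\<close>

lemma sep_lower_expander:
  fixes V :: "'v set" and K :: "'q \<Rightarrow> 'v set" and Q :: "nat \<Rightarrow> 'q set" and f g :: "nat \<Rightarrow> real"
  assumes cell: "\<And>k q. q \<in> Q k \<Longrightarrow> K q \<subseteq> V \<and> finite (K q) \<and> K q \<noteq> {} \<and> real (card (K q)) \<le> L \<and> conn E (K q)"
    and adj: "\<And>k p q. p \<in> Q k \<Longrightarrow> q \<in> Q k \<Longrightarrow> (p, q) \<in> \<Gamma> \<Longrightarrow> \<exists>u\<in>K p. \<exists>w\<in>K q. u = w \<or> (u, w) \<in> E"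
    and mult: "\<And>k v. v \<in> V \<Longrightarrow> real (card {q \<in> Q k. v \<in> K q}) \<le> M"
    and finQ: "\<And>k. finite (Q k)" and monoQ: "\<And>k. Q k \<subseteq> Q (Suc k)"
    and growth: "\<And>\<delta>. 0 < \<delta> \<Longrightarrow> \<forall>\<^sub>F k in sequentially. real (card (Q (Suc k))) - real (card (Q k)) \<le> \<delta> * real (card (Q k))"
    and unbounded: "filterlim (\<lambda>k. real (card (Q k))) at_top sequentially"
    and expansion: "\<And>\<delta>. 0 < \<delta> \<Longrightarrow> \<exists>\<epsilon>>0. \<forall>\<^sub>F k in sequentially. \<forall>B\<subseteq>Q k. real (card B) \<le> \<epsilon> * f k \<longrightarrow>
       (\<exists>T\<subseteq>Q k - B. real (card (Q k - T)) \<le> \<delta> * real (card (Q k)) \<and>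
         (\<forall>p\<in>T. \<forall>q\<in>T. (p, q) \<in> (\<Gamma> \<inter> (Q k - B) \<times> (Q k - B))\<^sup>*))"
    and profile: "\<And>A. 1 \<le> A \<Longrightarrow> \<exists>C>0. \<forall>\<^sub>F k in sequentially. \<forall>n\<ge>2. real n \<le> A * real (card (Q k)) \<longrightarrow> g n \<le> C * f k"
    and small: "\<And>n. 0 < n \<Longrightarrow> \<exists>S\<subseteq>V. finite S \<and> card S = n \<and> conn E S"
    and LM: "1 \<le> L" "1 \<le> M"
  obtains c where "0 < c" "\<And>n. 2 \<le> n \<Longrightarrow> c * g n \<le> real (sep V E n)"
proof -
  define S where "S k = \<Union>(K ` Q k)" for k
  have finS: "finite (S k)" and SV: "S k \<subseteq> V" for k using cell finQ by (auto simp: S_def)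
  have hit: "real (card {q \<in> Q k. K q \<inter> C \<noteq> {}}) \<le> M * real (card C)" if "finite C" "C \<subseteq> V" for C k
  proof -
    have "{q \<in> Q k. K q \<inter> C \<noteq> {}} = (\<Union>v\<in>C. {q \<in> Q k. v \<in> K q})" by auto
    moreover have "real (card (\<Union>v\<in>C. {q \<in> Q k. v \<in> K q})) \<le> real (card C) * M"
      using mult that(2) by (intro real_card_UN_le that(1)) blast
    ultimately show ?thesis by (simp add: mult.commute)
  qed
  have QS: "real (card (Q k)) \<le> M * real (card (S k))" for k
  proof -
    have "{q \<in> Q k. K q \<inter> S k \<noteq> {}} = Q k"
    proof -
      have "K q \<inter> S k \<noteq> {}" if "q \<in> Q k" for q using cell[OF that] that by (auto simp: S_def)
      then show ?thesis by blast
    qed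
    then show ?thesis using hit[OF finS SV, of k k] by simp
  qed
  have UL: "real (card (\<Union>(K ` X))) \<le> L * real (card X)" if "X \<subseteq> Q k" for X k
  proof -
    have "finite X" using that finQ[of k] by (rule finite_subset)
    then have "real (card (\<Union>(K ` X))) \<le> real (card X) * L"
      using cell that by (intro real_card_UN_le) blast+
    then show ?thesis by (simp add: mult.commute)
  qed
  \<comment> \<open>Cells have at most \<open>L\<close> vertices and
    \<open>card (Q k) \<le> M * card (S k)\<close>, so \<open>\<delta> * card (Q k)\<close> cells
    cover at most an eighth as many vertices as \<open>S k\<close> has.\<close>
  define \<delta> where "\<delta> = 1 / (8 * L * M)"
  have \<delta>: "0 < \<delta>" "L * \<delta> * M = 1 / 8" using LM by (auto simp: \<delta>_def)
  have \<delta>S: "L * (\<delta> * real (card (Q k))) \<le> real (card (S k)) / 8" for k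
  proof -
    have "L * \<delta> * real (card (Q k)) \<le> L * \<delta> * (M * real (card (S k)))"
      using QS LM \<delta>(1) by (intro mult_left_mono) auto
    also have "\<dots> = (L * \<delta> * M) * real (card (S k))" by (simp add: mult_ac)
    also have "\<dots> = real (card (S k)) / 8" by (simp only: \<delta>(2))
    finally show ?thesis by (simp only: mult.assoc)
  qed
  obtain \<epsilon> where \<epsilon>: "0 < \<epsilon>" and exp: "\<forall>\<^sub>F k in sequentially. \<forall>B\<subseteq>Q k. real (card B) \<le> \<epsilon> * f k \<longrightarrow>
       (\<exists>T\<subseteq>Q k - B. real (card (Q k - T)) \<le> \<delta> * real (card (Q k)) \<and>
         (\<forall>p\<in>T. \<forall>q\<in>T. (p, q) \<in> (\<Gamma> \<inter> (Q k - B) \<times> (Q k - B))\<^sup>*))"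
    using expansion[OF \<delta>(1)] by blast
  have "1 \<le> 2 * L" using LM by simp
  from profile[OF this] obtain C0 where C0: "0 < C0"
    and prof: "\<forall>\<^sub>F k in sequentially. \<forall>n\<ge>2. real n \<le> 2 * L * real (card (Q k)) \<longrightarrow> g n \<le> C0 * f k"
    by blast
  define P where "P k \<longleftrightarrow> (\<forall>B\<subseteq>Q k. real (card B) \<le> \<epsilon> * f k \<longrightarrow>
       (\<exists>T\<subseteq>Q k - B. real (card (Q k - T)) \<le> \<delta> * real (card (Q k)) \<and>
         (\<forall>p\<in>T. \<forall>q\<in>T. (p, q) \<in> (\<Gamma> \<inter> (Q k - B) \<times> (Q k - B))\<^sup>*))) \<and>
      (\<forall>n\<ge>2. real n \<le> 2 * L * real (card (Q k)) \<longrightarrow> g n \<le> C0 * f k) \<and>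
      real (card (Q (Suc k))) - real (card (Q k)) \<le> \<delta> * real (card (Q k))" for k
  have "eventually P sequentially"
    unfolding P_def by (intro eventually_conj exp prof growth[OF \<delta>(1)])
  then obtain k0 where k0: "\<And>k. k0 \<le> k \<Longrightarrow> P k" by (auto simp: eventually_sequentially)
  have large: "\<epsilon> / (M * C0) * g n \<le> real (sep V E n)" if n: "2 \<le> n" "card (S k0) \<le> n" for n
  proof -
    have "\<exists>j. n < card (S j)"
    proof -
      have "\<forall>\<^sub>F k in sequentially. M * real n < real (card (Q k))"
        using unbounded by (simp add: filterlim_at_top_dense)
      then obtain j where "M * real n < real (card (Q j))" by (auto simp: eventually_sequentially)
      then have "M * real n < M * real (card (S j))" using QS[of j] by linarith
      then show ?thesis using LM by auto
    qed
    define j where "j = (LEAST j. n < card (S j))"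
    have j: "n < card (S j)" unfolding j_def using \<open>\<exists>j. n < card (S j)\<close> by (rule LeastI_ex)
    have monoS: "card (S i) \<le> card (S k)" if "i \<le> k" for i k
    proof (rule card_mono[OF finS])
      have "Q i \<subseteq> Q k" using lift_Suc_mono_le[of Q, OF monoQ that] .
      then show "S i \<subseteq> S k" by (auto simp: S_def)
    qed
    have "k0 < j" using monoS[of j k0] j n(2) by (meson leD le_trans not_less)
    define k where "k = j - 1"
    have k: "k0 \<le> k" "j = Suc k" using \<open>k0 < j\<close> by (auto simp: k_def)
    have nk: "card (S k) \<le> n" "n < card (S (Suc k))"
      using j k not_less_Least[of k "\<lambda>j. n < card (S j)"] by (auto simp: j_def not_less)
    note kk = k0[OF k(1), unfolded P_def]
    have step: "real (card (S (Suc k))) \<le> 9 / 8 * real (card (S k))"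
    proof -
      have "Q (Suc k) = Q k \<union> (Q (Suc k) - Q k)" using monoQ[of k] by blast
      then have "S (Suc k) = S k \<union> \<Union>(K ` (Q (Suc k) - Q k))" unfolding S_def by blast
      then have "card (S (Suc k)) \<le> card (S k) + card (\<Union>(K ` (Q (Suc k) - Q k)))"
        using card_Un_le by metis
      then have "real (card (S (Suc k))) \<le> real (card (S k)) + L * real (card (Q (Suc k) - Q k))"
        using UL[of "Q (Suc k) - Q k" "Suc k"] by auto
      also have "real (card (Q (Suc k) - Q k)) = real (card (Q (Suc k))) - real (card (Q k))"
        using card_Diff_subset[OF finQ monoQ, of k] card_mono[OF finQ monoQ, of k] by simp
      also have "L * (real (card (Q (Suc k))) - real (card (Q k))) \<le> L * (\<delta> * real (card (Q k)))"
        using kk LM by (intro mult_left_mono) auto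
      finally show ?thesis using \<delta>S[of k] by linarith
    qed
    have "S k \<subseteq> S (Suc k)" using monoQ[of k] by (auto simp: S_def)
    \<comment> \<open>The test set consists of \<open>S k\<close> and enough further vertices to
      have exactly \<open>n\<close>; adding vertices cannot disconnect anything.\<close>
    then obtain R where R: "S k \<subseteq> R" "R \<subseteq> S (Suc k)" "card R = n"
      using exists_subset_between[of "S k" n "S (Suc k)"] nk finS by auto
    have RV: "R \<subseteq> V" "finite R" "R \<noteq> {}"
      using R(2) SV[of "Suc k"] finite_subset[OF R(2) finS] R(3) n(1) by auto
    have "\<epsilon> / (M * C0) * g n \<le> real (cut E R)"
    proof (rule cut_ge[OF RV(2,3)])
      fix C assume C: "C \<subseteq> R" "shattered E (real (card R) / 2) (R - C)"
      define B where "B = {q \<in> Q k. K q \<inter> C \<noteq> {}}"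
      have cB: "real (card B) \<le> M * real (card C)"
        unfolding B_def using C(1) RV by (intro hit) (auto intro: finite_subset)
      have notsmall: "\<not> real (card B) \<le> \<epsilon> * f k"
      proof
        assume "real (card B) \<le> \<epsilon> * f k"
        moreover have "B \<subseteq> Q k" by (auto simp: B_def)
        ultimately obtain T where T: "T \<subseteq> Q k - B" "real (card (Q k - T)) \<le> \<delta> * real (card (Q k))"
          "\<forall>p\<in>T. \<forall>q\<in>T. (p, q) \<in> (\<Gamma> \<inter> (Q k - B) \<times> (Q k - B))\<^sup>*"
          using kk by blast
        define U where "U = \<Union>(K ` T)"
        have sub: "\<Union>(K ` (Q k - B)) \<subseteq> R - C" using R(1) by (auto simp: S_def B_def)
        have US: "U \<subseteq> S k" using T(1) by (auto simp: U_def S_def)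
        have "S k \<subseteq> U \<union> \<Union>(K ` (Q k - T))" by (auto simp: U_def S_def)
        then have "card (S k) \<le> card (U \<union> \<Union>(K ` (Q k - T)))"
          using finS US cell finQ by (intro card_mono) (auto intro: finite_subset)
        also have "\<dots> \<le> card U + card (\<Union>(K ` (Q k - T)))" by (rule card_Un_le)
        finally have "real (card (S k)) \<le> real (card U) + L * real (card (Q k - T))"
          using UL[of "Q k - T" k] by auto
        also have "L * real (card (Q k - T)) \<le> L * (\<delta> * real (card (Q k)))"
          using T(2) LM by (intro mult_left_mono) auto
        finally have cU: "7 / 8 * real (card (S k)) \<le> real (card U)" using \<delta>S[of k] by linarith
        \<comment> \<open>\<open>n\<close> is below \<open>9 / 8\<close> of
          \<open>card (S k)\<close>, and half of that is less than the \<open>7 / 8\<close> covered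
          by \<open>U\<close>.\<close>
        have nU: "real n / 2 < real (card U)"
        proof -
          have "real n < real (card (S (Suc k)))" using nk(2) by simp
          then show ?thesis using step cU by linarith
        qed
        then have "U \<noteq> {}" by auto
        then obtain u where u: "u \<in> U" by blast
        have "U \<subseteq> component E (R - C) u"
        proof
          fix w assume w: "w \<in> U"
          obtain p q where pq: "p \<in> T" "u \<in> K p" "q \<in> T" "w \<in> K q" using u w by (auto simp: U_def)
          have link: "(p, q) \<in> (\<Gamma> \<inter> (Q k - B) \<times> (Q k - B))\<^sup>*" using T(3) pq by blast
          have p: "p \<in> Q k - B" using pq T(1) by blast
          have cellB: "conn E (K r)" if "r \<in> Q k - B" for r
            using cell[of r k] that by simp
          have adjB: "\<exists>u\<in>K r. \<exists>w\<in>K s. u = w \<or> (u, w) \<in> E"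
            if "r \<in> Q k - B" "s \<in> Q k - B" "(r, s) \<in> \<Gamma>" for r s
            using adj[of r k s] that by simp
          have "(u, w) \<in> (E \<inter> (\<Union>(K ` (Q k - B))) \<times> (\<Union>(K ` (Q k - B))))\<^sup>*"
            by (rule cells_conn[OF link p pq(2,4) cellB adjB])
          then have "(u, w) \<in> (E \<inter> (R - C) \<times> (R - C))\<^sup>*" using sub by (rule rtrancl_Restr_mono)
          moreover have "w \<in> R - C" using pq T(1) sub by blast
          ultimately show "w \<in> component E (R - C) u" by (simp add: component_def)
        qed
        then have "card U \<le> card (component E (R - C) u)"
          using RV(2) by (intro card_mono) (auto simp: component_def)
        moreover have "u \<in> R - C" using u T(1) sub by (auto simp: U_def)
        ultimately show False using C(2) nU R(3) by (force simp: shattered_def)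
      qed
      have "real n \<le> 2 * L * real (card (Q k))"
      proof -
        have "real n < real (card (S (Suc k)))" using nk(2) by simp
        moreover have "real (card (S k)) \<le> L * real (card (Q k))" using UL[of "Q k" k] by (simp add: S_def)
        ultimately show ?thesis using step by linarith
      qed
      then have "g n \<le> C0 * f k" using kk n(1) by blast
      then have "\<epsilon> / (M * C0) * g n \<le> \<epsilon> / (M * C0) * (C0 * f k)"
        using \<epsilon> LM C0 by (intro mult_left_mono) auto
      also have "\<dots> = \<epsilon> * f k / M" using C0 by simp
      also have "\<dots> \<le> real (card C)" using notsmall cB LM by (simp add: field_simps)
      finally show "\<epsilon> / (M * C0) * g n \<le> real (card C)" .
    qed
    also have "\<dots> \<le> real (sep V E n)"
      using cut_le_sep[OF _ RV(1,2) R(3), of E] n by simp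
    finally show ?thesis .
  qed
  define N where "N = card (S k0)"
  \<comment> \<open>For the finitely many \<open>n < N\<close>, \<open>1 / G\<close> scales
    \<open>g n\<close> down to at most 1, and \<open>sep V E n\<close> is at least 1.\<close>
  define G where "G = 1 + (\<Sum>n<N. \<bar>g n\<bar>)"
  have G: "1 \<le> G" by (simp add: G_def sum_nonneg)
  define c where "c = min (\<epsilon> / (M * C0)) (1 / G)"
  have c0: "0 < c" using \<epsilon> LM C0 G by (simp add: c_def)
  have "c * g n \<le> real (sep V E n)" if n: "2 \<le> n" for n
  proof (cases "g n \<le> 0")
    case True
    then have "c * g n \<le> 0" using c0 by (simp add: mult_le_0_iff)
    then show ?thesis by linarith
  next
    case pos: False
    show ?thesis
    proof (cases "N \<le> n")
      case True
      have "c * g n \<le> \<epsilon> / (M * C0) * g n" using pos by (intro mult_right_mono) (auto simp: c_def)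
      then show ?thesis using large[OF n] True by (simp add: N_def)
    next
      case False
      have "g n \<le> G"
        using member_le_sum[of n "{..<N}" "\<lambda>n. \<bar>g n\<bar>"] False by (simp add: G_def)
      then have "c * g n \<le> 1 / G * G" using pos G c0 by (intro mult_mono) (auto simp: c_def)
      moreover have "1 \<le> sep V E n"
        using small[of n] n one_le_sep[of n _ V E] by force
      ultimately show ?thesis using G by simp
    qed
  qed
  then show ?thesis using that c0 by blast
qed

section \<open>Expansion of cubes in the lattice\<close>

text \<open>Points that vanish from index \<open>D\<close> on correspond to functions that are
  undefined there, so the count is that of a \<open>PiE\<close>.\<close>

lemma lattice_box:
  fixes R :: "nat \<Rightarrow> int set"
  assumes "\<And>i. i < D \<Longrightarrow> finite (R i)"
  shows "finite {x \<in> lattice_verts D. \<forall>i<D. x i \<in> R i}"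
    and "card {x \<in> lattice_verts D. \<forall>i<D. x i \<in> R i} = (\<Prod>i<D. card (R i))"
proof -
  let ?X = "{x \<in> lattice_verts D. \<forall>i<D. x i \<in> R i}"
  have "bij_betw (\<lambda>x. restrict x {..<D}) ?X (PiE {..<D} R)"
  proof (rule bij_betw_byWitness[where f' = "\<lambda>y i. if i < D then y i else 0"])
    show "\<forall>x\<in>?X. (\<lambda>i. if i < D then restrict x {..<D} i else 0) = x"
      by (auto simp: lattice_verts_def fun_eq_iff)
    show "\<forall>y\<in>PiE {..<D} R. restrict (\<lambda>i. if i < D then y i else 0) {..<D} = y"
    proof
      fix y assume "y \<in> PiE {..<D} R"
      then show "restrict (\<lambda>i. if i < D then y i else 0) {..<D} = y"
        by (auto simp: fun_eq_iff restrict_def PiE_def extensional_def)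
    qed
    show "(\<lambda>x. restrict x {..<D}) ` ?X \<subseteq> PiE {..<D} R"
      by (intro image_subsetI restrict_PiE_iff[THEN iffD2]) simp
    show "(\<lambda>y i. if i < D then y i else 0) ` PiE {..<D} R \<subseteq> ?X"
      by (intro image_subsetI) (simp add: lattice_verts_def PiE_def Pi_def)
  qed
  moreover have "finite (PiE {..<D} R)" using assms by (intro finite_PiE) auto
  ultimately show "finite ?X" "card ?X = (\<Prod>i<D. card (R i))"
    by (simp_all add: bij_betw_finite bij_betw_same_card card_PiE)
qed

definition cube :: "nat \<Rightarrow> nat \<Rightarrow> (nat \<Rightarrow> int) set" where
  "cube D m = {x \<in> lattice_verts D. \<forall>i<D. x i \<in> {0..<int m}}"

lemma finite_cube: "finite (cube D m)" and card_cube: "card (cube D m) = m ^ D"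
  using lattice_box[of D "\<lambda>_. {0..<int m}"] by (simp_all add: cube_def)

lemma cube_mono: "cube D m \<subseteq> cube D (Suc m)"
  by (auto simp: cube_def)

lemma sym_lattice_edges: "sym (lattice_edges D)"
  by (auto simp: sym_def lattice_edges_def abs_minus_commute)

lemma lattice_step:
  assumes "x \<in> lattice_verts D" "i < D"
  shows "(x(i := c), x(i := c + 1)) \<in> lattice_edges D"
proof -
  have "(\<Sum>j<D. \<bar>(x(i := c)) j - (x(i := c + 1)) j\<bar>) = (\<Sum>j<D. if j = i then 1 else 0)"
    by (intro sum.cong) auto
  also have "\<dots> = 1" using assms(2) by simp
  finally show ?thesis using assms by (auto simp: lattice_edges_def lattice_verts_def)
qed

lemma sym_Restr: "sym E \<Longrightarrow> sym (E \<inter> X \<times> X)"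
  by (auto simp: sym_def)

lemma lattice_line:
  assumes "x \<in> lattice_verts D" "i < D" "a \<le> b" "\<And>c. a \<le> c \<Longrightarrow> c \<le> b \<Longrightarrow> x(i := c) \<in> X"
  shows "(x(i := a), x(i := b)) \<in> (lattice_edges D \<inter> X \<times> X)\<^sup>*"
  using assms(3,4)
proof (induction b rule: int_ge_induct)
  case (step b)
  have X: "x(i := b) \<in> X" "x(i := b + 1) \<in> X" using step.hyps by (intro step.prems; simp)+
  have "(x(i := b), x(i := b + 1)) \<in> lattice_edges D \<inter> X \<times> X"
    using lattice_step[OF assms(1,2), of b] X by (intro IntI SigmaI)
  moreover have "(x(i := a), x(i := b)) \<in> (lattice_edges D \<inter> X \<times> X)\<^sup>*"
    by (rule step.IH) (rule step.prems; simp)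
  ultimately show ?case by (meson rtrancl.rtrancl_into_rtrancl)
qed simp

text \<open>The path from \<open>x\<close> to \<open>y\<close> that corrects the coordinates one after the other runs through these points.\<close>

definition hybrid :: "(nat \<Rightarrow> int) \<Rightarrow> (nat \<Rightarrow> int) \<Rightarrow> nat \<Rightarrow> nat \<Rightarrow> int" where
  "hybrid x y i = (\<lambda>j. if j < i then y j else x j)"

lemma hybrid_cube:
  assumes "x \<in> cube D m" "y \<in> cube D m"
  shows "hybrid x y i \<in> cube D m"
  using assms by (auto simp: cube_def hybrid_def lattice_verts_def)

text \<open>Leg \<open>i\<close> changes coordinate \<open>i\<close> only. Asking for the whole line
  of the cube in this direction makes blocked pairs easy to count.\<close>

lemma hybrid_path:
  assumes "x \<in> cube D m" "y \<in> cube D m"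
    and "\<And>i c. i < D \<Longrightarrow> 0 \<le> c \<Longrightarrow> c < int m \<Longrightarrow> (hybrid x y i)(i := c) \<in> X"
  shows "(x, y) \<in> (lattice_edges D \<inter> X \<times> X)\<^sup>*"
proof -
  have "k \<le> D \<Longrightarrow> (x, hybrid x y k) \<in> (lattice_edges D \<inter> X \<times> X)\<^sup>*" for k
  proof (induction k)
    case 0
    have "hybrid x y 0 = x" by (simp add: hybrid_def)
    then show ?case by simp
  next
    case (Suc k)
    let ?h = "hybrid x y k" and ?R = "(lattice_edges D \<inter> X \<times> X)\<^sup>*"
    have h: "?h \<in> lattice_verts D" using hybrid_cube[OF assms(1,2)] by (auto simp: cube_def)
    have e: "?h(k := x k) = ?h" "?h(k := y k) = hybrid x y (Suc k)"
      by (auto simp: hybrid_def fun_eq_iff)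
    have r: "0 \<le> x k" "x k < int m" "0 \<le> y k" "y k < int m" "k < D"
      using assms(1,2) Suc(2) by (auto simp: cube_def)
    have symR: "sym ?R" by (intro sym_rtrancl sym_Restr sym_lattice_edges)
    have "(?h(k := x k), ?h(k := y k)) \<in> ?R"
    proof (cases "x k \<le> y k")
      case True
      then show ?thesis using assms(3) r by (intro lattice_line h) auto
    next
      case False
      then have "(?h(k := y k), ?h(k := x k)) \<in> ?R" using assms(3) r by (intro lattice_line h) auto
      then show ?thesis using symR by (meson symD)
    qed
    then show ?case using Suc e by (metis Suc_leD rtrancl_trans)
  qed
  moreover have "hybrid x y D = y"
    using assms(1,2) by (auto simp: hybrid_def cube_def lattice_verts_def fun_eq_iff)
  ultimately show ?thesis by (metis order_refl)
qed

text \<open>The point \<open>b\<close> reveals \<open>y\<close> below index \<open>i\<close> and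
  \<open>x\<close> above it. What remains, \<open>x\<close> up to \<open>i\<close> and
  \<open>y\<close> from \<open>i\<close> on, are \<open>D + 1\<close> coordinates, and these are
  what \<open>?f\<close> records.\<close>

lemma blocked_pairs:
  assumes "i < D"
  shows "card {(x, y). x \<in> cube D m \<and> y \<in> cube D m \<and> (\<exists>c. (hybrid x y i)(i := c) = b)} \<le> m ^ D * m"
proof -
  let ?P = "{(x, y). x \<in> cube D m \<and> y \<in> cube D m \<and> (\<exists>c. (hybrid x y i)(i := c) = b)}"
  let ?f = "\<lambda>(x, y). (hybrid y x i, x i)"
  have "inj_on ?f ?P"
  proof (rule inj_onI, clarsimp)
    fix x y x' y' c c'
    assume b: "(hybrid x' y' i)(i := c') = (hybrid x y i)(i := c)" "b = (hybrid x y i)(i := c)"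
      and f: "hybrid y x i = hybrid y' x' i" "x i = x' i"
    have bj: "(if j = i then c' else if j < i then y' j else x' j) = (if j = i then c else if j < i then y j else x j)" for j
      using fun_cong[OF b(1), of j] by (simp add: hybrid_def)
    have fj: "(if j < i then x j else y j) = (if j < i then x' j else y' j)" for j
      using fun_cong[OF f(1), of j] by (simp add: hybrid_def)
    have "x j = x' j" "y j = y' j" for j
      using bj[of j] fj[of j] f(2) by (auto split: if_splits simp: not_less_iff_gr_or_eq)
    then show "x = x' \<and> y = y'" by auto
  qed
  moreover have "?f ` ?P \<subseteq> cube D m \<times> {0..<int m}"
    using assms hybrid_cube by (auto simp: cube_def) (auto simp: hybrid_def lattice_verts_def)
  moreover have "finite (cube D m \<times> {0..<int m})" using finite_cube by simp
  ultimately have "card ?P \<le> card (cube D m \<times> {0..<int m})" by (rule card_inj_on_le)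
  then show ?thesis by (simp add: card_cartesian_product card_cube)
qed

text \<open>Double counting: at most \<open>D * card B * m ^ (D + 1)\<close> pairs have a blocked
  path, so some \<open>x\<close> has at most \<open>D * m * card B\<close> blocked partners. All
  other points are joined to this \<open>x\<close>.\<close>

lemma cube_expansion:
  assumes D: "0 < D" and m: "0 < m" and B: "B \<subseteq> cube D m"
  obtains T where "T \<subseteq> cube D m - B" "real (card (cube D m - T)) \<le> real D * real m * real (card B)"
    "\<forall>p\<in>T. \<forall>q\<in>T. (p, q) \<in> (lattice_edges D \<inter> (cube D m - B) \<times> (cube D m - B))\<^sup>*"
proof -
  let ?Q = "cube D m"
  define bad where "bad x y \<longleftrightarrow> (\<exists>i<D. \<exists>c. (hybrid x y i)(i := c) \<in> B)" for x y
  define P where "P i b = {(x, y). x \<in> ?Q \<and> y \<in> ?Q \<and> (\<exists>c. (hybrid x y i)(i := c) = b)}" for i b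
  have finP: "finite (P i b)" for i b
    by (rule finite_subset[of _ "?Q \<times> ?Q"]) (auto simp: P_def finite_cube)
  have finB: "finite B" using B finite_cube finite_subset by blast
  have "(SIGMA x:?Q. {y \<in> ?Q. bad x y}) = (\<Union>i\<in>{..<D}. \<Union>b\<in>B. P i b)"
    by (auto simp: bad_def P_def)
  moreover have "real (card (\<Union>i\<in>{..<D}. \<Union>b\<in>B. P i b)) \<le> real (card {..<D}) * (real (card B) * real (m ^ D * m))"
    by (intro real_card_UN_le finB) (use blocked_pairs in \<open>auto simp: P_def simp del: of_nat_mult of_nat_power\<close>)
  ultimately have "real (card (SIGMA x:?Q. {y \<in> ?Q. bad x y})) \<le> real D * real m * real (card B) * real (card ?Q)"
    by (simp add: card_cube mult_ac)
  then have sum: "(\<Sum>x\<in>?Q. real (card {y \<in> ?Q. bad x y})) \<le> (\<Sum>x\<in>?Q. real D * real m * real (card B))"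
    by (simp add: card_SigmaI finite_cube mult_ac)
  have "\<exists>x\<in>?Q. real (card {y \<in> ?Q. bad x y}) \<le> real D * real m * real (card B)"
  proof (rule ccontr)
    assume "\<not> ?thesis"
    moreover have "?Q \<noteq> {}" using card_cube[of D m] m by force
    ultimately have "(\<Sum>x\<in>?Q. real D * real m * real (card B)) < (\<Sum>x\<in>?Q. real (card {y \<in> ?Q. bad x y}))"
      by (intro sum_strict_mono finite_cube) auto
    then show False using sum by linarith
  qed
  then obtain x where x: "x \<in> ?Q" "real (card {y \<in> ?Q. bad x y}) \<le> real D * real m * real (card B)"
    by blast
  define T where "T = {y \<in> ?Q. \<not> bad x y}"
  have reach: "(x, y) \<in> (lattice_edges D \<inter> (?Q - B) \<times> (?Q - B))\<^sup>*" if "y \<in> T" for y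
  proof (rule hybrid_path[OF x(1)])
    show "y \<in> ?Q" using that by (simp add: T_def)
    fix i c assume "i < D" "0 \<le> c" "c < int m"
    moreover have "hybrid x y i \<in> ?Q" using hybrid_cube x(1) \<open>y \<in> ?Q\<close> by blast
    ultimately show "(hybrid x y i)(i := c) \<in> ?Q - B"
      using that by (auto simp: T_def bad_def cube_def lattice_verts_def)
  qed
  show ?thesis
  proof (rule that[of T])
    show "T \<subseteq> ?Q - B"
    proof
      fix y assume y: "y \<in> T"
      \<comment> \<open>The last leg ends in \<open>y\<close>, so a point of \<open>B\<close> counts
        as bad.\<close>
      have "(hybrid x y (D - 1))(D - 1 := y (D - 1)) = y"
        using x(1) y by (auto simp: T_def hybrid_def cube_def lattice_verts_def fun_eq_iff)
      moreover have "D - 1 < D" using D by simp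
      ultimately have "y \<notin> B" using y unfolding T_def bad_def by (metis (mono_tags, lifting) mem_Collect_eq)
      then show "y \<in> ?Q - B" using y by (simp add: T_def)
    qed
    have "?Q - T = {y \<in> ?Q. bad x y}" by (auto simp: T_def)
    then show "real (card (?Q - T)) \<le> real D * real m * real (card B)" using x(2) by simp
    let ?R = "(lattice_edges D \<inter> (?Q - B) \<times> (?Q - B))\<^sup>*"
    have symR: "sym ?R" by (intro sym_rtrancl sym_Restr sym_lattice_edges)
    show "\<forall>p\<in>T. \<forall>q\<in>T. (p, q) \<in> ?R"
      by (intro ballI) (rule rtrancl_trans[OF symD[OF symR reach] reach])
  qed
qed

text \<open>The ratio of consecutive cubes, \<open>(1 + 1 / k) ^ D\<close>, tends to 1.\<close>

lemma cube_growth: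
  assumes "0 < \<delta>"
  shows "\<forall>\<^sub>F k in sequentially. real (card (cube D (Suc k))) - real (card (cube D k)) \<le> \<delta> * real (card (cube D k))"
proof -
  have "((\<lambda>k. (1 + 1 / real k) ^ D) \<longlongrightarrow> (1 + 0) ^ D) sequentially"
    by (intro tendsto_power tendsto_add tendsto_const lim_1_over_n)
  then have "\<forall>\<^sub>F k in sequentially. (1 + 1 / real k) ^ D < 1 + \<delta>"
    using assms by (intro order_tendstoD(2)[of _ "(1 + 0) ^ D"]) auto
  then show ?thesis using eventually_gt_at_top[of 0]
  proof eventually_elim
    case (elim k)
    have "real (Suc k) ^ D = (1 + 1 / real k) ^ D * real k ^ D"
      using elim(2) by (simp add: field_simps flip: power_mult_distrib)
    also have "\<dots> \<le> (1 + \<delta>) * real k ^ D" using elim(1) by (intro mult_right_mono) auto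
    finally show ?case by (simp add: card_cube algebra_simps)
  qed
qed

lemma cube_unbounded:
  assumes "0 < D"
  shows "filterlim (\<lambda>k. real (card (cube D k))) at_top sequentially"
proof (rule filterlim_at_top_mono[OF filterlim_real_sequentially])
  show "\<forall>\<^sub>F k in sequentially. real k \<le> real (card (cube D k))"
    using eventually_gt_at_top[of 0]
  proof eventually_elim
    case (elim k)
    then have "k ^ 1 \<le> k ^ D" using assms by (intro power_increasing) auto
    then show ?case by (simp add: card_cube flip: of_nat_power)
  qed
qed

lemma cube_expansion_rate:
  assumes "0 < D" "0 < \<delta>"
  shows "\<exists>\<epsilon>>0. \<forall>\<^sub>F k in sequentially. \<forall>B\<subseteq>cube D k. real (card B) \<le> \<epsilon> * real k ^ (D - 1) \<longrightarrow>
     (\<exists>T\<subseteq>cube D k - B. real (card (cube D k - T)) \<le> \<delta> * real (card (cube D k)) \<and>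
       (\<forall>p\<in>T. \<forall>q\<in>T. (p, q) \<in> (lattice_edges D \<inter> (cube D k - B) \<times> (cube D k - B))\<^sup>*))"
proof (intro exI conjI)
  show "0 < \<delta> / real D" using assms by simp
  show "\<forall>\<^sub>F k in sequentially. \<forall>B\<subseteq>cube D k. real (card B) \<le> \<delta> / real D * real k ^ (D - 1) \<longrightarrow>
     (\<exists>T\<subseteq>cube D k - B. real (card (cube D k - T)) \<le> \<delta> * real (card (cube D k)) \<and>
       (\<forall>p\<in>T. \<forall>q\<in>T. (p, q) \<in> (lattice_edges D \<inter> (cube D k - B) \<times> (cube D k - B))\<^sup>*))"
    using eventually_gt_at_top[of 0]
  proof eventually_elim
    case (elim k)
    show ?case
    proof (intro allI impI)
      fix B assume B: "B \<subseteq> cube D k" "real (card B) \<le> \<delta> / real D * real k ^ (D - 1)"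
      obtain T where T: "T \<subseteq> cube D k - B" "real (card (cube D k - T)) \<le> real D * real k * real (card B)"
        "\<forall>p\<in>T. \<forall>q\<in>T. (p, q) \<in> (lattice_edges D \<inter> (cube D k - B) \<times> (cube D k - B))\<^sup>*"
        by (rule cube_expansion[OF assms(1) elim B(1)], rule that, assumption+)
      have "real D * real k * real (card B) \<le> real D * real k * (\<delta> / real D * real k ^ (D - 1))"
        using B(2) by (intro mult_left_mono) auto
      also have "\<dots> = \<delta> * real (card (cube D k))"
        using assms(1) by (cases D) (simp_all add: card_cube)
      finally show "\<exists>T\<subseteq>cube D k - B. real (card (cube D k - T)) \<le> \<delta> * real (card (cube D k)) \<and>
        (\<forall>p\<in>T. \<forall>q\<in>T. (p, q) \<in> (lattice_edges D \<inter> (cube D k - B) \<times> (cube D k - B))\<^sup>*)"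
        using T by (intro exI[of _ T] conjI) simp_all
    qed
  qed
qed

lemma cube_profile:
  assumes "0 < D" "1 \<le> A"
  shows "\<exists>C>0. \<forall>\<^sub>F k in sequentially. \<forall>n\<ge>2. real n \<le> A * real (card (cube D k)) \<longrightarrow>
    real n powr ((real D - 1) / real D) \<le> C * real k ^ (D - 1)"
proof (intro exI conjI)
  let ?e = "(real D - 1) / real D"
  show "0 < A powr ?e" using assms by simp
  show "\<forall>\<^sub>F k in sequentially. \<forall>n\<ge>2. real n \<le> A * real (card (cube D k)) \<longrightarrow>
    real n powr ?e \<le> A powr ?e * real k ^ (D - 1)"
    using eventually_gt_at_top[of 0]
  proof eventually_elim
    case (elim k)
    show ?case
    proof (intro allI impI)
      fix n :: nat assume n: "real n \<le> A * real (card (cube D k))"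
      have "real n powr ?e \<le> (A * real k ^ D) powr ?e"
        using n assms(1) by (intro powr_mono2) (auto simp: card_cube)
      also have "\<dots> = A powr ?e * (real k powr real D) powr ?e"
        using assms(2) elim by (simp add: powr_mult powr_realpow)
      also have "(real k powr real D) powr ?e = real k ^ (D - 1)"
        using assms(1) elim by (simp add: powr_powr of_nat_diff flip: powr_realpow)
      finally show "real n powr ?e \<le> A powr ?e * real k ^ (D - 1)" .
    qed
  qed
qed

section \<open>Expansion of the heap-numbered tree\<close>

text \<open>
  The heap numbering of the infinite binary tree (\<open>v\<close> has children \<open>2 v\<close> and \<open>2 v + 1\<close>),
  with consecutive vertices of a level joined.
\<close>

definition heap_edges :: "(nat \<times> nat) set" where
  "heap_edges = {(u, v). 0 < u \<and> 0 < v \<and> (u = v div 2 \<or> v = u div 2 \<or>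
     (\<exists>j. 2 ^ j \<le> u \<and> u < 2 ^ Suc j \<and> 2 ^ j \<le> v \<and> v < 2 ^ Suc j \<and> (u = Suc v \<or> v = Suc u)))}"

lemma sym_heap_edges: "sym heap_edges"
  by (auto simp: sym_def heap_edges_def)

lemma div_power2_interval: "(v::nat) div 2 ^ i = b \<Longrightarrow> v \<in> {b * 2 ^ i..<(b + 1) * 2 ^ i}"
  by (auto simp: div_nat_eqI dividend_less_times_div mult.commute)

text \<open>The intact row \<open>j\<close> is a path, and a vertex climbs to it through its
  ancestors \<open>v div 2 ^ i\<close>. Lost are only the vertices above the row and the descendants
  of \<open>B\<close>; a vertex of \<open>B\<close> at level \<open>j\<close> or deeper has fewer
  than \<open>2 ^ Suc (J - j)\<close> of them down to level \<open>J\<close>, itself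
  included.\<close>

lemma tree_row_expansion:
  assumes J: "k < 2 ^ Suc J" "2 ^ J \<le> k" and j: "j < J"
    and B: "B \<subseteq> {1..k}" "\<And>v. 2 ^ j \<le> v \<Longrightarrow> v < 2 ^ Suc j \<Longrightarrow> v \<notin> B"
  obtains T where "T \<subseteq> {1..k} - B"
    "real (card ({1..k} - T)) \<le> 2 ^ j + real (card B) * 2 ^ Suc (J - j)"
    "\<forall>p\<in>T. \<forall>q\<in>T. (p, q) \<in> (heap_edges \<inter> ({1..k} - B) \<times> ({1..k} - B))\<^sup>*"
proof -
  let ?X = "{1..k} - B"
  let ?R = "(heap_edges \<inter> ?X \<times> ?X)\<^sup>*"
  define T where "T = {v \<in> {1..k}. 2 ^ j \<le> v \<and> (\<forall>i. 2 ^ j \<le> v div 2 ^ i \<longrightarrow> v div 2 ^ i \<notin> B)}"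
  have TX: "T \<subseteq> ?X"
  proof
    fix v assume v: "v \<in> T"
    then have "v div 2 ^ 0 \<notin> B" unfolding T_def by (metis (mono_tags, lifting) div_by_1 mem_Collect_eq power_0)
    then show "v \<in> ?X" using v by (auto simp: T_def)
  qed
  have row: "v \<in> ?X" if "2 ^ j \<le> v" "v < 2 ^ Suc j" for v
  proof -
    have "(2::nat) ^ Suc j \<le> 2 ^ J" using j by (intro power_increasing) auto
    moreover have "0 < (2::nat) ^ j" by simp
    ultimately show ?thesis using that J(2) B(2)[OF that] by auto
  qed
  have reach: "(2 ^ j, v) \<in> ?R" if "v \<in> T" for v
    using that
  proof (induction v rule: less_induct)
    case (less v)
    show ?case
    proof (cases "v < 2 ^ Suc j")
      case True
      have "2 ^ j \<le> v" using less.prems by (simp add: T_def)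
      then show ?thesis using True
      proof (induction v rule: dec_induct)
        case (step u)
        then have "(u, Suc u) \<in> heap_edges \<inter> ?X \<times> ?X"
          using row[of u] row[of "Suc u"] by (auto simp: heap_edges_def)
        then show ?case using step by (meson Suc_lessD rtrancl.rtrancl_into_rtrancl)
      qed simp
    next
      case False
      have v2: "2 ^ j \<le> v div 2" using False by simp
      have "0 < v div 2" using v2 by (meson less_le_trans pos2 zero_less_power)
      have allT: "\<forall>i. 2 ^ j \<le> v div 2 ^ i \<longrightarrow> v div 2 ^ i \<notin> B" using less.prems by (simp add: T_def)
      have "v div 2 div 2 ^ i \<notin> B" if "2 ^ j \<le> v div 2 div 2 ^ i" for i
        using allT[rule_format, of "Suc i"] that by (simp add: div_mult2_eq)
      moreover have "v div 2 \<le> k"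
        using less.prems div_le_dividend[of v 2] unfolding T_def by (simp del: div_le_dividend)
      ultimately have T2: "v div 2 \<in> T" using v2 \<open>0 < v div 2\<close> by (simp add: T_def)
      have "v div 2 < v" using \<open>0 < v div 2\<close> by simp
      moreover have "(v div 2, v) \<in> heap_edges \<inter> ?X \<times> ?X"
        using TX T2 less.prems by (auto simp: heap_edges_def)
      ultimately show ?thesis using less.IH T2 by (meson rtrancl.rtrancl_into_rtrancl)
    qed
  qed
  show ?thesis
  proof (rule that[of T])
    show "T \<subseteq> ?X" by (rule TX)
    have finB: "finite B" using B(1) finite_subset by blast
    have "{1..k} - T \<subseteq> {1..<2 ^ j} \<union> (\<Union>b\<in>B. \<Union>i\<in>{..<Suc (J - j)}. {b * 2 ^ i..<(b + 1) * 2 ^ i})"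
    proof
      fix v assume v: "v \<in> {1..k} - T"
      show "v \<in> {1..<2 ^ j} \<union> (\<Union>b\<in>B. \<Union>i\<in>{..<Suc (J - j)}. {b * 2 ^ i..<(b + 1) * 2 ^ i})"
      proof (cases "v < 2 ^ j")
        case False
        then obtain i where i: "2 ^ j \<le> v div 2 ^ i" "v div 2 ^ i \<in> B" using v by (auto simp: T_def)
        have "2 ^ j * 2 ^ i \<le> v" using i(1) by (meson div_times_less_eq_dividend le_trans mult_le_mono1)
        also have "v < 2 ^ Suc J" using v J(1) by auto
        finally have "(2::nat) ^ (j + i) < 2 ^ Suc J" by (simp add: power_add)
        then have "j + i < Suc J" by (rule power_less_imp_less_exp[rotated]) simp
        then have "i < Suc (J - j)" using j by linarith
        then show ?thesis using i(2) div_power2_interval[OF refl, of v i] by blast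
      qed (use v in simp)
    qed
    then have "card ({1..k} - T) \<le> card ({1..<2 ^ j} \<union> (\<Union>b\<in>B. \<Union>i\<in>{..<Suc (J - j)}. {b * 2 ^ i..<(b + 1) * 2 ^ i}))"
      using finB by (intro card_mono) auto
    also have "\<dots> \<le> card {1..<(2::nat) ^ j} + card (\<Union>b\<in>B. \<Union>i\<in>{..<Suc (J - j)}. {b * 2 ^ i..<(b + 1) * 2 ^ i})"
      by (rule card_Un_le)
    finally have "real (card ({1..k} - T)) \<le> real (card {1..<(2::nat) ^ j})
        + real (card (\<Union>b\<in>B. \<Union>i\<in>{..<Suc (J - j)}. {b * 2 ^ i..<(b + 1) * 2 ^ i}))"
      by linarith
    also have "real (card (\<Union>b\<in>B. \<Union>i\<in>{..<Suc (J - j)}. {b * 2 ^ i..<(b + 1) * 2 ^ i})) \<le> real (card B) * 2 ^ Suc (J - j)"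
    proof (rule real_card_UN_le[OF finB])
      fix b :: nat
      have "card (\<Union>i\<in>{..<Suc (J - j)}. {b * 2 ^ i..<(b + 1) * 2 ^ i})
          \<le> (\<Sum>i<Suc (J - j). card {b * 2 ^ i..<(b + 1) * 2 ^ i})"
        by (rule card_UN_le) simp
      also have "\<dots> = (\<Sum>i<Suc (J - j). 2 ^ i)" by simp
      also have "\<dots> \<le> 2 ^ Suc (J - j)"
        using sum_power2[of "Suc (J - j)"] by (simp only: atLeast0LessThan)
      finally have "real (card (\<Union>i\<in>{..<Suc (J - j)}. {b * 2 ^ i..<(b + 1) * 2 ^ i})) \<le> real (2 ^ Suc (J - j))"
        by (simp only: of_nat_le_iff)
      then show "real (card (\<Union>i\<in>{..<Suc (J - j)}. {b * 2 ^ i..<(b + 1) * 2 ^ i})) \<le> 2 ^ Suc (J - j)"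
        by simp
    qed
    also have "real (card {1..<(2::nat) ^ j}) \<le> 2 ^ j" by (simp add: of_nat_diff)
    finally show "real (card ({1..k} - T)) \<le> 2 ^ j + real (card B) * 2 ^ Suc (J - j)" by simp
    have symR: "sym ?R" by (intro sym_rtrancl sym_Restr sym_heap_edges)
    show "\<forall>p\<in>T. \<forall>q\<in>T. (p, q) \<in> ?R"
      by (intro ballI) (rule rtrancl_trans[OF symD[OF symR reach] reach])
  qed
qed

text \<open>Pigeonhole: the rows are disjoint, so fewer points than rows miss one of them.\<close>

lemma free_row:
  assumes "finite B" "card B < b - a"
  obtains j where "a \<le> j" "j < b" "\<And>v::nat. 2 ^ j \<le> v \<Longrightarrow> v < 2 ^ Suc j \<Longrightarrow> v \<notin> B"
proof -
  have "\<exists>j\<in>{a..<b}. \<forall>v. 2 ^ j \<le> v \<and> v < 2 ^ Suc j \<longrightarrow> v \<notin> B"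
  proof (rule ccontr)
    assume "\<not> ?thesis"
    then have "\<forall>j\<in>{a..<b}. \<exists>v. 2 ^ j \<le> v \<and> v < 2 ^ Suc j \<and> v \<in> B" by blast
    then obtain r where r: "\<And>j. j \<in> {a..<b} \<Longrightarrow> 2 ^ j \<le> r j \<and> r j < 2 ^ Suc j \<and> r j \<in> B" by metis
    have "inj_on r {a..<b}"
    proof (rule inj_onI)
      fix i j assume ij: "i \<in> {a..<b}" "j \<in> {a..<b}" "r i = r j"
      have "(2::nat) ^ i < 2 ^ Suc j" using r[OF ij(1)] r[OF ij(2)] ij(3) by linarith
      moreover have "(2::nat) ^ j < 2 ^ Suc i" using r[OF ij(1)] r[OF ij(2)] ij(3) by linarith
      ultimately have "i < Suc j" "j < Suc i"
        using power_less_imp_less_exp[of "2::nat" i "Suc j"] power_less_imp_less_exp[of "2::nat" j "Suc i"] by simp_all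
      then show "i = j" by simp
    qed
    then have "card {a..<b} \<le> card B" using r assms(1) by (intro card_inj_on_le[of r]) auto
    then show False using assms(2) by simp
  qed
  then show ?thesis using that by auto
qed

text \<open>The free row is sought between levels \<open>h = J div 2\<close> and
  \<open>J - p\<close>. Staying before \<open>J - p\<close> limits the loss above the row to
  \<open>\<delta> / 2\<close> of all vertices; starting at \<open>h\<close> makes the lost subtrees
  so small that even \<open>h\<close> of them are negligible. The window has about
  \<open>J / 2\<close> rows, while \<open>B\<close> has at most about \<open>J / 8\<close>
  points.\<close>

lemma heap_expansion_rate:
  assumes \<delta>: "0 < \<delta>"
  shows "\<exists>\<epsilon>>0. \<forall>\<^sub>F k in sequentially. \<forall>B\<subseteq>{1..k}. real (card B) \<le> \<epsilon> * ln (real k) \<longrightarrow>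
     (\<exists>T\<subseteq>{1..k} - B. real (card ({1..k} - T)) \<le> \<delta> * real (card {1..k}) \<and>
       (\<forall>p\<in>T. \<forall>q\<in>T. (p, q) \<in> (heap_edges \<inter> ({1..k} - B) \<times> ({1..k} - B))\<^sup>*))"
proof (intro exI conjI)
  obtain p :: nat where p: "2 / \<delta> < 2 ^ p" using real_arch_pow[of 2 "2 / \<delta>"] by auto
  have "(\<lambda>h. real h * (1 / 2) ^ h) \<longlonglongrightarrow> 0" using powser_times_n_limit_0[of "1 / 2 :: real"] by simp
  then have "\<forall>\<^sub>F h in sequentially. real h * (1 / 2) ^ h < \<delta> / 4"
    using \<delta> by (intro order_tendstoD(2)[of _ 0]) auto
  then have "\<forall>\<^sub>F h in sequentially. 4 * p + 4 \<le> h \<and> real h * (1 / 2) ^ h < \<delta> / 4"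
    using eventually_ge_at_top[of "4 * p + 4"] by eventually_elim auto
  then obtain h0 where h0: "\<And>h. h0 \<le> h \<Longrightarrow> 4 * p + 4 \<le> h \<and> real h * (1 / 2) ^ h < \<delta> / 4"
    by (auto simp: eventually_sequentially)
  show "\<forall>\<^sub>F k in sequentially. \<forall>B\<subseteq>{1..k}. real (card B) \<le> 1 / 8 * ln (real k) \<longrightarrow>
     (\<exists>T\<subseteq>{1..k} - B. real (card ({1..k} - T)) \<le> \<delta> * real (card {1..k}) \<and>
       (\<forall>p\<in>T. \<forall>q\<in>T. (p, q) \<in> (heap_edges \<inter> ({1..k} - B) \<times> ({1..k} - B))\<^sup>*))"
    using eventually_ge_at_top[of "2 ^ (2 * h0)"]
  proof eventually_elim
    case (elim k)
    show ?case
    proof (intro allI impI)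
      fix B assume B: "B \<subseteq> {1..k}" "real (card B) \<le> 1 / 8 * ln (real k)"
      have k0: "0 < k" using elim by (meson less_le_trans pos2 zero_less_power)
      obtain J where J: "2 ^ J \<le> k" "k < 2 ^ Suc J" using dyadic_bracket[of 2 k] k0 by auto
      have "(2::nat) ^ (2 * h0) < 2 ^ Suc J" using J(2) elim by linarith
      then have "2 * h0 < Suc J" by (rule power_less_imp_less_exp[rotated]) simp
      define h where "h = J div 2"
      have hJ: "2 * h \<le> J" "J \<le> 2 * h + 1" "h0 \<le> h" using \<open>2 * h0 < Suc J\<close> by (auto simp: h_def)
      note hh = h0[OF hJ(3)]
      have finB: "finite B" using B(1) finite_subset by blast
      have "real k \<le> 2 ^ Suc J" using J(2) by (metis less_imp_le of_nat_le_iff of_nat_numeral of_nat_power)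
      then have "ln (real k) \<le> ln (2 ^ Suc J)" using k0 by (subst ln_le_cancel_iff) auto
      also have "\<dots> = real (Suc J) * ln 2" by (rule ln_realpow)
      also have "\<dots> \<le> real (Suc J) * 1" using ln_le_minus_one[of "2::real"] by (intro mult_left_mono) auto
      finally have "ln (real k) \<le> real (Suc J)" by simp
      moreover have "8 * real (card B) \<le> ln (real k)" using B(2) by (simp add: field_simps)
      ultimately have "real (8 * card B) \<le> real (Suc J)" by simp
      then have "8 * card B \<le> Suc J" by (simp only: of_nat_le_iff)
      then have cB: "4 * card B \<le> Suc h" using hJ by linarith
      have "card B < (J - p) - h" using cB hJ hh by linarith
      then obtain j where j: "h \<le> j" "j < J - p" "\<And>v. 2 ^ j \<le> v \<Longrightarrow> v < 2 ^ Suc j \<Longrightarrow> v \<notin> B"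
        using free_row[OF finB, of "J - p" h] by blast
      have "j < J" using j(2) by simp
      obtain T where T: "T \<subseteq> {1..k} - B"
        "real (card ({1..k} - T)) \<le> 2 ^ j + real (card B) * 2 ^ Suc (J - j)"
        "\<forall>p\<in>T. \<forall>q\<in>T. (p, q) \<in> (heap_edges \<inter> ({1..k} - B) \<times> ({1..k} - B))\<^sup>*"
        by (rule tree_row_expansion[OF J(2,1) \<open>j < J\<close> B(1) j(3)], assumption, assumption, rule that, assumption+)
      have kJ: "(2::real) ^ J \<le> real k" using J(1) by (metis of_nat_le_iff of_nat_numeral of_nat_power)
      have "(2::real) ^ j * 2 ^ p \<le> 2 ^ J"
        using j(2) power_increasing[of "j + p" J "2::real"] by (simp add: power_add)
      moreover have "2 ^ j * (2 / \<delta>) \<le> (2::real) ^ j * 2 ^ p" using p by (intro mult_left_mono) auto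
      ultimately have "2 ^ j * (2 / \<delta>) \<le> real k" using kJ by linarith
      then have t1: "2 ^ j \<le> \<delta> / 2 * real k" using \<delta> by (simp add: field_simps)
      have "real (card B) * 2 ^ Suc (J - j) \<le> real h * 2 ^ Suc (J - h)"
        using cB hh j(1) by (intro mult_mono power_increasing) auto
      also have "(2::real) ^ Suc (J - h) = 2 * 2 ^ J * (1 / 2) ^ h"
        using hJ by (simp add: power_diff power_one_over field_simps)
      finally have "real (card B) * 2 ^ Suc (J - j) \<le> 2 * 2 ^ J * (real h * (1 / 2) ^ h)" by (simp add: mult_ac)
      also have "\<dots> \<le> 2 * real k * (\<delta> / 4)" using kJ hh by (intro mult_mono) auto
      finally have t2: "real (card B) * 2 ^ Suc (J - j) \<le> \<delta> / 2 * real k" by simp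
      have "real (card ({1..k} - T)) \<le> \<delta> * real (card {1..k})" using T(2) t1 t2 by simp
      then show "\<exists>T\<subseteq>{1..k} - B. real (card ({1..k} - T)) \<le> \<delta> * real (card {1..k}) \<and>
       (\<forall>p\<in>T. \<forall>q\<in>T. (p, q) \<in> (heap_edges \<inter> ({1..k} - B) \<times> ({1..k} - B))\<^sup>*)"
        using T(1,3) by (intro exI[of _ T] conjI)
    qed
  qed
qed simp

text \<open>Adding single vertices instead of whole rows keeps the growth factor close to 1.\<close>

lemma heap_growth:
  assumes "0 < \<delta>"
  shows "\<forall>\<^sub>F k in sequentially. real (card {1..Suc k}) - real (card {1..k}) \<le> \<delta> * real (card {1..k})"
proof -
  obtain N :: nat where N: "1 / \<delta> < real N" using reals_Archimedean2 by blast
  show ?thesis using eventually_ge_at_top[of N]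
  proof eventually_elim
    case (elim k)
    then have "1 / \<delta> \<le> real k" using N by linarith
    then show ?case using assms by (simp add: field_simps)
  qed
qed

lemma heap_profile:
  assumes "1 \<le> A"
  shows "\<exists>C>0. \<forall>\<^sub>F k in sequentially. \<forall>n\<ge>2. real n \<le> A * real (card {1..k}) \<longrightarrow> ln (real n) \<le> C * ln (real k)"
proof (intro exI conjI)
  have A: "0 \<le> ln A" using assms by simp
  show "0 < 1 + ln A / ln 2" using A by (simp add: add_pos_nonneg)
  show "\<forall>\<^sub>F k in sequentially. \<forall>n\<ge>2. real n \<le> A * real (card {1..k}) \<longrightarrow> ln (real n) \<le> (1 + ln A / ln 2) * ln (real k)"
    using eventually_ge_at_top[of 2]
  proof eventually_elim
    case (elim k)
    show ?case
    proof (intro allI impI)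
      fix n :: nat assume n: "2 \<le> n" "real n \<le> A * real (card {1..k})"
      have "ln (real n) \<le> ln (A * real k)" using n assms elim by (subst ln_le_cancel_iff) auto
      also have "\<dots> = ln A + ln (real k)" using assms elim by (subst ln_mult) auto
      also have "ln A \<le> ln A / ln 2 * ln (real k)"
      proof -
        have "ln 2 \<le> ln (real k)" using elim by (subst ln_le_cancel_iff) auto
        then have "ln A / ln 2 * ln 2 \<le> ln A / ln 2 * ln (real k)" using A by (intro mult_left_mono) auto
        then show ?thesis by simp
      qed
      finally show "ln (real n) \<le> (1 + ln A / ln 2) * ln (real k)" by (simp add: algebra_simps)
    qed
  qed
qed

section \<open>Discretizations of hyperbolic space\<close>

text \<open>Defined by walks and not by \<open>graph_dist\<close>, whose value is unspecified for
  vertices that no path joins.\<close>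

definition graph_ball :: "('v \<times> 'v) set \<Rightarrow> nat \<Rightarrow> 'v \<Rightarrow> 'v set" where
  "graph_ball E r u = {v. \<exists>k\<le>r. (u, v) \<in> E ^^ k}"

lemma graph_ball_self: "u \<in> graph_ball E r u"
  by (auto simp: graph_ball_def intro!: exI[of _ 0])

lemma sym_relpow: "sym E \<Longrightarrow> sym (E ^^ k)"
proof (induction k)
  case (Suc k)
  show ?case
  proof (rule symI)
    fix x y assume "(x, y) \<in> E ^^ Suc k"
    then obtain z where "(x, z) \<in> E ^^ k" "(z, y) \<in> E" by auto
    then have "(z, x) \<in> E ^^ k" "(y, z) \<in> E" using Suc by (auto dest: symD)
    then show "(y, x) \<in> E ^^ Suc k" by (meson relpow_Suc_I2)
  qed
qed (auto simp: sym_def)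

lemma graph_ball_commute: "sym E \<Longrightarrow> v \<in> graph_ball E r u \<longleftrightarrow> u \<in> graph_ball E r v"
  unfolding graph_ball_def by (blast dest: symD[OF sym_relpow])

lemma graph_ball_subset:
  assumes "E \<subseteq> V \<times> V" "u \<in> V"
  shows "graph_ball E r u \<subseteq> V"
proof -
  have "(u, v) \<in> E ^^ k \<Longrightarrow> v \<in> V" for v k
    using assms by (cases k) auto
  then show ?thesis by (auto simp: graph_ball_def)
qed

text \<open>Each initial part of a walk of length at most \<open>r\<close> from \<open>u\<close>
  ends inside the ball.\<close>

lemma graph_ball_path:
  assumes "k \<le> r" "(u, v) \<in> E ^^ k"
  shows "(u, v) \<in> (E \<inter> graph_ball E r u \<times> graph_ball E r u)\<^sup>*"
  using assms
proof (induction k arbitrary: v)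
  case (Suc k)
  then obtain w where w: "(u, w) \<in> E ^^ k" "(w, v) \<in> E" by auto
  have "w \<in> graph_ball E r u" unfolding graph_ball_def using w(1) Suc(2) by (auto intro!: exI[of _ k])
  moreover have "v \<in> graph_ball E r u" unfolding graph_ball_def using Suc(2,3) by blast
  ultimately have "(w, v) \<in> E \<inter> graph_ball E r u \<times> graph_ball E r u" using w(2) by blast
  then show ?case using Suc.IH[OF _ w(1)] Suc(2) by (meson Suc_leD rtrancl.rtrancl_into_rtrancl)
qed simp

lemma conn_graph_ball:
  assumes "sym E"
  shows "conn E (graph_ball E r u)"
proof -
  let ?R = "(E \<inter> graph_ball E r u \<times> graph_ball E r u)\<^sup>*"
  have symR: "sym ?R" by (intro sym_rtrancl sym_Restr assms)
  have path: "(u, v) \<in> ?R" if "v \<in> graph_ball E r u" for v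
    using that graph_ball_path[of _ r u v E] by (auto simp: graph_ball_def)
  show ?thesis
    unfolding conn_def by (intro ballI) (rule rtrancl_trans[OF symD[OF symR path] path])
qed

lemma graph_ball_card:
  assumes "bounded_degree V E" "E \<subseteq> V \<times> V"
  obtains L where "\<And>u. u \<in> V \<Longrightarrow> finite (graph_ball E r u) \<and> real (card (graph_ball E r u)) \<le> L"
proof -
  obtain D where D: "\<And>v. v \<in> V \<Longrightarrow> finite (E `` {v}) \<and> card (E `` {v}) \<le> D"
    using assms(1) by (auto simp: bounded_degree_def)
  have sphere: "finite {v. (u, v) \<in> E ^^ k} \<and> real (card {v. (u, v) \<in> E ^^ k}) \<le> real D ^ k" if u: "u \<in> V" for u k
  proof (induction k)
    case (Suc k)
    let ?A = "{v. (u, v) \<in> E ^^ k}"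
    have "?A \<subseteq> V" using u assms(2) by (cases k) auto
    then have D': "\<And>w. w \<in> ?A \<Longrightarrow> finite (E `` {w}) \<and> card (E `` {w}) \<le> D" using D by blast
    have e: "{v. (u, v) \<in> E ^^ Suc k} = (\<Union>w\<in>?A. E `` {w})" by auto
    have "real (card (\<Union>w\<in>?A. E `` {w})) \<le> real (card ?A) * real D"
      using Suc D' by (intro real_card_UN_le) auto
    also have "\<dots> \<le> real D ^ k * real D" using Suc by (intro mult_right_mono) auto
    finally have "real (card (\<Union>w\<in>?A. E `` {w})) \<le> real D ^ Suc k" by (simp add: mult.commute)
    moreover have "finite (\<Union>w\<in>?A. E `` {w})" using Suc D' by blast
    ultimately show ?case unfolding e by blast
  qed simp
  have "finite (graph_ball E r u) \<and> real (card (graph_ball E r u)) \<le> real (Suc r) * (\<Sum>k\<le>r. real D ^ k)" if "u \<in> V" for u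
  proof -
    have e: "graph_ball E r u = (\<Union>k\<in>{..r}. {v. (u, v) \<in> E ^^ k})" by (auto simp: graph_ball_def)
    have "real (card (\<Union>k\<in>{..r}. {v. (u, v) \<in> E ^^ k})) \<le> real (card {..r}) * (\<Sum>k\<le>r. real D ^ k)"
    proof (rule real_card_UN_le)
      fix k assume "k \<in> {..r}"
      then have "real D ^ k \<le> (\<Sum>k\<le>r. real D ^ k)" by (intro member_le_sum) auto
      then show "real (card {v. (u, v) \<in> E ^^ k}) \<le> (\<Sum>k\<le>r. real D ^ k)"
        using sphere[OF that, of k] by linarith
    qed simp
    moreover have "finite (\<Union>k\<in>{..r}. {v. (u, v) \<in> E ^^ k})" using sphere[OF that] by blast
    ultimately show ?thesis unfolding e by simp
  qed
  then show ?thesis using that by blast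
qed

lemma cosh_hyp_dist:
  assumes "x \<in> hyp_space d" "y \<in> hyp_space d"
  shows "cosh (hyp_dist d x y) = 1 + (\<Sum>i<d. (x i - y i)\<^sup>2) / (2 * x 0 * y 0)" "0 \<le> hyp_dist d x y"
proof -
  have "0 \<le> (\<Sum>i<d. (x i - y i)\<^sup>2) / (2 * x 0 * y 0)"
    using assms by (intro divide_nonneg_nonneg sum_nonneg) (auto simp: hyp_space_def)
  then show "cosh (hyp_dist d x y) = 1 + (\<Sum>i<d. (x i - y i)\<^sup>2) / (2 * x 0 * y 0)" "0 \<le> hyp_dist d x y"
    by (simp_all add: hyp_dist_def)
qed

lemma hyp_dist_imp_near:
  assumes "x \<in> hyp_space d" "y \<in> hyp_space d" "hyp_dist d x y \<le> c"
  shows "near d (2 * cosh c) x y"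
proof -
  have xy: "0 < x 0" "0 < y 0" using assms by (auto simp: hyp_space_def)
  have "cosh (hyp_dist d x y) \<le> cosh c"
    using cosh_hyp_dist(2)[OF assms(1,2)] assms(3) by (subst cosh_real_nonneg_le_iff) auto
  then have "(\<Sum>i<d. (x i - y i)\<^sup>2) / (2 * x 0 * y 0) \<le> cosh c"
    by (simp add: cosh_hyp_dist(1)[OF assms(1,2)])
  then show ?thesis using xy by (simp add: near_def field_simps)
qed

lemma near_imp_hyp_dist:
  assumes "x \<in> hyp_space d" "y \<in> hyp_space d" "near d K x y" "0 \<le> K"
  shows "hyp_dist d x y \<le> arcosh (1 + K / 2)"
proof -
  have xy: "0 < x 0" "0 < y 0" using assms by (auto simp: hyp_space_def)
  have "(\<Sum>i<d. (x i - y i)\<^sup>2) / (2 * x 0 * y 0) \<le> K / 2"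
    using assms(3) xy by (simp add: near_def field_simps)
  then have "cosh (hyp_dist d x y) \<le> cosh (arcosh (1 + K / 2))"
    using assms(4) by (simp add: cosh_hyp_dist(1)[OF assms(1,2)])
  then show ?thesis
    using cosh_hyp_dist(2)[OF assms(1,2)] assms(4) by (subst (asm) cosh_real_nonneg_le_iff) auto
qed

text \<open>This restates the rough isometry in terms of \<open>near\<close>. The last property is
  properness; the walk it promises exists because the graph is connected.\<close>

lemma discretization_map:
  assumes "discretization V E (hyp_space d) (hyp_dist d)"
  obtains f K where "0 \<le> K" "\<And>v. v \<in> V \<Longrightarrow> f v \<in> hyp_space d"
    "\<And>u v. (u, v) \<in> E \<Longrightarrow> near d K (f u) (f v)"
    "\<And>y. y \<in> hyp_space d \<Longrightarrow> \<exists>v\<in>V. near d K y (f v)"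
    "\<And>K'. 0 \<le> K' \<Longrightarrow> \<exists>r. \<forall>u\<in>V. \<forall>v\<in>V. near d K' (f u) (f v) \<longrightarrow> v \<in> graph_ball E r u"
proof -
  have EV: "E \<subseteq> V \<times> V" and con: "connected_graph V E"
    using assms by (auto simp: discretization_def simple_graph_def)
  obtain \<kappa> f where "rough_isometry \<kappa> V (graph_dist E) (hyp_space d) (hyp_dist d) f"
    using assms by (auto simp: discretization_def roughly_isometric_def)
  then have \<kappa>: "0 < \<kappa>" and fV: "\<And>v. v \<in> V \<Longrightarrow> f v \<in> hyp_space d"
    and low: "\<And>u v. u \<in> V \<Longrightarrow> v \<in> V \<Longrightarrow> inverse \<kappa> * graph_dist E u v - \<kappa> \<le> hyp_dist d (f u) (f v)"
    and up: "\<And>u v. u \<in> V \<Longrightarrow> v \<in> V \<Longrightarrow> hyp_dist d (f u) (f v) \<le> \<kappa> * graph_dist E u v + \<kappa>"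
    and net: "\<And>y. y \<in> hyp_space d \<Longrightarrow> \<exists>v\<in>V. hyp_dist d y (f v) \<le> \<kappa>"
    unfolding rough_isometry_def by blast+
  show ?thesis
  \<comment> \<open>One constant for two purposes: images of adjacent vertices have distance at most
    \<open>\<kappa> * 1 + \<kappa>\<close>, and every point has an image within
    \<open>\<kappa>\<close>.\<close>
  proof (rule that[of "2 * cosh (2 * \<kappa>)" f])
    fix u v assume uv: "(u, v) \<in> E"
    then have V: "u \<in> V" "v \<in> V" using EV by auto
    have "(LEAST k. (u, v) \<in> E ^^ k) \<le> 1" using uv by (intro Least_le) simp
    then have "\<kappa> * graph_dist E u v \<le> \<kappa> * 1" using \<kappa> unfolding graph_dist_def by (intro mult_left_mono) auto
    then have "hyp_dist d (f u) (f v) \<le> 2 * \<kappa>" using up[OF V] by linarith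
    then show "near d (2 * cosh (2 * \<kappa>)) (f u) (f v)" by (intro hyp_dist_imp_near fV V)
  next
    fix y assume y: "y \<in> hyp_space d"
    then obtain v where v: "v \<in> V" "hyp_dist d y (f v) \<le> \<kappa>" using net by blast
    then have "hyp_dist d y (f v) \<le> 2 * \<kappa>" using \<kappa> by linarith
    then show "\<exists>v\<in>V. near d (2 * cosh (2 * \<kappa>)) y (f v)"
      using hyp_dist_imp_near[OF y fV[OF v(1)]] v(1) by blast
  next
    fix K' :: real assume K': "0 \<le> K'"
    define r where "r = nat \<lceil>\<kappa> * (arcosh (1 + K' / 2) + \<kappa>)\<rceil>"
    have "v \<in> graph_ball E r u" if uv: "u \<in> V" "v \<in> V" and nr: "near d K' (f u) (f v)" for u v
    proof -
      have "hyp_dist d (f u) (f v) \<le> arcosh (1 + K' / 2)" by (intro near_imp_hyp_dist fV uv nr K')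
      then have "inverse \<kappa> * graph_dist E u v \<le> arcosh (1 + K' / 2) + \<kappa>" using low[OF uv] by linarith
      then have "graph_dist E u v \<le> \<kappa> * (arcosh (1 + K' / 2) + \<kappa>)" using \<kappa> by (simp add: field_simps)
      then have "(LEAST k. (u, v) \<in> E ^^ k) \<le> r" unfolding r_def graph_dist_def by linarith
      moreover have "\<exists>k. (u, v) \<in> E ^^ k"
        using con uv by (auto simp: connected_graph_def rtrancl_power)
      then have "(u, v) \<in> E ^^ (LEAST k. (u, v) \<in> E ^^ k)" by (rule LeastI_ex)
      ultimately show ?thesis by (auto simp: graph_ball_def)
    qed
    then show "\<exists>r. \<forall>u\<in>V. \<forall>v\<in>V. near d K' (f u) (f v) \<longrightarrow> v \<in> graph_ball E r u" by blast
  qed (use fV in auto)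
qed

text \<open>A pairwise near set lies in one graph ball about any of its members, and bounded degree
  limits the size of that ball.\<close>

lemma discretization_sparse:
  assumes "bounded_degree V E" "E \<subseteq> V \<times> V"
    and "\<exists>r. \<forall>u\<in>V. \<forall>v\<in>V. near d (real d) (f u) (f v) \<longrightarrow> v \<in> graph_ball E r u"
  obtains B where "sparse d B f V"
proof -
  obtain r where r: "\<And>u v. u \<in> V \<Longrightarrow> v \<in> V \<Longrightarrow> near d (real d) (f u) (f v) \<Longrightarrow> v \<in> graph_ball E r u"
    using assms(3) by blast
  obtain L where L: "\<And>u. u \<in> V \<Longrightarrow> finite (graph_ball E r u) \<and> real (card (graph_ball E r u)) \<le> L"
    by (rule graph_ball_card[OF assms(1,2), of r]) blast
  have "sparse d (max L 0) f V"
    unfolding sparse_def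
  proof (intro allI impI)
    fix A assume A: "A \<subseteq> V" "\<forall>u\<in>A. \<forall>v\<in>A. near d (real d) (f u) (f v)"
    show "real (card A) \<le> max L 0"
    proof (cases "A = {}")
      case False
      then obtain u where u: "u \<in> A" by blast
      then have "A \<subseteq> graph_ball E r u" using A r by blast
      then have "card A \<le> card (graph_ball E r u)" using L[of u] u A(1) by (intro card_mono) auto
      then show ?thesis using L[of u] u A(1) by fastforce
    qed simp
  qed
  then show ?thesis using that by blast
qed

text \<open>A vertex \<open>\<phi> q\<close> with image near \<open>y q\<close> represents
  \<open>q\<close>, and the ball of radius \<open>r\<close> about it is the cell. \<open>r\<close>
  is so large that the cell of \<open>p\<close> contains \<open>\<phi> q\<close> whenever
  \<open>p\<close> and \<open>q\<close> are adjacent.\<close>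

lemma hyp_lower:
  fixes V :: "'v set" and y :: "'q \<Rightarrow> nat \<Rightarrow> real" and Q :: "nat \<Rightarrow> 'q set" and h g :: "nat \<Rightarrow> real"
  assumes disc: "discretization V E (hyp_space d) (hyp_dist d)" and d: "0 < d" and Ke: "0 \<le> Ke"
    and yQ: "\<And>k q. q \<in> Q k \<Longrightarrow> y q \<in> hyp_space d"
    and y\<Gamma>: "\<And>k p q. p \<in> Q k \<Longrightarrow> q \<in> Q k \<Longrightarrow> (p, q) \<in> \<Gamma> \<Longrightarrow> near d Ke (y p) (y q)"
    and mult: "\<And>K. 0 \<le> K \<Longrightarrow> \<exists>M. \<forall>k. \<forall>c\<in>hyp_space d. real (card {q \<in> Q k. near d K (y q) c}) \<le> M"
    and finQ: "\<And>k. finite (Q k)" and monoQ: "\<And>k. Q k \<subseteq> Q (Suc k)"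
    and growth: "\<And>\<delta>. 0 < \<delta> \<Longrightarrow> \<forall>\<^sub>F k in sequentially. real (card (Q (Suc k))) - real (card (Q k)) \<le> \<delta> * real (card (Q k))"
    and unbounded: "filterlim (\<lambda>k. real (card (Q k))) at_top sequentially"
    and expansion: "\<And>\<delta>. 0 < \<delta> \<Longrightarrow> \<exists>\<epsilon>>0. \<forall>\<^sub>F k in sequentially. \<forall>B\<subseteq>Q k. real (card B) \<le> \<epsilon> * h k \<longrightarrow>
       (\<exists>T\<subseteq>Q k - B. real (card (Q k - T)) \<le> \<delta> * real (card (Q k)) \<and>
         (\<forall>p\<in>T. \<forall>q\<in>T. (p, q) \<in> (\<Gamma> \<inter> (Q k - B) \<times> (Q k - B))\<^sup>*))"
    and profile: "\<And>A. 1 \<le> A \<Longrightarrow> \<exists>C>0. \<forall>\<^sub>F k in sequentially. \<forall>n\<ge>2. real n \<le> A * real (card (Q k)) \<longrightarrow> g n \<le> C * h k"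
  obtains c where "0 < c" "\<And>n. 2 \<le> n \<Longrightarrow> c * g n \<le> real (sep V E n)"
proof -
  have EV: "E \<subseteq> V \<times> V" and symE: "sym E" and con: "connected_graph V E" and deg: "bounded_degree V E"
    using disc by (auto simp: discretization_def simple_graph_def)
  obtain f K where K: "0 \<le> K" and fV: "\<And>v. v \<in> V \<Longrightarrow> f v \<in> hyp_space d"
    and net: "\<And>y. y \<in> hyp_space d \<Longrightarrow> \<exists>v\<in>V. near d K y (f v)"
    and proper: "\<And>K'. 0 \<le> K' \<Longrightarrow> \<exists>r. \<forall>u\<in>V. \<forall>v\<in>V. near d K' (f u) (f v) \<longrightarrow> v \<in> graph_ball E r u"
    by (rule discretization_map[OF disc], rule that, assumption+)
  define \<phi> where "\<phi> q = (SOME v. v \<in> V \<and> near d K (y q) (f v))" for q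
  have \<phi>: "\<phi> q \<in> V" "near d K (y q) (f (\<phi> q))" if "q \<in> Q k" for q k
    using someI_ex[of "\<lambda>v. v \<in> V \<and> near d K (y q) (f v)"] net[OF yQ[OF that]] by (auto simp: \<phi>_def)
  have pos: "0 < x 0" if "x \<in> hyp_space d" for x using that by (simp add: hyp_space_def)
  \<comment> \<open>Constants for the chain \<open>f (\<phi> p)\<close>, \<open>y p\<close>,
    \<open>y q\<close>, \<open>f (\<phi> q)\<close>, by two uses of
    \<open>near_trans\<close>.\<close>
  define K2 where "K2 = 2 * K * (Ke + 2) + 2 * Ke * (K + 2)"
  define K3 where "K3 = 2 * K2 * (K + 2) + 2 * K * (K2 + 2)"
  have K23: "0 \<le> K2" "0 \<le> K3" using K Ke by (simp_all add: K2_def K3_def)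
  obtain r where r: "\<And>u v. u \<in> V \<Longrightarrow> v \<in> V \<Longrightarrow> near d K3 (f u) (f v) \<Longrightarrow> v \<in> graph_ball E r u"
    using proper[OF K23(2)] by blast
  obtain L where L: "\<And>u. u \<in> V \<Longrightarrow> finite (graph_ball E r u) \<and> real (card (graph_ball E r u)) \<le> L"
    by (rule graph_ball_card[OF deg EV, of r]) blast
  obtain M where M: "\<And>k c. c \<in> hyp_space d \<Longrightarrow> real (card {q \<in> Q k. near d K (y q) c}) \<le> M"
    using mult[OF K] by blast
  have M0: "real (card {q \<in> Q k. \<phi> q = w}) \<le> M" if "w \<in> V" for w k
  proof -
    have "card {q \<in> Q k. \<phi> q = w} \<le> card {q \<in> Q k. near d K (y q) (f w)}"
      using \<phi>(2) finQ by (intro card_mono) auto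
    then show ?thesis using M[OF fV[OF that], of k] by linarith
  qed
  \<comment> \<open>Boundedly many model points share a vertex, so a finite \<open>V\<close> would
    bound the models. Infinity provides connected sets of all sizes.\<close>
  have inf: "infinite V"
  proof
    assume fin: "finite V"
    have "real (card (Q k)) \<le> real (card V) * M" for k
    proof -
      have "Q k = (\<Union>w\<in>V. {q \<in> Q k. \<phi> q = w})" using \<phi>(1) by blast
      then show ?thesis using real_card_UN_le[OF fin, of "\<lambda>w. {q \<in> Q k. \<phi> q = w}" M] M0 by simp
    qed
    moreover have "\<forall>\<^sub>F k in sequentially. real (card V) * M < real (card (Q k))"
      using unbounded by (simp add: filterlim_at_top_dense)
    ultimately show False by (meson eventually_happens' not_less sequentially_bot)
  qed
  let ?K = "\<lambda>q. graph_ball E r (\<phi> q)"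
  show ?thesis
  proof (rule sep_lower_expander[where K = ?K and V = V and E = E and \<Gamma> = \<Gamma> and Q = Q and f = h and g = g
        and L = "max L 1" and M = "max (max L 0 * max M 0) 1"])
    show "?K q \<subseteq> V \<and> finite (?K q) \<and> ?K q \<noteq> {} \<and> real (card (?K q)) \<le> max L 1 \<and> conn E (?K q)"
      if "q \<in> Q k" for k q
      using graph_ball_subset[OF EV \<phi>(1)[OF that]] L[OF \<phi>(1)[OF that]] graph_ball_self[of "\<phi> q" E r]
        conn_graph_ball[OF symE] by auto
    show "\<exists>u\<in>?K p. \<exists>w\<in>?K q. u = w \<or> (u, w) \<in> E" if pq: "p \<in> Q k" "q \<in> Q k" "(p, q) \<in> \<Gamma>" for k p q
    proof -
      note P = pos[OF yQ[OF pq(1)]] pos[OF yQ[OF pq(2)]] pos[OF fV[OF \<phi>(1)[OF pq(1)]]] pos[OF fV[OF \<phi>(1)[OF pq(2)]]]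
      have 1: "near d K (f (\<phi> p)) (y p)" using \<phi>(2)[OF pq(1)] near_sym by blast
      have 2: "near d K2 (f (\<phi> p)) (y q)"
        unfolding K2_def by (rule near_trans[OF 1 y\<Gamma>[OF pq] d P(3,1,2)])
      have "near d K3 (f (\<phi> p)) (f (\<phi> q))"
        unfolding K3_def by (rule near_trans[OF 2 \<phi>(2)[OF pq(2)] d P(3,2,4)])
      then have "\<phi> q \<in> ?K p" by (rule r[OF \<phi>(1)[OF pq(1)] \<phi>(1)[OF pq(2)]])
      then show ?thesis using graph_ball_self[of "\<phi> q" E r] by (intro bexI[of _ "\<phi> q"]) simp_all
    qed
    \<comment> \<open>\<open>v\<close> is in the cell of \<open>q\<close> exactly if
      \<open>\<phi> q\<close> is in the ball about \<open>v\<close>: at most \<open>L\<close>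
      vertices, each representing at most \<open>M\<close> model points.\<close>
    show "real (card {q \<in> Q k. v \<in> ?K q}) \<le> max (max L 0 * max M 0) 1" if v: "v \<in> V" for k v
    proof -
      have fin: "finite (graph_ball E r v)" using L[OF v] by blast
      have "{q \<in> Q k. v \<in> ?K q} \<subseteq> (\<Union>w\<in>graph_ball E r v. {q \<in> Q k. \<phi> q = w})"
        using graph_ball_commute[OF symE] by blast
      then have "card {q \<in> Q k. v \<in> ?K q} \<le> card (\<Union>w\<in>graph_ball E r v. {q \<in> Q k. \<phi> q = w})"
        using fin finQ by (intro card_mono) auto
      moreover have "real (card (\<Union>w\<in>graph_ball E r v. {q \<in> Q k. \<phi> q = w})) \<le> real (card (graph_ball E r v)) * M"
        using graph_ball_subset[OF EV v] by (intro real_card_UN_le fin M0) blast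
      moreover have "real (card (graph_ball E r v)) * M \<le> max L 0 * max M 0"
      proof -
        have "real (card (graph_ball E r v)) * M \<le> real (card (graph_ball E r v)) * max M 0"
          by (intro mult_left_mono) auto
        also have "\<dots> \<le> max L 0 * max M 0"
          using L[OF v] by (intro mult_right_mono) auto
        finally show ?thesis .
      qed
      ultimately show ?thesis by linarith
    qed
    show "\<exists>S\<subseteq>V. finite S \<and> card S = n \<and> conn E S" if "0 < n" for n
      by (rule connected_subsets_exist[OF con symE EV inf that])
  qed (fact finQ monoQ growth unbounded expansion profile that | simp)+
qed

section \<open>Models inside hyperbolic space\<close>

text \<open>The lattice as a subset of the horosphere of height 1.\<close>

definition horo :: "(nat \<Rightarrow> int) \<Rightarrow> nat \<Rightarrow> real" where
  "horo x i = (if i = 0 then 1 else real_of_int (x (i - 1)))"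

lemma horo_hyp_space: "x \<in> lattice_verts D \<Longrightarrow> horo x \<in> hyp_space (Suc D)"
  by (auto simp: horo_def hyp_space_def lattice_verts_def)

lemma horo_edge:
  assumes "(x, y) \<in> lattice_edges D"
  shows "near (Suc D) 1 (horo x) (horo y)"
proof -
  have s: "(\<Sum>i<D. \<bar>x i - y i\<bar>) = 1" using assms by (simp add: lattice_edges_def)
  have "(\<Sum>i<Suc D. (horo x i - horo y i)\<^sup>2) = (\<Sum>i<D. (real_of_int (x i) - real_of_int (y i))\<^sup>2)"
    by (simp only: sum.lessThan_Suc_shift) (simp add: horo_def)
  also have "\<dots> = real_of_int (\<Sum>i<D. (x i - y i)\<^sup>2)" by simp
  also have "(\<Sum>i<D. (x i - y i)\<^sup>2) \<le> (\<Sum>i<D. \<bar>x i - y i\<bar>)"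
  proof (rule sum_mono)
    fix i assume i: "i \<in> {..<D}"
    have "\<bar>x i - y i\<bar> \<le> (\<Sum>i<D. \<bar>x i - y i\<bar>)" using i by (intro member_le_sum) auto
    then have "\<bar>x i - y i\<bar> * \<bar>x i - y i\<bar> \<le> \<bar>x i - y i\<bar> * 1" using s by (intro mult_left_mono) auto
    then show "(x i - y i)\<^sup>2 \<le> \<bar>x i - y i\<bar>" by (simp add: power2_eq_square flip: abs_mult)
  qed
  finally show ?thesis using s by (simp add: near_def horo_def)
qed

lemma card_int_interval_le:
  assumes "0 \<le> R"
  shows "real (card {\<lceil>c - R\<rceil>..\<lfloor>c + R\<rfloor>}) \<le> 2 * R + 1"
  using assms by simp linarith

text \<open>All these points have height 1, so \<open>near_coord_abs\<close> confines each
  coordinate to an interval of length \<open>2 * (K + 2)\<close>.\<close>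

lemma horo_count:
  assumes "0 \<le> K" "0 < c 0"
  shows "finite {x \<in> lattice_verts D. near (Suc D) K (horo x) c}"
    and "real (card {x \<in> lattice_verts D. near (Suc D) K (horo x) c}) \<le> (2 * (K + 2) + 1) ^ D"
proof -
  define R where "R i = {\<lceil>c (Suc i) - (K + 2)\<rceil>..\<lfloor>c (Suc i) + (K + 2)\<rfloor>}" for i
  have "{x \<in> lattice_verts D. near (Suc D) K (horo x) c} \<subseteq> {x \<in> lattice_verts D. \<forall>i<D. x i \<in> R i}"
  proof clarify
    fix x i assume x: "near (Suc D) K (horo x) c" and i: "i < D"
    have "\<bar>horo x (Suc i) - c (Suc i)\<bar> \<le> (K + 2) * horo x 0"
      by (rule near_coord_abs[OF x]) (use i assms in \<open>auto simp: horo_def\<close>)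
    then have "\<bar>real_of_int (x i) - c (Suc i)\<bar> \<le> K + 2" by (simp add: horo_def)
    then show "x i \<in> R i" by (auto simp: R_def ceiling_le_iff le_floor_iff)
  qed
  moreover have b: "finite {x \<in> lattice_verts D. \<forall>i<D. x i \<in> R i}"
      "card {x \<in> lattice_verts D. \<forall>i<D. x i \<in> R i} = (\<Prod>i<D. card (R i))"
    by (rule lattice_box, simp add: R_def)+
  ultimately show "finite {x \<in> lattice_verts D. near (Suc D) K (horo x) c}"
    and "real (card {x \<in> lattice_verts D. near (Suc D) K (horo x) c}) \<le> (2 * (K + 2) + 1) ^ D"
  proof -
    assume sub: "{x \<in> lattice_verts D. near (Suc D) K (horo x) c} \<subseteq> {x \<in> lattice_verts D. \<forall>i<D. x i \<in> R i}"
    then show "finite {x \<in> lattice_verts D. near (Suc D) K (horo x) c}" using b(1) by (rule finite_subset)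
    have "real (card {x \<in> lattice_verts D. near (Suc D) K (horo x) c}) \<le> (\<Prod>i<D. real (card (R i)))"
      using card_mono[OF b(1) sub] b(2) by (simp flip: of_nat_prod)
    also have "\<dots> \<le> (\<Prod>i<D. 2 * (K + 2) + 1)"
      unfolding R_def using assms(1) by (intro prod_mono conjI card_int_interval_le) auto
    finally show "real (card {x \<in> lattice_verts D. near (Suc D) K (horo x) c}) \<le> (2 * (K + 2) + 1) ^ D"
      by simp
  qed
qed

lemma horo_sparse:
  obtains B where "sparse (Suc D) B horo (lattice_verts D)"
proof -
  let ?B = "(2 * (real (Suc D) + 2) + 1) ^ D"
  have "sparse (Suc D) ?B horo (lattice_verts D)"
    unfolding sparse_def
  proof (intro allI impI)
    fix A assume A: "A \<subseteq> lattice_verts D" "\<forall>u\<in>A. \<forall>v\<in>A. near (Suc D) (real (Suc D)) (horo u) (horo v)"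
    show "real (card A) \<le> ?B"
    proof (cases "A = {}")
      case False
      then obtain u where u: "u \<in> A" by blast
      have K: "0 \<le> real (Suc D)" "0 < horo u 0" by (auto simp: horo_def)
      note cnt = horo_count[where c = "horo u" and D = D, OF K]
      have "A \<subseteq> {x \<in> lattice_verts D. near (Suc D) (real (Suc D)) (horo x) (horo u)}" using A u by blast
      then have "card A \<le> card {x \<in> lattice_verts D. near (Suc D) (real (Suc D)) (horo x) (horo u)}"
        by (intro card_mono cnt(1))
      then show ?thesis using cnt(2) by linarith
    qed simp
  qed
  then show ?thesis using that by blast
qed

text \<open>Cubes on a horosphere have dimension \<open>D = d - 1\<close>. For \<open>d = 2\<close>
  the exponent is 0, so the logarithm in the plane needs another model.\<close>

lemma hyp_lower_power:
  fixes V :: "'v set"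
  assumes disc: "discretization V E (hyp_space d) (hyp_dist d)" and d: "2 \<le> d"
  obtains c where "0 < c" "\<And>n. 2 \<le> n \<Longrightarrow> c * real n powr ((real d - 2) / (real d - 1)) \<le> real (sep V E n)"
proof -
  define D where "D = d - 1"
  have D: "0 < D" "d = Suc D" using d by (auto simp: D_def)
  have e: "(real d - 2) / (real d - 1) = (real D - 1) / real D" using D(2) by simp
  show ?thesis
    unfolding e
  proof (rule hyp_lower[where y = horo and Q = "cube D" and \<Gamma> = "lattice_edges D" and h = "\<lambda>k. real k ^ (D - 1)"
        and V = V and E = E and d = d and g = "\<lambda>n. real n powr ((real D - 1) / real D)" and Ke = 1])
    show "horo q \<in> hyp_space d" if "q \<in> cube D k" for k q
      using that horo_hyp_space unfolding D(2) by (auto simp: cube_def)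
    show "near d 1 (horo p) (horo q)" if "(p, q) \<in> lattice_edges D" for p q
      using horo_edge[OF that] unfolding D(2) .
    show "\<exists>M. \<forall>k. \<forall>c\<in>hyp_space d. real (card {q \<in> cube D k. near d K (horo q) c}) \<le> M" if K: "0 \<le> K" for K
    proof (intro exI allI ballI)
      fix k and c :: "nat \<Rightarrow> real" assume "c \<in> hyp_space d"
      then have c: "0 < c 0" by (simp add: hyp_space_def)
      have "card {q \<in> cube D k. near d K (horo q) c} \<le> card {q \<in> lattice_verts D. near d K (horo q) c}"
        unfolding D(2) by (intro card_mono horo_count(1)[where c = c, OF K c]) (auto simp: cube_def)
      then show "real (card {q \<in> cube D k. near d K (horo q) c}) \<le> (2 * (K + 2) + 1) ^ D"
        using horo_count(2)[where c = c and D = D, OF K c] unfolding D(2) by linarith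
    qed
    show "filterlim (\<lambda>k. real (card (cube D k))) at_top sequentially" by (rule cube_unbounded[OF D(1)])
    show "0 < d" using D by simp
    show "c > 0 \<Longrightarrow> (\<And>n. 2 \<le> n \<Longrightarrow> c * real n powr ((real D - 1) / real D) \<le> real (sep V E n)) \<Longrightarrow> thesis" for c
      using that unfolding e by blast
  qed (fact disc finite_cube cube_mono cube_growth cube_expansion_rate[OF D(1)] cube_profile[OF D(1)] | simp)+
qed

section \<open>The tree in the hyperbolic plane\<close>

definition level :: "nat \<Rightarrow> nat" where
  "level v = (LEAST j. v < 2 ^ Suc j)"

lemma level_bounds:
  assumes "0 < v"
  shows "2 ^ level v \<le> v" "v < 2 ^ Suc (level v)"
proof -
  obtain J where J: "2 ^ J \<le> v" "v < 2 ^ Suc J" using dyadic_bracket[of 2 v] assms by auto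
  have "level v = J"
    unfolding level_def
  proof (rule Least_equality)
    fix j assume "v < 2 ^ Suc j"
    then have "(2::nat) ^ J < 2 ^ Suc j" using J(1) by linarith
    then have "J < Suc j" by (rule power_less_imp_less_exp[rotated]) simp
    then show "J \<le> j" by simp
  qed (rule J(2))
  then show "2 ^ level v \<le> v" "v < 2 ^ Suc (level v)" using J by auto
qed

lemma level_eqI:
  assumes "2 ^ j \<le> v" "v < 2 ^ Suc j"
  shows "level v = j"
proof -
  have v: "0 < v" using assms(1) by (meson less_le_trans pos2 zero_less_power)
  have "(2::nat) ^ j < 2 ^ Suc (level v)" "(2::nat) ^ level v < 2 ^ Suc j"
    using level_bounds[OF v] assms by linarith+
  then have "j < Suc (level v)" "level v < Suc j"
    using power_less_imp_less_exp[of "2::nat" j "Suc (level v)"]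
      power_less_imp_less_exp[of "2::nat" "level v" "Suc j"] by simp_all
  then show ?thesis by simp
qed

text \<open>For \<open>v > 0\<close> this is the dyadic tiling over \<open>[1, 2)\<close>: spacing
  in a row equals its height, and the child \<open>2 * v\<close> sits at half the height of
  \<open>v\<close>, vertically below it.\<close>

definition tree_point :: "nat \<Rightarrow> nat \<Rightarrow> real" where
  "tree_point v i = (if i = 0 then 1 / 2 ^ level v else if i = 1 then real v / 2 ^ level v else 0)"

lemma tree_point_hyp_space: "tree_point v \<in> hyp_space 2"
  by (auto simp: tree_point_def hyp_space_def)

lemma near_2: "near 2 K x y \<longleftrightarrow> (x 0 - y 0)\<^sup>2 + (x 1 - y 1)\<^sup>2 \<le> K * x 0 * y 0"
  by (simp add: near_def numeral_2_eq_2)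

text \<open>If \<open>h\<close> is the parent's height, vertical and horizontal differences are at
  most \<open>h / 2\<close>, so the squares add up to at most \<open>h * h / 2\<close>, which is
  exactly the product of the heights.\<close>

lemma tree_point_parent:
  assumes "0 < v div 2"
  shows "near 2 1 (tree_point v) (tree_point (v div 2))"
proof -
  let ?u = "v div 2"
  have l: "level v = Suc (level ?u)"
    by (rule level_eqI) (use level_bounds[OF assms] in auto)
  define h where "h = 1 / (2::real) ^ level ?u"
  have h: "0 < h" by (simp add: h_def)
  have t: "tree_point v 0 = h / 2" "tree_point v 1 = real v * h / 2" "tree_point ?u 0 = h" "tree_point ?u 1 = real ?u * h"
    by (simp_all add: tree_point_def h_def l)
  have "\<bar>real v - 2 * real ?u\<bar> \<le> 1" by linarith
  then have "(real v - 2 * real ?u)\<^sup>2 \<le> 1" by (simp add: abs_square_le_1)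
  then have "(h / 2)\<^sup>2 * (real v - 2 * real ?u)\<^sup>2 \<le> (h / 2)\<^sup>2 * 1" by (intro mult_left_mono) auto
  then have "(h / 2 - h)\<^sup>2 + (real v * h / 2 - real ?u * h)\<^sup>2 \<le> h / 2 * h"
    by (simp add: power2_eq_square algebra_simps)
  then show ?thesis unfolding near_2 t by simp
qed

lemma tree_point_neighbour:
  assumes "level v = level u" "u = Suc v \<or> v = Suc u"
  shows "near 2 1 (tree_point u) (tree_point v)"
proof -
  define h where "h = 1 / (2::real) ^ level u"
  have t: "tree_point v 0 = h" "tree_point v 1 = real v * h" "tree_point u 0 = h" "tree_point u 1 = real u * h"
    by (simp_all add: tree_point_def h_def assms(1))
  have "(real u * h - real v * h)\<^sup>2 = h * h"
    using assms(2) by (auto simp: power2_eq_square algebra_simps)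
  then show ?thesis unfolding near_2 t by simp
qed

lemma tree_point_edge:
  assumes "(u, v) \<in> heap_edges"
  shows "near 2 1 (tree_point u) (tree_point v)"
  using assms unfolding heap_edges_def
proof clarify
  assume pos: "0 < u" "0 < v"
  assume "u = v div 2 \<or> v = u div 2 \<or>
     (\<exists>j. 2 ^ j \<le> u \<and> u < 2 ^ Suc j \<and> 2 ^ j \<le> v \<and> v < 2 ^ Suc j \<and> (u = Suc v \<or> v = Suc u))"
  then consider "u = v div 2" | "v = u div 2"
    | j where "2 ^ j \<le> u" "u < 2 ^ Suc j" "2 ^ j \<le> v" "v < 2 ^ Suc j" "u = Suc v \<or> v = Suc u" by blast
  then show ?thesis
  proof cases
    case 1
    then show ?thesis using tree_point_parent[of v] pos near_sym by auto
  next
    case 2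
    then show ?thesis using tree_point_parent[of u] pos by auto
  next
    case (3 j)
    then show ?thesis using level_eqI[of j u] level_eqI[of j v] by (intro tree_point_neighbour) simp
  qed
qed

text \<open>Being near \<open>c\<close> fixes the height up to a factor \<open>K + 2\<close> each
  way, so at most \<open>P\<close> consecutive levels occur; in each of them the position is fixed
  up to \<open>K + 2\<close> steps each way.\<close>

lemma tree_point_count:
  assumes K: "0 \<le> K"
  shows "\<exists>M. \<forall>k. \<forall>c\<in>hyp_space 2. real (card {q \<in> {1..k}. near 2 K (tree_point q) c}) \<le> M"
proof -
  obtain P :: nat where P: "(K + 2) * (K + 2) < 2 ^ P" using real_arch_pow[of 2 "(K + 2) * (K + 2)"] by auto
  have "real (card {q \<in> {1..k}. near 2 K (tree_point q) c}) \<le> real P * (2 * (K + 2) + 2)"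
    if c: "c \<in> hyp_space 2" for k c
  proof -
    let ?A = "{q \<in> {1..k}. near 2 K (tree_point q) c}"
    have c0: "0 < c 0" using c by (simp add: hyp_space_def)
    have tp: "0 < tree_point q 0" for q by (simp add: tree_point_def)
    show ?thesis
    proof (cases "?A = {}")
      case False
      \<comment> \<open>The smallest occurring level serves as reference, which avoids computing a
        level from \<open>c 0\<close>.\<close>
      define l0 where "l0 = Min (level ` ?A)"
      have "l0 \<in> level ` ?A" unfolding l0_def using False by (intro Min_in) auto
      then obtain q0 where q0: "q0 \<in> ?A" "level q0 = l0" by blast
      have lev: "level q \<in> {l0..<l0 + P}" if "q \<in> ?A" for q
      proof -
        have "l0 \<le> level q" unfolding l0_def using that by (intro Min_le) auto
        have "tree_point q0 0 \<le> (K + 2) * c 0" using near_height[of 2 K _ c] q0(1) tp c0 by auto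
        also have "c 0 \<le> (K + 2) * tree_point q 0"
          using near_height[of 2 K c "tree_point q"] that near_sym tp c0 by auto
        then have "(K + 2) * c 0 \<le> (K + 2) * ((K + 2) * tree_point q 0)" using K by (intro mult_left_mono) auto
        finally have "1 / 2 ^ l0 \<le> (K + 2) * (K + 2) / 2 ^ level q" using q0(2) by (simp add: tree_point_def)
        then have "2 ^ level q \<le> (K + 2) * (K + 2) * 2 ^ l0" by (simp add: field_simps)
        also have "\<dots> < 2 ^ P * 2 ^ l0" using P by (intro mult_strict_right_mono) auto
        finally have "(2::real) ^ level q < 2 ^ (P + l0)" by (simp add: power_add)
        then have "level q < P + l0" by (rule power_less_imp_less_exp[rotated]) simp
        then show ?thesis using \<open>l0 \<le> level q\<close> by simp
      qed
      have "?A \<subseteq> (\<Union>l\<in>{l0..<l0 + P}. {q. q < Suc k \<and> 2 ^ l * c 1 - (K + 2) \<le> real q \<and>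
          real q < 2 ^ l * c 1 - (K + 2) + (2 * (K + 2) + 1)})"
      proof
        fix q assume q: "q \<in> ?A"
        define l where "l = level q"
        have "\<bar>tree_point q 1 - c 1\<bar> \<le> (K + 2) * tree_point q 0"
          using q tp c0 by (intro near_coord_abs) auto
        then have "\<bar>real q / 2 ^ l - c 1\<bar> \<le> (K + 2) / 2 ^ l" by (simp add: tree_point_def l_def)
        then have "\<bar>real q / 2 ^ l - c 1\<bar> * 2 ^ l \<le> (K + 2) / 2 ^ l * 2 ^ l" by (intro mult_right_mono) auto
        moreover have "\<bar>real q / 2 ^ l - c 1\<bar> * 2 ^ l = \<bar>(real q / 2 ^ l - c 1) * 2 ^ l\<bar>" by (simp add: abs_mult)
        moreover have "(real q / 2 ^ l - c 1) * 2 ^ l = real q - 2 ^ l * c 1" by (simp add: algebra_simps)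
        ultimately have "\<bar>real q - 2 ^ l * c 1\<bar> \<le> K + 2" by simp
        then have "2 ^ l * c 1 - (K + 2) \<le> real q" "real q \<le> 2 ^ l * c 1 + (K + 2)"
          by (simp_all add: abs_le_iff)
        then have "2 ^ l * c 1 - (K + 2) \<le> real q" "real q < 2 ^ l * c 1 - (K + 2) + (2 * (K + 2) + 1)" by auto
        then show "q \<in> (\<Union>l\<in>{l0..<l0 + P}. {q. q < Suc k \<and> 2 ^ l * c 1 - (K + 2) \<le> real q \<and>
          real q < 2 ^ l * c 1 - (K + 2) + (2 * (K + 2) + 1)})"
          using q lev[OF q] unfolding l_def by auto
      qed
      then have "card ?A \<le> card (\<Union>l\<in>{l0..<l0 + P}. {q. q < Suc k \<and> 2 ^ l * c 1 - (K + 2) \<le> real q \<and>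
          real q < 2 ^ l * c 1 - (K + 2) + (2 * (K + 2) + 1)})"
        by (intro card_mono) auto
      also have "real \<dots> \<le> real (card {l0..<l0 + P}) * (2 * (K + 2) + 1 + 1)"
        using K by (intro real_card_UN_le card_nat_interval_le) auto
      finally show ?thesis by simp
    next
      case True
      then show ?thesis using K by (simp only: card.empty) simp
    qed
  qed
  then show ?thesis by blast
qed

lemma hyp_lower_log:
  fixes V :: "'v set"
  assumes disc: "discretization V E (hyp_space 2) (hyp_dist 2)"
  obtains c where "0 < c" "\<And>n. 2 \<le> n \<Longrightarrow> c * ln (real n) \<le> real (sep V E n)"
proof -
  show ?thesis
  proof (rule hyp_lower[where y = tree_point and Q = "\<lambda>k. {1..k}" and \<Gamma> = heap_edges and h = "\<lambda>k. ln (real k)"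
        and V = V and E = E and d = 2 and g = "\<lambda>n. ln (real n)" and Ke = 1])
    show "filterlim (\<lambda>k. real (card {1..k})) at_top sequentially"
      by (simp add: filterlim_real_sequentially)
    show "near 2 1 (tree_point p) (tree_point q)" if "(p, q) \<in> heap_edges" for p q
      by (rule tree_point_edge[OF that])
    show "\<exists>M. \<forall>k. \<forall>c\<in>hyp_space 2. real (card {q \<in> {1..k}. near 2 K (tree_point q) c}) \<le> M" if "0 \<le> K" for K
      by (rule tree_point_count[OF that])
    show "tree_point q \<in> hyp_space 2" for q by (rule tree_point_hyp_space)
    show "{1..k} \<subseteq> {1..Suc k}" "finite {1..k}" for k by auto
  qed (fact disc that heap_growth heap_expansion_rate heap_profile | simp)+
qed

section \<open>The lattice\<close>

lemma lattice_lower: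
  assumes D: "0 < D"
  obtains c where "0 < c"
    "\<And>n. 2 \<le> n \<Longrightarrow> c * real n powr ((real D - 1) / real D) \<le> real (sep (lattice_verts D) (lattice_edges D) n)"
proof -
  show ?thesis
  proof (rule sep_lower_expander[where K = "\<lambda>x. {x}" and V = "lattice_verts D" and E = "lattice_edges D"
        and \<Gamma> = "lattice_edges D" and Q = "cube D" and f = "\<lambda>k. real k ^ (D - 1)"
        and g = "\<lambda>n. real n powr ((real D - 1) / real D)" and L = 1 and M = 1])
    show "{q} \<subseteq> lattice_verts D \<and> finite {q} \<and> {q} \<noteq> {} \<and> real (card {q}) \<le> 1 \<and> conn (lattice_edges D) {q}"
      if "q \<in> cube D k" for k q
      using that by (auto simp: cube_def conn_def)
    show "\<exists>u\<in>{p}. \<exists>w\<in>{q}. u = w \<or> (u, w) \<in> lattice_edges D" if "(p, q) \<in> lattice_edges D" for p q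
      using that by simp
    show "real (card {q \<in> cube D k. v \<in> {q}}) \<le> 1" for k v
      using card_mono[of "{v}" "{q \<in> cube D k. v \<in> {q}}"] by auto
    show "\<exists>S\<subseteq>lattice_verts D. finite S \<and> card S = n \<and> conn (lattice_edges D) S" if n: "0 < n" for n
    proof -
      \<comment> \<open>Segments of the first axis are connected sets of every size.\<close>
      define e :: "int \<Rightarrow> nat \<Rightarrow> int" where "e c = (\<lambda>_. 0)(0 := c)" for c
      define S where "S = e ` {0..<int n}"
      have z: "(\<lambda>_. 0) \<in> lattice_verts D" by (simp add: lattice_verts_def)
      have inj: "inj_on e {0..<int n}" by (rule inj_onI) (metis e_def fun_upd_same)
      have up: "(e a, e b) \<in> (lattice_edges D \<inter> S \<times> S)\<^sup>*" if "0 \<le> a" "a \<le> b" "b < int n" for a b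
        unfolding e_def by (rule lattice_line[OF z D that(2)]) (use that in \<open>auto simp: S_def e_def\<close>)
      have symR: "sym ((lattice_edges D \<inter> S \<times> S)\<^sup>*)" by (intro sym_rtrancl sym_Restr sym_lattice_edges)
      have "conn (lattice_edges D) S"
        unfolding conn_def
      proof (intro ballI)
        fix u v assume "u \<in> S" "v \<in> S"
        then obtain a b where ab: "u = e a" "v = e b" "a \<in> {0..<int n}" "b \<in> {0..<int n}" by (auto simp: S_def)
        show "(u, v) \<in> (lattice_edges D \<inter> S \<times> S)\<^sup>*"
        proof (cases "a \<le> b")
          case True
          then show ?thesis using up[of a b] ab by auto
        next
          case False
          then show ?thesis using symD[OF symR up[of b a]] ab by auto
        qed
      qed
      moreover have "S \<subseteq> lattice_verts D" using D by (auto simp: S_def e_def lattice_verts_def)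
      moreover have "card S = n" using card_image[OF inj] by (simp add: S_def)
      moreover have "finite S" by (simp add: S_def)
      ultimately show ?thesis by blast
    qed
    show "filterlim (\<lambda>k. real (card (cube D k))) at_top sequentially" by (rule cube_unbounded[OF D])
  qed (fact that finite_cube cube_mono cube_growth cube_expansion_rate[OF D] cube_profile[OF D] | simp)+
qed

text \<open>In the half-space of dimension \<open>Suc D\<close> the exponent of
  \<open>sep_upper_power\<close> is \<open>(D - 1) / D\<close>. It asks for
  \<open>D \<ge> 2\<close>; on the line the heights in a box are summed directly.\<close>

lemma lattice_upper:
  assumes D: "0 < D"
  obtains C where "0 < C"
    "\<And>n. 2 \<le> n \<Longrightarrow> real (sep (lattice_verts D) (lattice_edges D) n) \<le> C * real n powr ((real D - 1) / real D)"
proof (cases "2 \<le> D")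
  case True
  obtain B where B: "sparse (Suc D) B horo (lattice_verts D)" by (rule horo_sparse)
  have pos: "0 < horo v 0" for v by (simp add: horo_def)
  have d: "3 \<le> Suc D" "(0::real) \<le> 1" using True by auto
  show ?thesis
    by (rule sep_upper_power[OF d sym_lattice_edges pos horo_edge B]) (assumption | rule that | simp)+
next
  case False
  then have D1: "D = 1" using D by simp
  have "real (sep (lattice_verts D) (lattice_edges D) n) \<le> 5 ^ 2 * (real 2 * (1 + 2) * (6 + 1))" if n: "2 \<le> n" for n
  proof (rule sep_le_weight[where F = horo])
    show "near 2 1 (horo u) (horo v)" if "(u, v) \<in> lattice_edges D" for u v
      using horo_edge[OF that] by (simp add: D1 numeral_2_eq_2)
    fix S :: "(nat \<Rightarrow> int) set" and a :: "nat \<Rightarrow> real" and t :: real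
    assume S: "S \<subseteq> lattice_verts D" "finite S" and t: "0 < t"
    let ?A = "{v \<in> S. horo v \<in> box 2 a (2 * t)}"
    have "(\<Sum>v\<in>?A. horo v 0) = real (card ?A)" by (simp add: horo_def)
    \<comment> \<open>An interval of length \<open>4 * t\<close> has at most
      \<open>4 * t + 1\<close> integers, which is at most \<open>6 * t\<close> if
      \<open>1 \<le> 2 * t\<close>. Otherwise the box ends below height 1.\<close>
    also have "\<dots> \<le> 6 * t"
    proof (cases "1 \<le> 2 * t")
      case True
      have "?A \<subseteq> {x \<in> lattice_verts 1. \<forall>i<1. x i \<in> {\<lceil>a 1 - 2 * t\<rceil>..\<lfloor>a 1 + 2 * t\<rfloor>}}"
      proof clarify
        fix x assume x: "x \<in> S" "horo x \<in> box 2 a (2 * t)"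
        then have "\<bar>real_of_int (x 0) - a 1\<bar> \<le> 2 * t" by (auto simp: box_def horo_def)
        then have "x 0 \<in> {\<lceil>a 1 - 2 * t\<rceil>..\<lfloor>a 1 + 2 * t\<rfloor>}" by (auto simp: ceiling_le_iff le_floor_iff)
        then show "x \<in> lattice_verts 1 \<and> (\<forall>i<1. x i \<in> {\<lceil>a 1 - 2 * t\<rceil>..\<lfloor>a 1 + 2 * t\<rfloor>})"
          using x(1) S(1) D1 by auto
      qed
      then have "card ?A \<le> card {x \<in> lattice_verts 1. \<forall>i<1. x i \<in> {\<lceil>a 1 - 2 * t\<rceil>..\<lfloor>a 1 + 2 * t\<rfloor>}}"
        by (intro card_mono lattice_box(1)) auto
      also have "\<dots> = card {\<lceil>a 1 - 2 * t\<rceil>..\<lfloor>a 1 + 2 * t\<rfloor>}"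
        by (subst lattice_box(2)) auto
      finally have "real (card ?A) \<le> 2 * (2 * t) + 1"
        using card_int_interval_le[of "2 * t" "a 1"] t by linarith
      then show ?thesis using True by linarith
    next
      case False
      then have "?A = {}" by (auto simp: box_def horo_def)
      then show ?thesis using t by (simp only: card.empty)
    qed
    finally show "(\<Sum>v\<in>?A. horo v 0) \<le> 6 * t" .
  qed (use n sym_lattice_edges in \<open>auto simp: horo_def\<close>)
  \<comment> \<open>For \<open>D = 1\<close> the exponent is 0 and \<open>n powr 0 = 1\<close>, so a
    constant bound is what is claimed.\<close>
  then show ?thesis by (intro that[of "5 ^ 2 * (real 2 * (1 + 2) * (6 + 1))"]) (auto simp: D1)
qed

section \<open>Upper bounds for discretizations, and the conclusion\<close>

lemma hyp_upper_log:
  fixes V :: "'v set"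
  assumes disc: "discretization V E (hyp_space 2) (hyp_dist 2)"
  obtains C where "0 < C" "\<And>n. 2 \<le> n \<Longrightarrow> real (sep V E n) \<le> C * ln (real n)"
proof -
  have EV: "E \<subseteq> V \<times> V" and symE: "sym E" and deg: "bounded_degree V E"
    using disc by (auto simp: discretization_def simple_graph_def)
  obtain f K where K: "0 \<le> K" and fV: "\<And>v. v \<in> V \<Longrightarrow> f v \<in> hyp_space 2"
    and lip: "\<And>u v. (u, v) \<in> E \<Longrightarrow> near 2 K (f u) (f v)"
    and proper: "\<And>K'. 0 \<le> K' \<Longrightarrow> \<exists>r. \<forall>u\<in>V. \<forall>v\<in>V. near 2 K' (f u) (f v) \<longrightarrow> v \<in> graph_ball E r u"
    by (rule discretization_map[OF disc], rule that, assumption+)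
  obtain B where B: "sparse 2 B f V" by (rule discretization_sparse[OF deg EV proper]) auto
  have pos: "0 < f v 0" if "v \<in> V" for v using fV[OF that] by (simp add: hyp_space_def)
  show ?thesis by (rule sep_upper_log[OF K symE pos lip B]) (assumption | rule that)+
qed

lemma hyp_upper_power:
  fixes V :: "'v set"
  assumes disc: "discretization V E (hyp_space d) (hyp_dist d)" and d: "3 \<le> d"
  obtains C where "0 < C" "\<And>n. 2 \<le> n \<Longrightarrow> real (sep V E n) \<le> C * real n powr ((real d - 2) / (real d - 1))"
proof -
  have EV: "E \<subseteq> V \<times> V" and symE: "sym E" and deg: "bounded_degree V E"
    using disc by (auto simp: discretization_def simple_graph_def)
  obtain f K where K: "0 \<le> K" and fV: "\<And>v. v \<in> V \<Longrightarrow> f v \<in> hyp_space d"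
    and lip: "\<And>u v. (u, v) \<in> E \<Longrightarrow> near d K (f u) (f v)"
    and proper: "\<And>K'. 0 \<le> K' \<Longrightarrow> \<exists>r. \<forall>u\<in>V. \<forall>v\<in>V. near d K' (f u) (f v) \<longrightarrow> v \<in> graph_ball E r u"
    by (rule discretization_map[OF disc], rule that, assumption+)
  obtain B where B: "sparse d B f V" by (rule discretization_sparse[OF deg EV proper]) auto
  have pos: "0 < f v 0" if "v \<in> V" for v using fV[OF that] by (simp add: hyp_space_def)
  show ?thesis by (rule sep_upper_power[OF d K symE pos lip B]) (assumption | rule that)+
qed

lemma same_growthI:
  assumes "0 < c" "\<And>n. 2 \<le> n \<Longrightarrow> c * g n \<le> f n" "0 < C" "\<And>n. 2 \<le> n \<Longrightarrow> f n \<le> C * g n"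
  shows "f \<asymp> g"
  unfolding same_growth_def using assms by blast

theorem proposition4p1:
  "(\<forall>(V :: 'v set) E. discretization V E (hyp_space 2) (hyp_dist 2) \<longrightarrow>
      (\<lambda>n. real (sep V E n)) \<asymp> (\<lambda>n. ln (real n))) \<and>
   (\<forall>d\<ge>3. \<forall>(V :: 'v set) E. discretization V E (hyp_space d) (hyp_dist d) \<longrightarrow>
      (\<lambda>n. real (sep V E n)) \<asymp> (\<lambda>n. real n powr ((real d - 2) / (real d - 1)))) \<and>
   (\<forall>d\<ge>1. (\<lambda>n. real (sep (lattice_verts d) (lattice_edges d) n))
             \<asymp> (\<lambda>n. real n powr ((real d - 1) / real d)))"
proof (intro conjI allI impI)
  fix V :: "'v set" and E
  assume disc: "discretization V E (hyp_space 2) (hyp_dist 2)"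
  obtain c where c: "0 < c" "\<And>n. 2 \<le> n \<Longrightarrow> c * ln (real n) \<le> real (sep V E n)"
    by (rule hyp_lower_log[OF disc], rule that, assumption+)
  obtain C where C: "0 < C" "\<And>n. 2 \<le> n \<Longrightarrow> real (sep V E n) \<le> C * ln (real n)"
    by (rule hyp_upper_log[OF disc], rule that, assumption+)
  show "(\<lambda>n. real (sep V E n)) \<asymp> (\<lambda>n. ln (real n))" by (rule same_growthI[OF c C])
next
  fix d and V :: "'v set" and E
  assume d: "3 \<le> d" and disc: "discretization V E (hyp_space d) (hyp_dist d)"
  have d2: "2 \<le> d" using d by simp
  obtain c where c: "0 < c"
    "\<And>n. 2 \<le> n \<Longrightarrow> c * real n powr ((real d - 2) / (real d - 1)) \<le> real (sep V E n)"
    by (rule hyp_lower_power[OF disc d2], rule that, assumption+)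
  obtain C where C: "0 < C"
    "\<And>n. 2 \<le> n \<Longrightarrow> real (sep V E n) \<le> C * real n powr ((real d - 2) / (real d - 1))"
    by (rule hyp_upper_power[OF disc d], rule that, assumption+)
  show "(\<lambda>n. real (sep V E n)) \<asymp> (\<lambda>n. real n powr ((real d - 2) / (real d - 1)))"
    by (rule same_growthI[OF c C])
next
  fix d :: nat assume "1 \<le> d"
  then have d: "0 < d" by simp
  let ?s = "\<lambda>n. real (sep (lattice_verts d) (lattice_edges d) n)"
  obtain c where c: "0 < c" "\<And>n. 2 \<le> n \<Longrightarrow> c * real n powr ((real d - 1) / real d) \<le> ?s n"
    by (rule lattice_lower[OF d], rule that, assumption+)
  obtain C where C: "0 < C" "\<And>n. 2 \<le> n \<Longrightarrow> ?s n \<le> C * real n powr ((real d - 1) / real d)"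
    by (rule lattice_upper[OF d], rule that, assumption+)
  show "?s \<asymp> (\<lambda>n. real n powr ((real d - 1) / real d))" by (rule same_growthI[OF c C])
qed

end
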